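(* Let $L>0$, $I_L=(0,L)$, let $\theta,\phi\in BV(I_L)$ with $\theta$ strictly increasing, and let $$\Omega(s)=\begin{pmatrix}0&\theta(s)&0\\-\theta(s)&0&\phi(s)\\0&-\phi(s)&0\end{pmatrix}.$$ Assume that the jump set $S(\Omega)=\{0<s_1<\dots<s_m<L\}$ is finite and that $d_k=\theta(s_k^+)-\theta(s_k^-)$, $\mathfrak t_k=\phi(s_k^+)-\phi(s_k^-)$ satisfy $0<\sqrt{d_k^2+\mathfrak t_k^2}<\pi$ for all $k=1,\dots,m$. Let $G$ be the solution described in the context, $\mathbf t=G\mathbf e_1$, $\mathbf b=G\mathbf e_3$, and $\mathbf c(s)=\int_0^s\mathbf t(\sigma)\,d\sigma$, $s\in[0,L]$. Then $$\mathrm{TC}(\mathbf c)\le|\bar D\mathbf t|(I_L)+2^{-1/2}|D^J\Omega|(I_L)\quad\text{and}\quad \mathrm{TAT}(\mathbf c)\le|\bar D\mathbf b|(I_L)+2^{-1/2}|D^J\Omega|(I_L).$$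
   Context: Notation. For a BV function $u$ on $I_L$: $u(s^\pm)$ one-sided limits, $u(0)=u(0^+)$, $S(u)$ the set of $s$ with $u(s^-)\neq u(s^+)$, $Du=\bar Du+D^Ju$ with $D^Ju=\sum_{s\in S(u)}(u(s^+)-u(s^-))\delta_s$ the jump part and $\bar Du$ the diffuse part (absolutely continuous plus Cantor). $|\cdot|(I_L)$ is total variation; matrices carry the Frobenius norm $|A|=\mathrm{tr}(A^\top A)^{1/2}$. $(\mathbf e_1,\mathbf e_2,\mathbf e_3)$ is the canonical basis of $\mathbb R^3$. $\mathbb J_1=\begin{pmatrix}0&0&0\\0&0&-1\\0&1&0\end{pmatrix}$, $\mathbb J_3=\begin{pmatrix}0&-1&0\\1&0&0\\0&0&0\end{pmatrix}$. The solution $G$. $G\in BV(I_L,\mathbb R^{3\times3})$, with $G(s)\in SO(3)$ for $s\in I_L\setminus S(\Omega)$, is the solution of $DG=-(G^\top)^{-1}(\bar D\Omega+D^{at}\Omega)$, $G(0)=\mathbb I_3$, where $D^{at}\Omega=-\sum_{k=1}^m\frac{\sin\sqrt{d_k^2+\mathfrak t_k^2}}{\sqrt{d_k^2+\mathfrak t_k^2}}(d_k\mathbb J_3+\mathfrak t_k\mathbb J_1)\delta_{s_k}$ (equality of measures; $G$ on the right is the precise representative $\frac12(G(s^+)+G(s^-))$, invertible for every $s$), obtained as follows: on each component of $I_L\setminus S(\Omega)$, $G$ is continuous and solves $DG=-G\,D\Omega$, and for each $k$ one has $G(s_k^+)=R_k\,G(s_k^-)$, where $R_k\in SO(3)$ is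 the rotation of angle $\sqrt{d_k^2+\mathfrak t_k^2}$ around the axis oriented by $G(s_k^-)\mathbf v_k$, $\mathbf v_k=(\mathfrak t_k,0,d_k)^\top/\sqrt{d_k^2+\mathfrak t_k^2}$. Total curvature and torsion. The rotation of a polygonal curve is the sum of the turning angles at its interior vertices; $\mathrm{TC}(\mathbf c)$ is the supremum of the rotations of polygonal curves inscribed in $\mathbf c$. For a (non-closed) polygonal $\mathbf p$ with vertices $v_0,\dots,v_n$, $n\ge3$, with segments $\sigma_i=[v_{i-1},v_i]$ of positive length and consecutive segments not aligned (assumed without loss of generality), $\widetilde{\mathrm{TAT}}(\mathbf p)=\sum_{i=2}^{n-1}\widetilde\tau_i$, where $\widetilde\tau_i\in[0,\pi/2]$ is the angle between the unoriented lines spanned by $\sigma_{i-1}\times\sigma_i$ and $\sigma_i\times\sigma_{i+1}$. The total absolute torsion is $\mathrm{TAT}(\mathbf c)=\lim_{\varepsilon\to0^+}\sup\{\widetilde{\mathrm{TAT}}(\mathbf p):\mathbf p\text{ inscribed in }\mathbf c,\ \mu_{\mathbf c}(\mathbf p)<\varepsilon\}$, where $\mu_{\mathbf c}(\mathbf p)$ is the maximum of the diameters of the arcs of $\mathbf c$ determined by consecutive vertices of $\mathbf p$. *)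

theory Defs
  imports "HOL-Analysis.Analysis"
begin

section \<open>Vector measures and functions of bounded variation on an interval\<close>

text \<open>
  A finite measure with values in a Euclidean space, on the Borel subsets of a Borel set E of
  reals, is a set function that has an integrable density f with respect to some finite positive
  measure \<nu> on E (polar decomposition). Its values outside the Borel subsets of E are irrelevant.
  Matrices of type real^3^3 are a Euclidean space whose norm is the Frobenius norm.
\<close>

definition has_density ::
  "real set \<Rightarrow> (real set \<Rightarrow> 'a::euclidean_space) \<Rightarrow> real measure \<Rightarrow> (real \<Rightarrow> 'a) \<Rightarrow> bool" where
  "has_density E \<mu> \<nu> f \<longleftrightarrow>
     finite_measure \<nu> \<and> sets \<nu> = sets (restrict_space borel E) \<and> integrable \<nu> f \<and>
     (\<forall>A\<in>sets \<nu>. \<mu> A = (LINT x:A|\<nu>. f x))"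

definition total_variation :: "real \<Rightarrow> (real set \<Rightarrow> 'a::euclidean_space) \<Rightarrow> ennreal" where
  "total_variation L \<mu> =
     (SUP A\<in>{A :: nat \<Rightarrow> real set. range A \<subseteq> sets borel \<and> disjoint_family A \<and> (\<Union>i. A i) = {0<..<L}}.
        \<Sum>i. ennreal (norm (\<mu> (A i))))"

text \<open>The measure \<eta> is the product H \<mu> of the matrix-valued measure \<mu> by the matrix function H on E.\<close>

definition is_product_measure ::
  "real set \<Rightarrow> (real \<Rightarrow> real^3^3) \<Rightarrow> (real set \<Rightarrow> real^3^3) \<Rightarrow> (real set \<Rightarrow> real^3^3) \<Rightarrow> bool" where
  "is_product_measure E H \<mu> \<eta> \<longleftrightarrow>
     (\<exists>\<nu> f. has_density E \<mu> \<nu> f \<and> has_density E \<eta> \<nu> (\<lambda>x. H x ** f x))"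

text \<open>Distributional derivative on (0,L), tested against compactly supported C1 functions g.\<close>

definition distr_deriv :: "real \<Rightarrow> (real \<Rightarrow> 'a::euclidean_space) \<Rightarrow> (real set \<Rightarrow> 'a) \<Rightarrow> bool" where
  "distr_deriv L u \<mu> \<longleftrightarrow>
     (\<exists>\<nu> f. has_density {0<..<L} \<mu> \<nu> f \<and>
        (\<forall>g g'. (\<forall>x. (g has_real_derivative g' x) (at x)) \<and> continuous_on UNIV g' \<and>
                (\<exists>a b. 0 < a \<and> b < L \<and> (\<forall>x. x \<notin> {a..b} \<longrightarrow> g x = 0)) \<longrightarrow>
                (LINT x:{0<..<L}|lborel. g' x *\<^sub>R u x) = - (LINT x|\<nu>. g x *\<^sub>R f x)))"

text \<open>
  BV functions on (0,L) are represented by functions that have one-sided limits everywhere; every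
  BV class contains such a function, and the limits do not depend on its choice.
\<close>

definition BV :: "real \<Rightarrow> (real \<Rightarrow> 'a::euclidean_space) \<Rightarrow> bool" where
  "BV L u \<longleftrightarrow>
     set_integrable lborel {0<..<L} u \<and> (\<exists>\<mu>. distr_deriv L u \<mu>) \<and>
     (\<forall>s\<in>{0<..L}. \<exists>l. (u \<longlongrightarrow> l) (at_left s)) \<and>
     (\<forall>s\<in>{0..<L}. \<exists>l. (u \<longlongrightarrow> l) (at_right s))"

text \<open>The derivative of a BV function is unique on the Borel subsets of (0,L).\<close>

definition deriv_measure :: "real \<Rightarrow> (real \<Rightarrow> 'a::euclidean_space) \<Rightarrow> real set \<Rightarrow> 'a" where
  "deriv_measure L u = (SOME \<mu>. distr_deriv L u \<mu>)"

definition lim_left :: "(real \<Rightarrow> 'a::t2_space) \<Rightarrow> real \<Rightarrow> 'a" where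
  "lim_left u s = Lim (at_left s) u"

definition lim_right :: "(real \<Rightarrow> 'a::t2_space) \<Rightarrow> real \<Rightarrow> 'a" where
  "lim_right u s = Lim (at_right s) u"

definition jump :: "(real \<Rightarrow> 'a::euclidean_space) \<Rightarrow> real \<Rightarrow> 'a" where
  "jump u s = lim_right u s - lim_left u s"

definition jump_set :: "real \<Rightarrow> (real \<Rightarrow> 'a::euclidean_space) \<Rightarrow> real set" where
  "jump_set L u = {s\<in>{0<..<L}. lim_left u s \<noteq> lim_right u s}"

definition jump_part :: "real \<Rightarrow> (real \<Rightarrow> 'a::euclidean_space) \<Rightarrow> real set \<Rightarrow> 'a" where
  "jump_part L u A = infsum (jump u) (jump_set L u \<inter> A)"

definition diffuse_part :: "real \<Rightarrow> (real \<Rightarrow> 'a::euclidean_space) \<Rightarrow> real set \<Rightarrow> 'a" where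
  "diffuse_part L u A = deriv_measure L u A - jump_part L u A"

definition precise_rep :: "(real \<Rightarrow> 'a::euclidean_space) \<Rightarrow> real \<Rightarrow> 'a" where
  "precise_rep u s = (1/2) *\<^sub>R (lim_right u s + lim_left u s)"


section \<open>The frame equation\<close>

definition J1 :: "real^3^3" where
  "J1 = vector [vector [0, 0, 0], vector [0, 0, -1], vector [0, 1, 0]]"

definition J3 :: "real^3^3" where
  "J3 = vector [vector [0, -1, 0], vector [1, 0, 0], vector [0, 0, 0]]"

definition Omega :: "(real \<Rightarrow> real) \<Rightarrow> (real \<Rightarrow> real) \<Rightarrow> real \<Rightarrow> real^3^3" where
  "Omega \<theta> \<phi> s = vector [vector [0, \<theta> s, 0], vector [- \<theta> s, 0, \<phi> s], vector [0, - \<phi> s, 0]]"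

definition jump_angle :: "(real \<Rightarrow> real) \<Rightarrow> (real \<Rightarrow> real) \<Rightarrow> real \<Rightarrow> real" where
  "jump_angle \<theta> \<phi> s = sqrt ((jump \<theta> s)\<^sup>2 + (jump \<phi> s)\<^sup>2)"

definition jump_axis :: "(real \<Rightarrow> real) \<Rightarrow> (real \<Rightarrow> real) \<Rightarrow> real \<Rightarrow> real^3" where
  "jump_axis \<theta> \<phi> s = (1 / jump_angle \<theta> \<phi> s) *\<^sub>R vector [jump \<phi> s, 0, jump \<theta> s]"

definition atomic_part ::
  "real \<Rightarrow> (real \<Rightarrow> real) \<Rightarrow> (real \<Rightarrow> real) \<Rightarrow> real set \<Rightarrow> real^3^3" where
  "atomic_part L \<theta> \<phi> A =
     - (\<Sum>s\<in>jump_set L (Omega \<theta> \<phi>) \<inter> A.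
          (sin (jump_angle \<theta> \<phi> s) / jump_angle \<theta> \<phi> s) *\<^sub>R (jump \<theta> s *\<^sub>R J3 + jump \<phi> s *\<^sub>R J1))"

text \<open>Rodrigues' formula for the rotation of angle \<alpha> around the axis oriented by the unit vector a.\<close>

definition rotation_about :: "real^3 \<Rightarrow> real \<Rightarrow> real^3^3" where
  "rotation_about a \<alpha> =
     matrix (\<lambda>x. cos \<alpha> *\<^sub>R x + sin \<alpha> *\<^sub>R cross3 a x + ((1 - cos \<alpha>) * (a \<bullet> x)) *\<^sub>R a)"

text \<open>
  The measure equation alone does not single out G, since the sine does not distinguish an angle
  in (0, pi) from its supplement; the last three conditions say which solution is meant.
\<close>

definition frame_solution ::
  "real \<Rightarrow> (real \<Rightarrow> real) \<Rightarrow> (real \<Rightarrow> real) \<Rightarrow> (real \<Rightarrow> real^3^3) \<Rightarrow> bool" where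
  "frame_solution L \<theta> \<phi> G \<longleftrightarrow>
     BV L G \<and>
     (\<forall>s\<in>{0<..<L} - jump_set L (Omega \<theta> \<phi>). rotation_matrix (G s)) \<and>
     (\<forall>s\<in>{0<..<L}. invertible (precise_rep G s)) \<and>
     is_product_measure {0<..<L}
       (\<lambda>s. - matrix_inv (transpose (precise_rep G s)))
       (\<lambda>A. diffuse_part L (Omega \<theta> \<phi>) A + atomic_part L \<theta> \<phi> A)
       (deriv_measure L G) \<and>
     lim_right G 0 = mat 1 \<and>
     continuous_on ({0<..<L} - jump_set L (Omega \<theta> \<phi>)) G \<and>
     is_product_measure ({0<..<L} - jump_set L (Omega \<theta> \<phi>))
       (\<lambda>s. - G s) (deriv_measure L (Omega \<theta> \<phi>)) (deriv_measure L G) \<and>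
     (\<forall>s\<in>jump_set L (Omega \<theta> \<phi>).
        lim_right G s =
          rotation_about (lim_left G s *v jump_axis \<theta> \<phi> s) (jump_angle \<theta> \<phi> s) ** lim_left G s)"


section \<open>Total curvature and total absolute torsion\<close>

definition vec_angle :: "real^3 \<Rightarrow> real^3 \<Rightarrow> real" where
  "vec_angle x y = arccos ((x \<bullet> y) / (norm x * norm y))"

definition line_angle :: "real^3 \<Rightarrow> real^3 \<Rightarrow> real" where
  "line_angle x y = arccos (\<bar>x \<bullet> y\<bar> / (norm x * norm y))"

text \<open>
  A polygonal curve is given by the list of its vertices. Repeated consecutive vertices are
  identified, so that all segments have positive length.
\<close>

definition segments :: "(real^3) list \<Rightarrow> (real^3) list" where
  "segments vs = (let ws = remdups_adj vs in map2 (-) (tl ws) ws)"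

definition rotation_poly :: "(real^3) list \<Rightarrow> real" where
  "rotation_poly vs = sum_list (map2 vec_angle (segments vs) (tl (segments vs)))"

text \<open>
  Merging two consecutive segments pointing in the same direction deletes a zero vector from the
  list of cross products and only rescales the others; hence skipping the zero vectors
  amounts to assuming that consecutive segments are not aligned.
\<close>

definition TAT_poly :: "(real^3) list \<Rightarrow> real" where
  "TAT_poly vs =
     (let ns = filter (\<lambda>n. n \<noteq> 0) (map2 cross3 (segments vs) (tl (segments vs)))
      in sum_list (map2 line_angle ns (tl ns)))"

text \<open>Inscribed polygonal curves are given by the parameters of their vertices.\<close>

definition inscribed :: "real \<Rightarrow> real list \<Rightarrow> bool" where
  "inscribed L ts \<longleftrightarrow> sorted_wrt (<) ts \<and> set ts \<subseteq> {0..L} \<and> length ts \<ge> 2"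

definition mesh :: "(real \<Rightarrow> real^3) \<Rightarrow> real list \<Rightarrow> real" where
  "mesh c ts = Max ((\<lambda>i. diameter (c ` {ts ! i..ts ! Suc i})) ` {i. Suc i < length ts})"

definition TC :: "real \<Rightarrow> (real \<Rightarrow> real^3) \<Rightarrow> ennreal" where
  "TC L c = (SUP ts\<in>{ts. inscribed L ts}. ennreal (rotation_poly (map c ts)))"

definition TAT :: "real \<Rightarrow> (real \<Rightarrow> real^3) \<Rightarrow> ennreal" where
  "TAT L c = Lim (at_right (0::real))
     (\<lambda>\<epsilon>. SUP ts\<in>{ts. inscribed L ts \<and> mesh c ts < \<epsilon>}. ennreal (TAT_poly (map c ts)))"

end

theory Submission
  imports Defs
begin

text \<open>
  Both inequalities rest on corner cutting on the sphere: inserting a direction into a sequence of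
  directions does not decrease its total turning, and replacing two consecutive directions by a
  positive combination of them does not increase it.

  The segments of an inscribed polygon are positive combinations of tangents, taken in order, so the
  polygon turns at most as much as a fine sample of the tangent; at a jump the tangent turns by at
  most the rotation angle.

  For the torsion, consecutive segments have the cross product of the integrals of t over two
  adjacent intervals, that is a positive combination of the vectors cross3 (t s) (t r) with s < r.
  Since dt = n d\<theta> and t, n, b is a frame, this is the integral of b against d\<theta> weighted by a tent
  over the two intervals, up to a relative error of second order (the oscillation of \<theta> times the
  variation of n over the window), which is summable over the polygon with sum tending to 0. The
  tents overlap, but their weights are ordered by likelihood ratio, and such overlapping averages
  still arise from a fine sample of b by corner cutting. At a jump of angle \<alpha> the two one-sided
  tangents span a plane whose normal \<nu> is within \<alpha>/2 of both one-sided binormals; a window across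
  the jump averages b and \<nu>, so that the jump costs at most \<alpha>.
\<close>

section \<open>Angles between vectors\<close>

text \<open>The obstacle is that an inscribed polygon may have arbitrarily many vertices, so an
  error that is merely small per window is useless: summed over the polygon it must be a small
  factor times increments of one fixed bounded function. The first-order error indeed disappears. In
  the cross product of t(s) with dt(r) = n(r) d\<theta>(r), replacing t(s) by t(r) leaves the
  product of t(s) - t(r) with n(r); this difference is a multiple of n(r) up to the variation of n,
  and the multiple is annihilated. Errors must moreover be small relative to the averaged vector,
  which might cancel. It does not: all binormals of a short window lie in a cone around one
  direction, across a jump around \<nu>, and \<alpha> < pi keeps cos (\<alpha>/2) positive. Two
  scales occur: one depends on the admissible error alone and becomes the mesh bound, the other is
  chosen after the polygon, for the partition that turns integrals into finite sums. The factor
  2^(-1/2) comes from the Frobenius norm: a rotation by \<alpha> belongs to a jump of \<Omega> of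
  norm sqrt 2 times \<alpha>.\<close>

lemma abs_inner_sgn_le: "\<bar>sgn x \<bullet> sgn y\<bar> \<le> 1" for x y :: "'a::real_inner"
  using Cauchy_Schwarz_ineq2[of "sgn x" "sgn y"] by (auto simp: norm_sgn split: if_splits)

lemma vec_angle_sgn: "vec_angle x y = arccos (sgn x \<bullet> sgn y)"
  by (simp add: vec_angle_def sgn_div_norm divide_inverse mult_ac)

lemma cos_vec_angle: "cos (vec_angle x y) = sgn x \<bullet> sgn y"
  using abs_inner_sgn_le[of x y] by (simp add: vec_angle_sgn cos_arccos_abs)

lemma vec_angle_nonneg: "0 \<le> vec_angle x y"
  and vec_angle_le_pi: "vec_angle x y \<le> pi"
  using abs_inner_sgn_le[of x y] by (simp_all add: vec_angle_sgn arccos_lbound arccos_ubound abs_le_iff)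

lemma vec_angle_commute: "vec_angle x y = vec_angle y x"
  by (simp add: vec_angle_sgn inner_commute)

lemma vec_angle_refl: "x \<noteq> 0 \<Longrightarrow> vec_angle x x = 0"
  by (simp add: vec_angle_def dot_square_norm power2_eq_square)

lemma vec_angle_scale [simp]:
  assumes "0 < c"
  shows "vec_angle (c *\<^sub>R x) y = vec_angle x y" and "vec_angle x (c *\<^sub>R y) = vec_angle x y"
  using assms by (simp_all add: vec_angle_sgn sgn_scaleR)

lemma vec_angle_le_cos:
  assumes "cos a \<le> sgn x \<bullet> sgn y" "0 \<le> a"
  shows "vec_angle x y \<le> a"
proof (cases "a \<le> pi")
  case True
  then have "arccos (sgn x \<bullet> sgn y) \<le> arccos (cos a)"
    using assms abs_inner_sgn_le[of x y] by (intro arccos_le_arccos) auto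
  then show ?thesis using True assms by (simp add: vec_angle_sgn arccos_cos)
qed (use vec_angle_le_pi[of x y] in linarith)

lemma vec_angle_eq_cos:
  assumes "cos a = sgn x \<bullet> sgn y" "0 \<le> a" "a \<le> pi"
  shows "vec_angle x y = a"
  using assms by (metis vec_angle_sgn arccos_cos)

lemma line_angle_le_vec_angle: "line_angle x y \<le> vec_angle x y"
proof -
  have "line_angle x y = arccos \<bar>sgn x \<bullet> sgn y\<bar>"
    by (simp add: line_angle_def sgn_div_norm divide_inverse mult_ac abs_mult)
  then show ?thesis
    using abs_inner_sgn_le[of x y] by (auto simp: vec_angle_sgn intro!: arccos_le_arccos)
qed

lemma sin_vec_angle_nonneg: "0 \<le> sin (vec_angle x y)"
  by (simp add: sin_ge_zero vec_angle_le_pi vec_angle_nonneg)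

lemma norm_perp_eq_sin_vec_angle:
  assumes "x \<noteq> 0" "y \<noteq> 0"
  shows "norm (sgn x - (sgn x \<bullet> sgn y) *\<^sub>R sgn y) = sin (vec_angle x y)"
proof -
  have [simp]: "sgn x \<bullet> sgn x = 1" "sgn y \<bullet> sgn y = 1"
    using assms by (simp_all add: norm_sgn flip: norm_eq_1)
  have "(norm (sgn x - (sgn x \<bullet> sgn y) *\<^sub>R sgn y))\<^sup>2 = 1 - (sgn x \<bullet> sgn y)\<^sup>2"
    unfolding power2_norm_eq_inner
    by (simp add: inner_diff_left inner_diff_right inner_commute power2_eq_square)
  also have "\<dots> = (sin (vec_angle x y))\<^sup>2"
    using sin_squared_eq[of "vec_angle x y"] by (simp add: cos_vec_angle)
  finally show ?thesis using sin_vec_angle_nonneg by (simp add: power2_eq_iff_nonneg)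
qed

text \<open>Splitting both directions into their parts along and orthogonal to y is the cosine rule
  on the sphere; comparing it with the addition formula of the cosine yields both the triangle
  inequality and its equality case.\<close>

lemma inner_sgn_split:
  fixes x y z :: "'a::real_inner"
  assumes "y \<noteq> 0"
  shows "sgn x \<bullet> sgn z = (sgn x \<bullet> sgn y) * (sgn z \<bullet> sgn y)
    + (sgn x - (sgn x \<bullet> sgn y) *\<^sub>R sgn y) \<bullet> (sgn z - (sgn z \<bullet> sgn y) *\<^sub>R sgn y)"
proof -
  have "sgn y \<bullet> sgn y = 1"
    using assms by (simp add: norm_sgn flip: norm_eq_1)
  then show ?thesis by (simp add: inner_diff_left inner_diff_right inner_commute)
qed

lemma vec_angle_triangle:
  assumes "x \<noteq> 0" "y \<noteq> 0" "z \<noteq> 0"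
  shows "vec_angle x z \<le> vec_angle x y + vec_angle y z"
proof (rule vec_angle_le_cos)
  let ?p = "sgn x - (sgn x \<bullet> sgn y) *\<^sub>R sgn y" and ?q = "sgn z - (sgn z \<bullet> sgn y) *\<^sub>R sgn y"
  \<comment> \<open>Cauchy-Schwarz for the parts orthogonal to y, whose lengths are the
    sines.\<close>
  have "- (?p \<bullet> ?q) \<le> sin (vec_angle x y) * sin (vec_angle z y)"
    using Cauchy_Schwarz_ineq2[of ?p ?q] assms by (simp add: norm_perp_eq_sin_vec_angle)
  then show "cos (vec_angle x y + vec_angle y z) \<le> sgn x \<bullet> sgn z"
    unfolding cos_add inner_sgn_split[OF assms(2), of x z]
    by (simp add: cos_vec_angle vec_angle_commute[of y z] inner_commute[of "sgn y"])
qed (simp add: vec_angle_nonneg)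

text \<open>The equality case: the parts of a and b orthogonal to \<open>a + b\<close> are
  antiparallel, so Cauchy-Schwarz is sharp. The cosine of the sum then identifies the sum with the
  angle once it is known not to exceed pi.\<close>

lemma vec_angle_add_between:
  assumes "a \<noteq> 0" "b \<noteq> 0" "a + b \<noteq> 0"
  shows "vec_angle a (a + b) + vec_angle (a + b) b = vec_angle a b"
proof -
  define v where "v = a + b"
  have v: "v \<noteq> 0" using assms by (simp add: v_def)
  have vv: "sgn v \<bullet> sgn v = 1" using v by (simp add: norm_sgn flip: norm_eq_1)
  let ?p = "sgn a - (sgn a \<bullet> sgn v) *\<^sub>R sgn v" and ?q = "sgn b - (sgn b \<bullet> sgn v) *\<^sub>R sgn v"
  have na: "norm a *\<^sub>R sgn a = a" and nb: "norm b *\<^sub>R sgn b = b" and nv: "norm v *\<^sub>R sgn v = v"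
    using assms v by (simp_all add: sgn_div_norm)
  have "norm a *\<^sub>R ?p + norm b *\<^sub>R ?q = v - ((norm a *\<^sub>R sgn a + norm b *\<^sub>R sgn b) \<bullet> sgn v) *\<^sub>R sgn v"
    by (simp add: scaleR_diff_right na nb v_def inner_add_left scaleR_add_left flip: inner_scaleR_left)
  also have "\<dots> = v - (v \<bullet> sgn v) *\<^sub>R sgn v" by (simp add: na nb v_def)
  also have "v \<bullet> sgn v = norm v" using nv vv by (metis inner_scaleR_left mult.right_neutral)
  finally have pq: "norm a *\<^sub>R ?p = - (norm b *\<^sub>R ?q)" using nv by (simp add: eq_neg_iff_add_eq_0)
  have q: "?q = - ((norm a / norm b) *\<^sub>R ?p)"
  proof -
    have "?q = (1 / norm b) *\<^sub>R (norm b *\<^sub>R ?q)" using assms by simp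
    also have "norm b *\<^sub>R ?q = - (norm a *\<^sub>R ?p)" using pq by simp
    finally show ?thesis by simp
  qed
  have "?p \<bullet> ?q = - (norm ?p * norm ?q)"
    unfolding q by (simp add: power2_norm_eq_inner[symmetric] power2_eq_square)
  then have pq': "?p \<bullet> ?q = - (sin (vec_angle a v) * sin (vec_angle b v))"
    using assms v by (simp add: norm_perp_eq_sin_vec_angle)
  have "cos (vec_angle a v + vec_angle v b) = sgn a \<bullet> sgn b"
    unfolding cos_add inner_sgn_split[OF v, of a b] pq'
    by (simp add: cos_vec_angle vec_angle_commute[of v b] inner_commute[of "sgn v"])
  \<comment> \<open>The cosines of the two angles have a nonnegative sum: up to the positive factor
    \<open>norm v\<close> it equals
    \<open>(norm a + norm b) * (1 + sgn a \<bullet> sgn b)\<close>.\<close>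
  moreover have "vec_angle a v + vec_angle v b \<le> pi"
  proof -
    have "norm v * (sgn v \<bullet> sgn a + sgn v \<bullet> sgn b) = (norm a *\<^sub>R sgn a + norm b *\<^sub>R sgn b) \<bullet> (sgn a + sgn b)"
      unfolding na nb using nv by (simp add: v_def[symmetric] inner_add_right distrib_left flip: inner_scaleR_left)
    also have "\<dots> = (norm a + norm b) * (1 + sgn a \<bullet> sgn b)"
    proof -
      have "sgn a \<bullet> sgn a = 1" "sgn b \<bullet> sgn b = 1"
        using assms by (simp_all add: norm_sgn flip: norm_eq_1)
      then show ?thesis by (simp add: algebra_simps inner_add_left inner_add_right inner_commute)
    qed
    also have "\<dots> \<ge> 0" using abs_inner_sgn_le[of a b] by (intro mult_nonneg_nonneg) auto
    finally have "0 \<le> sgn v \<bullet> sgn a + sgn v \<bullet> sgn b" using v by (simp add: zero_le_mult_iff)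
    then have "cos (pi - vec_angle v b) \<le> cos (vec_angle a v)"
      by (simp add: cos_diff cos_vec_angle inner_commute)
    then show ?thesis
      using vec_angle_nonneg[of v b] vec_angle_nonneg[of a v] vec_angle_le_pi[of v b] vec_angle_le_pi[of a v]
      by (subst (asm) cos_mono_le_eq) auto
  qed
  ultimately show ?thesis
    using vec_angle_eq_cos[of "vec_angle a v + vec_angle v b" a b] by (simp add: v_def vec_angle_nonneg)
qed

lemma norm_diff_eq_sin_vec_angle:
  assumes "norm u = 1" "norm v = 1"
  shows "norm (u - v) = 2 * sin (vec_angle u v / 2)"
proof -
  let ?a = "vec_angle u v"
  have "u \<bullet> u = 1" "v \<bullet> v = 1" "sgn u = u" "sgn v = v"
    using assms by (simp_all add: sgn_div_norm flip: norm_eq_1)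
  then have "(norm (u - v))\<^sup>2 = 2 - 2 * cos ?a"
    by (simp add: cos_vec_angle power2_norm_eq_inner inner_diff_left inner_diff_right inner_commute)
  also have "\<dots> = (2 * sin (?a/2))\<^sup>2"
    using cos_double_sin[of "?a/2"] by (simp add: power_mult_distrib)
  finally show ?thesis
    using vec_angle_nonneg[of u v] vec_angle_le_pi[of u v]
    by (subst (asm) power2_eq_iff_nonneg) (auto intro!: sin_ge_zero)
qed

lemma vec_angle_le_chord:
  assumes "norm u = 1" "norm v = 1"
  shows "vec_angle u v \<le> pi / 2 * norm (u - v)"
proof -
  define a where "a = vec_angle u v"
  have a: "0 \<le> a" "a \<le> pi" by (simp_all add: a_def vec_angle_nonneg vec_angle_le_pi)
  have n: "norm (u - v) = 2 * sin (a/2)"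
    using norm_diff_eq_sin_vec_angle[OF assms] by (simp add: a_def)
  \<comment> \<open>Jordan's inequality \<open>2 / pi * z \<le> sin z\<close> on the interval from 0
    to pi/2, obtained from concavity and used at \<open>z = a / 2\<close>.\<close>
  have "concave_on {0..pi/2} sin"
    by (rule f''_le0_imp_concave[where f' = cos and f'' = "\<lambda>x. - sin x"])
      (auto intro!: derivative_eq_intros sin_ge_zero)
  from concave_onD[OF this, of "a/pi" 0 "pi/2"] have "a/pi * 1 \<le> sin (a / 2)"
    using a by (simp add: field_simps)
  then show ?thesis
    using n a by (simp add: a_def field_simps)
qed

text \<open>Normalising at most doubles the relative distance, and the chord bound contributes pi/2.
  Only the length of x enters: a lower bound for one of the two vectors is enough.\<close>

lemma vec_angle_le_relative:
  assumes "x \<noteq> 0" "y \<noteq> 0"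
  shows "vec_angle x y \<le> pi * (norm (x - y) / norm x)"
proof -
  have "norm (sgn x - sgn y) \<le> 2 * (norm (x - y) / norm x)"
  proof -
    have "norm x *\<^sub>R (sgn x - sgn y) = (x - y) + (norm y - norm x) *\<^sub>R sgn y"
      using assms by (simp add: sgn_div_norm algebra_simps)
    then have "norm x * norm (sgn x - sgn y) = norm ((x - y) + (norm y - norm x) *\<^sub>R sgn y)"
      by (metis abs_norm_cancel norm_scaleR)
    also have "\<dots> \<le> norm (x - y) + \<bar>norm y - norm x\<bar>"
      by (rule order.trans[OF norm_triangle_ineq]) (simp add: norm_sgn assms)
    also have "\<dots> \<le> 2 * norm (x - y)"
      using norm_triangle_ineq3[of y x] by (simp add: norm_minus_commute)
    finally show ?thesis using assms by (simp add: field_simps)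
  qed
  then have "pi/2 * norm (sgn x - sgn y) \<le> pi/2 * (2 * (norm (x - y) / norm x))"
    by (intro mult_left_mono) auto
  also have "\<dots> = pi * (norm (x - y) / norm x)" by simp
  finally have "pi/2 * norm (sgn x - sgn y) \<le> pi * (norm (x - y) / norm x)" .
  moreover have "vec_angle x y = vec_angle (sgn x) (sgn y)"
    using assms by (simp add: vec_angle_sgn sgn_div_norm[of "sgn x"] sgn_div_norm[of "sgn y"] norm_sgn)
  ultimately show ?thesis
    using vec_angle_le_chord[of "sgn x" "sgn y"] assms by (simp add: norm_sgn del: times_divide_eq_right times_divide_eq_left)
qed

text \<open>Total variation bounds chords, not angles. The constant pi/2 of the crude bound would
  survive in the final inequality, whereas \<open>1 + \<epsilon>\<close> disappears in the
  limit.\<close>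

lemma vec_angle_le_chord_eps:
  assumes "0 < \<epsilon>"
  obtains \<delta> where "0 < \<delta>"
    "\<And>u v. norm u = 1 \<Longrightarrow> norm v = 1 \<Longrightarrow> norm (u - v) < \<delta> \<Longrightarrow> vec_angle u v \<le> (1 + \<epsilon>) * norm (u - v)"
proof -
  have "((\<lambda>x::real. sin x / x) \<longlongrightarrow> 1) (at 0)"
    using DERIV_sin[of "0::real"] by (simp add: has_field_derivative_iff)
  moreover have "1 / (1 + \<epsilon>) < 1" using assms by simp
  ultimately have "eventually (\<lambda>x::real. 1 / (1 + \<epsilon>) < sin x / x) (at 0)"
    by (rule order_tendstoD)
  then obtain d where d: "d > 0" "\<And>x::real. x \<noteq> 0 \<Longrightarrow> \<bar>x\<bar> < d \<Longrightarrow> 1 / (1 + \<epsilon>) < sin x / x"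
    unfolding eventually_at by (auto simp: dist_real_def)
  show thesis
  \<comment> \<open>With this threshold the crude bound already gives half the angle below
    d.\<close>
  proof (rule that[of "4 * d / pi"])
    show "0 < 4 * d / pi" using d by simp
    fix u v :: "real^3" assume uv: "norm u = 1" "norm v = 1" "norm (u - v) < 4 * d / pi"
    define a where "a = vec_angle u v"
    have a: "0 \<le> a" "a \<le> pi" by (simp_all add: a_def vec_angle_nonneg vec_angle_le_pi)
    have n: "norm (u - v) = 2 * sin (a/2)"
      using norm_diff_eq_sin_vec_angle[OF uv(1,2)] by (simp add: a_def)
    have "pi/2 * norm (u - v) < pi/2 * (4 * d / pi)" using uv by (intro mult_strict_left_mono) auto
    then have "a / 2 < d"
      using vec_angle_le_chord[OF uv(1,2)] unfolding a_def by simp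
    have "a \<le> (1 + \<epsilon>) * (2 * sin (a/2))"
    proof (cases "a = 0")
      case False
      then have "1 / (1 + \<epsilon>) < 2 * sin (a/2) / a"
        using d(2)[of "a/2"] a \<open>a / 2 < d\<close> by (simp add: mult.commute)
      then have "1 < (1 + \<epsilon>) * (2 * sin (a/2) / a)"
        using assms by (simp add: divide_less_eq mult.commute)
      then show ?thesis using False a by (simp add: less_divide_eq)
    qed simp
    then show "vec_angle u v \<le> (1 + \<epsilon>) * norm (u - v)"
      unfolding n a_def[symmetric] .
  qed
qed

section \<open>Rotation of a sequence of vectors\<close>

text \<open>The value u = 0 stands for the absence of an initial direction.\<close>

definition ang :: "real^3 \<Rightarrow> real^3 \<Rightarrow> real" where
  "ang u v = (if u = 0 \<or> v = 0 then 0 else vec_angle u v)"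

text \<open>A zero entry leaves the current direction unchanged, so vanishing segments and cross
  products need no separate treatment.\<close>

fun path_angle :: "real^3 \<Rightarrow> (real^3) list \<Rightarrow> real" where
  "path_angle u [] = 0"
| "path_angle u (z # zs) = (if z = 0 then path_angle u zs else ang u z + path_angle z zs)"

text \<open>
  Quantifying over the initial direction and the continuation makes the relation compatible with append.
\<close>

definition turns_less :: "(real^3) list \<Rightarrow> (real^3) list \<Rightarrow> bool" (infix "\<preceq>" 50) where
  "xs \<preceq> ys \<longleftrightarrow> (\<forall>u zs. path_angle u (xs @ zs) \<le> path_angle u (ys @ zs))"

lemma ang_nonneg: "0 \<le> ang u v"
  by (simp add: ang_def vec_angle_nonneg)

lemma ang_0 [simp]: "ang 0 v = 0" "ang u 0 = 0"
  by (simp_all add: ang_def)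

lemma ang_triangle: "v \<noteq> 0 \<Longrightarrow> ang u w \<le> ang u v + ang v w"
  using vec_angle_triangle[of u v w] by (auto simp: ang_def vec_angle_nonneg)

lemma path_angle_change: "a \<noteq> 0 \<Longrightarrow> path_angle u zs \<le> ang u a + path_angle a zs"
proof (induction zs arbitrary: u)
  case (Cons z zs)
  then show ?case using ang_triangle[of a u z] by auto
qed (simp add: ang_nonneg)

lemma turns_less_refl [simp]: "xs \<preceq> xs"
  by (simp add: turns_less_def)

lemma turns_less_trans [trans]: "xs \<preceq> ys \<Longrightarrow> ys \<preceq> zs \<Longrightarrow> xs \<preceq> zs"
  unfolding turns_less_def by (meson order.trans)

lemma turns_less_append_left: "xs \<preceq> ys \<Longrightarrow> ps @ xs \<preceq> ps @ ys"
proof (induction ps)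
  case (Cons p ps)
  then show ?case unfolding turns_less_def by simp
qed simp

lemma turns_less_append_right: "xs \<preceq> ys \<Longrightarrow> xs @ ps \<preceq> ys @ ps"
  unfolding turns_less_def by simp

lemma turns_less_append: "xs \<preceq> ys \<Longrightarrow> xs' \<preceq> ys' \<Longrightarrow> xs @ xs' \<preceq> ys @ ys'"
  by (meson turns_less_append_left turns_less_append_right turns_less_trans)

lemma turns_less_concat:
  "(\<And>i. i \<in> set is \<Longrightarrow> f i \<preceq> g i) \<Longrightarrow> concat (map f is) \<preceq> concat (map g is)"
  by (induction "is") (auto intro: turns_less_append)

text \<open>The inserting half of corner cutting; for one vector it is the triangle inequality in
  the form of \<open>path_angle_change\<close>.\<close>

lemma Nil_turns_less [simp]: "[] \<preceq> xs"
proof (induction xs)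
  case (Cons x xs)
  have "[] \<preceq> [x]" unfolding turns_less_def by (auto simp: path_angle_change)
  from turns_less_append[OF this Cons] show ?case by simp
qed simp

lemma turns_less_insert: "xs @ zs \<preceq> xs @ ys @ zs"
  using turns_less_append_left[OF turns_less_append_right[OF Nil_turns_less]] by auto

lemma zero_turns_less: "[0] \<preceq> []" by (simp add: turns_less_def)

lemma ang_scale [simp]: "0 < c \<Longrightarrow> ang (c *\<^sub>R x) y = ang x y" "0 < c \<Longrightarrow> ang x (c *\<^sub>R y) = ang x y"
  by (auto simp: ang_def)

lemma path_angle_scale [simp]: "0 < c \<Longrightarrow> path_angle (c *\<^sub>R u) zs = path_angle u zs"
  by (induction zs) auto

lemma turns_less_scale: "0 \<le> c \<Longrightarrow> [c *\<^sub>R a] \<preceq> [a]"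
proof (cases "c = 0")
  case True
  then show ?thesis using turns_less_trans[OF zero_turns_less Nil_turns_less] by simp
qed (auto simp: turns_less_def)

lemma scale_turns_less: "0 < c \<Longrightarrow> [a] \<preceq> [c *\<^sub>R a]"
  by (auto simp: turns_less_def)

lemma turns_less_dup: "[a, a] \<preceq> [a]"
  by (auto simp: turns_less_def ang_def vec_angle_refl)

text \<open>The cutting half. The sum lies on the arc from a to b, so the angle from a to b splits
  there; the detour from u via a and the detour from the sum via b use up the two pieces.\<close>

lemma turns_less_add: "[a + b] \<preceq> [a, b]"
proof (cases "a = 0 \<or> b = 0 \<or> a + b = 0")
  case True
  moreover have "[0] \<preceq> [a, b]" by (rule turns_less_trans[OF zero_turns_less]) simp
  moreover have "[x] \<preceq> [0, x]" "[x] \<preceq> [x, 0]" for x by (auto simp: turns_less_def)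
  ultimately show ?thesis by auto
next
  case False
  show ?thesis unfolding turns_less_def
  proof (intro allI)
    fix u zs
    have "ang u (a + b) \<le> ang u a + ang a (a + b)" using False by (intro ang_triangle) auto
    moreover have "path_angle (a + b) zs \<le> ang (a + b) b + path_angle b zs"
      using False by (intro path_angle_change) auto
    moreover have "ang a (a + b) + ang (a + b) b = ang a b"
      using False by (simp add: ang_def vec_angle_add_between)
    ultimately show "path_angle u ([a + b] @ zs) \<le> path_angle u ([a, b] @ zs)" using False by simp
  qed
qed

lemma turns_less_sum:
  assumes "\<And>l. l \<in> set ls \<Longrightarrow> 0 \<le> x l"
  shows "[\<Sum>l\<leftarrow>ls. x l *\<^sub>R a l] \<preceq> map a ls"
  using assms
proof (induction ls)
  case Nil
  then show ?case by (simp add: zero_turns_less)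
next
  case (Cons l ls)
  have "[x l *\<^sub>R a l + (\<Sum>l\<leftarrow>ls. x l *\<^sub>R a l)] \<preceq> [x l *\<^sub>R a l] @ [\<Sum>l\<leftarrow>ls. x l *\<^sub>R a l]"
    using turns_less_add by simp
  also have "\<dots> \<preceq> [a l] @ map a ls"
    using Cons by (intro turns_less_append turns_less_scale) auto
  finally show ?case by simp
qed

text \<open>
  Two weighted sums whose weights are ordered by likelihood ratio are obtained by corner cutting.
\<close>

lemma turns_less_pair:
  fixes x y :: "nat \<Rightarrow> real"
  assumes "p \<le> q" "\<And>l. l \<in> {p..<q} \<Longrightarrow> 0 \<le> x l" "\<And>l. l \<in> {p..<q} \<Longrightarrow> 0 \<le> y l"
    "\<And>i j. p \<le> i \<Longrightarrow> i < j \<Longrightarrow> j < q \<Longrightarrow> y i * x j \<le> y j * x i"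
  shows "[\<Sum>l=p..<q. x l *\<^sub>R a l, \<Sum>l=p..<q. y l *\<^sub>R a l] \<preceq> map a [p..<q]"
  using assms
proof (induction q arbitrary: x y rule: dec_induct)
  case base
  show ?case using turns_less_append[OF zero_turns_less zero_turns_less] by simp
next
  case (step q)
  let ?X = "\<Sum>l=p..<q. x l *\<^sub>R a l" and ?Y = "\<Sum>l=p..<q. y l *\<^sub>R a l"
  have single: "[\<Sum>l=p..<Suc q. z l *\<^sub>R a l] \<preceq> map a [p..<Suc q]"
    if "\<And>l. l \<in> {p..<Suc q} \<Longrightarrow> 0 \<le> z l" for z
    using turns_less_sum[of "[p..<Suc q]" z a] that
    by (simp del: upt_Suc sum.op_ivl_Suc add: interv_sum_list_conv_sum_set_nat)
  have nz: "0 \<le> x l" "0 \<le> y l" if "l \<in> {p..<Suc q}" for l using step.prems that by auto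
  show ?case
  proof (cases "x q = 0")
    \<comment> \<open>Then \<open>a q\<close> occurs in the second sum only and can be split off at
      the end.\<close>
    case True
    have "[?X, ?Y + y q *\<^sub>R a q] \<preceq> [?X] @ [?Y, y q *\<^sub>R a q]"
      using turns_less_append_left[OF turns_less_add, of "[?X]" ?Y "y q *\<^sub>R a q"] by simp
    also have "\<dots> = [?X, ?Y] @ [y q *\<^sub>R a q]" by simp
    also have "\<dots> \<preceq> map a [p..<q] @ [a q]"
      using step nz by (intro turns_less_append step.IH turns_less_scale) auto
    finally show ?thesis using True step.hyps by (simp add: atLeastLessThanSuc add.commute)
  next
    case False
    then have xq: "x q > 0" using nz(1)[of q] step.hyps by auto
    show ?thesis
    proof (cases "y q = 0")
      case True
      \<comment> \<open>Since \<open>x q\<close> is positive, the order of the ratios makes every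
        \<open>y l\<close> vanish together with \<open>y q\<close>.\<close>
      have "y l = 0" if "l \<in> {p..<Suc q}" for l
      proof (cases "l = q")
        case False
        then have "y l * x q \<le> 0" using step.prems(3)[of l q] that True by auto
        then show ?thesis using xq nz(2)[OF that] by (auto simp: mult_le_0_iff)
      qed (simp add: True)
      then have "(\<Sum>l=p..<Suc q. y l *\<^sub>R a l) = 0" by simp
      then have "[\<Sum>l=p..<Suc q. x l *\<^sub>R a l, \<Sum>l=p..<Suc q. y l *\<^sub>R a l] \<preceq> [\<Sum>l=p..<Suc q. x l *\<^sub>R a l]"
        using turns_less_append_left[OF zero_turns_less, of "[\<Sum>l=p..<Suc q. x l *\<^sub>R a l]"] by simp
      then show ?thesis using single nz(1) turns_less_trans by blast
    next
      case False
      then have yq: "y q > 0" using nz(2)[of q] step.hyps by auto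
      \<comment> \<open>r is the largest of the ratios \<open>y l / x l\<close>, so in P, which is r
        times the first sum minus the second, the last vector disappears and all weights stay
        nonnegative. Now r times the first sum is cut into P and Y, the repeated Y is merged, and
        \<open>a q\<close> is split off from Y; the remaining weights again have ordered
        ratios.\<close>
      define r where "r = y q / x q"
      have lam: "r > 0" using xq yq by (simp add: r_def)
      define P where "P = (\<Sum>l=p..<q. (r * x l - y l) *\<^sub>R a l)"
      define Y where "Y = ?Y + y q *\<^sub>R a q"
      have "r *\<^sub>R (?X + x q *\<^sub>R a q) = P + Y"
        using xq by (simp add: P_def Y_def scaleR_diff_left sum_subtractf scaleR_add_right
            scaleR_sum_right r_def)
      then have "[?X + x q *\<^sub>R a q, Y] \<preceq> [P + Y] @ [Y]"
        using turns_less_append_right[OF scale_turns_less[OF lam], of "?X + x q *\<^sub>R a q" "[Y]"] by simp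
      also have "\<dots> \<preceq> [P, Y] @ [Y]" by (intro turns_less_append_right turns_less_add)
      also have "\<dots> = [P] @ [Y, Y]" by simp
      also have "\<dots> \<preceq> [P] @ [Y]" by (intro turns_less_append_left turns_less_dup)
      also have "\<dots> \<preceq> [P] @ [?Y, y q *\<^sub>R a q]" unfolding Y_def by (intro turns_less_append_left turns_less_add)
      also have "\<dots> = [P, ?Y] @ [y q *\<^sub>R a q]" by simp
      also have "\<dots> \<preceq> map a [p..<q] @ [a q]"
        unfolding P_def
      proof (intro turns_less_append step.IH turns_less_scale)
        fix l assume l: "l \<in> {p..<q}"
        then show "0 \<le> y l" using nz by auto
        show "0 \<le> r * x l - y l"
          using step.prems(3)[of l q] l xq by (simp add: r_def field_simps)
      next
        fix i j assume ij: "p \<le> i" "i < j" "j < q"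
        have "y i * x j * r \<le> y j * x i * r"
          using step.prems(3)[of i j] ij lam by (intro mult_right_mono) auto
        then show "y i * (r * x j - y j) \<le> y j * (r * x i - y i)" by (simp add: algebra_simps)
      qed (use nz step.hyps in auto)
      finally show ?thesis using step.hyps by (simp add: Y_def add.commute atLeastLessThanSuc)
    qed
  qed
qed

text \<open>Every vector that is moved belongs to two turns, hence the factor 2. If u were a
  direction and v absent, the first turn would have no counterpart on the right, which the last
  hypothesis excludes.\<close>

lemma path_angle_perturb:
  assumes "\<And>i. i \<in> set is \<Longrightarrow> P i \<noteq> 0" "\<And>i. i \<in> set is \<Longrightarrow> Q i \<noteq> 0" "u \<noteq> 0 \<longleftrightarrow> v \<noteq> 0"
  shows "path_angle u (map P is) \<le> ang u v + path_angle v (map Q is) + 2 * (\<Sum>i\<leftarrow>is. vec_angle (P i) (Q i))"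
  using assms
proof (induction "is" arbitrary: u v)
  case (Cons i "is")
  have i: "P i \<noteq> 0" "Q i \<noteq> 0" using Cons.prems by auto
  have "path_angle (P i) (map P is) \<le> ang (P i) (Q i) + path_angle (Q i) (map Q is)
      + 2 * (\<Sum>i\<leftarrow>is. vec_angle (P i) (Q i))"
    using Cons.prems by (intro Cons.IH) auto
  moreover have "ang u (P i) \<le> ang u v + (ang v (Q i) + ang (Q i) (P i))"
  proof (cases "v = 0")
    case False
    show ?thesis using ang_triangle[OF False, of u "P i"] ang_triangle[OF i(2), of v "P i"] by linarith
  qed (use Cons.prems ang_nonneg in auto)
  moreover have "ang (P i) (Q i) = vec_angle (P i) (Q i)" "ang (Q i) (P i) = vec_angle (P i) (Q i)"
    using i by (simp_all add: ang_def vec_angle_commute)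
  ultimately show ?case using i by simp
qed (simp add: ang_nonneg)

section \<open>Polygons as sequences of vectors\<close>

lemma sum_list_vec_angle:
  "sum_list (map2 vec_angle (filter (\<lambda>z. z \<noteq> 0) zs) (tl (filter (\<lambda>z. z \<noteq> 0) zs))) = path_angle 0 zs"
proof -
  have *: "sum_list (map2 vec_angle (u # filter (\<lambda>z. z \<noteq> 0) zs) (filter (\<lambda>z. z \<noteq> 0) zs)) = path_angle u zs"
    if "u \<noteq> 0" for u zs using that
    by (induction zs arbitrary: u) (auto simp: ang_def)
  show ?thesis
    by (induction zs) (simp_all add: *)
qed

lemma segments_eq_filter: "segments vs = filter (\<lambda>z. z \<noteq> 0) (map2 (-) (tl vs) vs)"
proof -
  have "map2 (-) (tl (remdups_adj vs)) (remdups_adj vs) = filter (\<lambda>z. z \<noteq> 0) (map2 (-) (tl vs) vs)"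
  proof (induction vs rule: remdups_adj.induct)
    case (3 x y xs)
    have "remdups_adj (y # xs) = y # tl (remdups_adj (y # xs))"
      by (metis hd_remdups_adj list.collapse list.discI list.sel(1) remdups_adj_Nil_iff)
    then have "map2 (-) (remdups_adj (y # xs)) (x # remdups_adj (y # xs))
      = (y - x) # map2 (-) (tl (remdups_adj (y # xs))) (remdups_adj (y # xs))"
      by (metis list.simps(9) case_prod_conv zip_Cons_Cons)
    then show ?case using 3 by (cases "x = y") simp_all
  qed simp_all
  then show ?thesis by (simp add: segments_def)
qed

lemma rotation_poly_eq_path_angle: "rotation_poly vs = path_angle 0 (map2 (-) (tl vs) vs)"
  by (simp add: rotation_poly_def segments_eq_filter sum_list_vec_angle)

lemma sum_list_map2_mono:
  fixes f g :: "'a \<Rightarrow> 'b \<Rightarrow> real"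
  assumes "\<And>x y. f x y \<le> g x y"
  shows "sum_list (map2 f xs ys) \<le> sum_list (map2 g xs ys)"
  by (rule sum_list_mono) (use assms in auto)

text \<open>If no difference vanishes, consecutive segments are consecutive differences, with no
  index shift from deleted vertices. The passage from angles of lines to angles of vectors only
  enlarges the sum.\<close>

lemma TAT_poly_le_path_angle:
  assumes "\<And>z. z \<in> set (map2 (-) (tl vs) vs) \<Longrightarrow> z \<noteq> 0"
  defines "ss \<equiv> map2 (-) (tl vs) vs"
  shows "TAT_poly vs \<le> path_angle 0 (map2 cross3 ss (tl ss))"
proof -
  have "segments vs = ss"
    using assms(1) unfolding segments_eq_filter ss_def by (intro filter_True) auto
  then show ?thesis
    unfolding TAT_poly_def Let_def sum_list_vec_angle[symmetric]
    by (intro order.trans[OF sum_list_map2_mono[OF line_angle_le_vec_angle]]) simp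
qed

lemma map2_tl_conv_nth: "map2 f (tl xs) xs = map (\<lambda>i. f (xs ! Suc i) (xs ! i)) [0..<length xs - 1]"
  by (rule nth_equalityI) (auto simp: nth_tl)

lemma map2_conv_nth_tl: "map2 f xs (tl xs) = map (\<lambda>i. f (xs ! i) (xs ! Suc i)) [0..<length xs - 1]"
  by (rule nth_equalityI) (auto simp: nth_tl)

lemma path_angle_filter_nonzero: "path_angle u (filter (\<lambda>z. z \<noteq> 0) zs) = path_angle u zs"
  by (induction zs arbitrary: u) auto

lemma turns_less_path_angle: "xs \<preceq> ys \<Longrightarrow> path_angle u xs \<le> path_angle u ys"
  unfolding turns_less_def by (metis append_Nil2)

lemma map_filter_turns_less: "map Q (filter P is) \<preceq> map Q is"
proof (induction "is")
  case (Cons i "is")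
  show ?case
  proof (cases "P i")
    case True
    then show ?thesis using turns_less_append[OF turns_less_refl Cons, of "[Q i]"] by simp
  next
    case False
    then show ?thesis
      using turns_less_trans[OF Cons turns_less_insert[of "[]" _ "[Q i]", simplified]] by simp
  qed
qed simp

text \<open>Indices at which P vanishes are dropped on both sides; putting them back on the side of
  Q can only increase its turning. Hence nothing is demanded of Q there.\<close>

lemma path_angle_compare:
  assumes "\<And>i. i \<in> set is \<Longrightarrow> P i \<noteq> 0 \<Longrightarrow> Q i \<noteq> 0 \<and> vec_angle (P i) (Q i) \<le> d i"
    and d: "\<And>i. i \<in> set is \<Longrightarrow> 0 \<le> d i"
  shows "path_angle 0 (map P is) \<le> path_angle 0 (map Q is) + 2 * (\<Sum>i\<leftarrow>is. d i)"
proof -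
  define js where "js = filter (\<lambda>i. P i \<noteq> 0) is"
  have "path_angle 0 (map P is) = path_angle 0 (map P js)"
    unfolding js_def by (subst path_angle_filter_nonzero[symmetric]) (simp add: filter_map o_def)
  also have "\<dots> \<le> path_angle 0 (map Q js) + 2 * (\<Sum>i\<leftarrow>js. vec_angle (P i) (Q i))"
    using path_angle_perturb[of js P Q 0 0] assms(1) by (simp add: js_def)
  also have "(\<Sum>i\<leftarrow>js. vec_angle (P i) (Q i)) \<le> (\<Sum>i\<leftarrow>js. d i)"
    using assms(1) by (intro sum_list_mono) (simp add: js_def)
  also have "(\<Sum>i\<leftarrow>js. d i) \<le> (\<Sum>i\<leftarrow>is. d i)"
  proof -
    have "sum_list (map d (filter R is)) \<le> sum_list (map d is)" for R
      using d
    proof (induction "is")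
      case (Cons i "is")
      then have "sum_list (map d (filter R is)) \<le> sum_list (map d is)" "0 \<le> d i" by simp_all
      then show ?case by simp
    qed simp
    then show ?thesis by (simp add: js_def)
  qed
  also have "path_angle 0 (map Q js) \<le> path_angle 0 (map Q is)"
    unfolding js_def by (intro turns_less_path_angle map_filter_turns_less)
  finally show ?thesis by simp
qed

text \<open>The estimate is one-sided by nature: a nonzero vector nearly keeps its direction under a
  small change, but a zero vector may turn into any short vector, which can add turning.\<close>

lemma path_angle_lower_semicontinuous:
  fixes P :: "'a \<Rightarrow> real^3"
  assumes "0 < \<epsilon>"
  obtains e where "0 < e" "\<And>Q. (\<And>i. i \<in> set is \<Longrightarrow> norm (P i - Q i) < e) \<Longrightarrow>
    path_angle 0 (map P is) \<le> path_angle 0 (map Q is) + \<epsilon>"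
proof -
  \<comment> \<open>The inserted 1 keeps the minimum meaningful when every \<open>P i\<close>
    vanishes.\<close>
  define r where "r = Min (insert 1 (norm ` P ` {i \<in> set is. P i \<noteq> 0}))"
  have r: "0 < r" unfolding r_def by (subst Min_gr_iff) auto
  have r_le: "r \<le> norm (P i)" if "i \<in> set is" "P i \<noteq> 0" for i
    unfolding r_def using that by (intro Min_le) auto
  define M where "M = real (length is) + 1"
  have M: "M > 0" by (simp add: M_def add_nonneg_pos)
  \<comment> \<open>The first bound keeps \<open>Q i\<close> nonzero where \<open>P i\<close> is;
    the second bounds each angle by \<open>\<epsilon> / (2 * M)\<close>, which leaves at most
    \<epsilon> after the factor 2.\<close>
  define e where "e = min r (\<epsilon> * r / (2 * pi * M))"
  show thesis
  proof
    show "0 < e" using r assms M by (simp add: e_def)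
    fix Q assume Q: "\<And>i. i \<in> set is \<Longrightarrow> norm (P i - Q i) < e"
    have "path_angle 0 (map P is) \<le> path_angle 0 (map Q is) + 2 * (\<Sum>i\<leftarrow>is. \<epsilon> / (2 * M))"
    proof (rule path_angle_compare)
      fix i assume i: "i \<in> set is" and P: "P i \<noteq> 0"
      have "norm (P i - Q i) < norm (P i)" using Q[OF i] r_le[OF i P] by (simp add: e_def)
      then have "Q i \<noteq> 0" by auto
      have "vec_angle (P i) (Q i) \<le> pi * (norm (P i - Q i) / norm (P i))"
        using P \<open>Q i \<noteq> 0\<close> by (rule vec_angle_le_relative)
      also have "\<dots> \<le> pi * ((\<epsilon> * r / (2 * pi * M)) / r)"
        using Q[OF i] r_le[OF i P] r assms M by (intro mult_left_mono frac_le) (auto simp: e_def)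
      also have "\<dots> = \<epsilon> / (2 * M)" using r by simp
      finally show "Q i \<noteq> 0 \<and> vec_angle (P i) (Q i) \<le> \<epsilon> / (2 * M)" using \<open>Q i \<noteq> 0\<close> by simp
    qed (use assms M in simp)
    also have "2 * (\<Sum>i\<leftarrow>is. \<epsilon> / (2 * M)) \<le> \<epsilon>"
      using assms by (simp add: sum_list_triv M_def field_simps)
    finally show "path_angle 0 (map P is) \<le> path_angle 0 (map Q is) + \<epsilon>" by simp
  qed
qed

section \<open>Windows\<close>

text \<open>Summation by parts, through an exchange of the order of summation. An index l left of q
  is counted by all j up to l, one from q on by all k beyond l: these partial sums of h are the two
  flanks of the tent.\<close>

lemma window_sum:
  fixes h :: "nat \<Rightarrow> real" and a :: "nat \<Rightarrow> 'a::real_vector"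
  assumes "p \<le> q" "q \<le> r"
  shows "(\<Sum>j=p..<q. \<Sum>k=q..<r. (h j * h k) *\<^sub>R (\<Sum>l=j..<k. a l))
    = (\<Sum>k=q..<r. h k) *\<^sub>R (\<Sum>l=p..<q. (\<Sum>j=p..<Suc l. h j) *\<^sub>R a l)
    + (\<Sum>j=p..<q. h j) *\<^sub>R (\<Sum>l=q..<r. (\<Sum>k=Suc l..<r. h k) *\<^sub>R a l)"
proof -
  have 1: "(\<Sum>j=p..<q. h j *\<^sub>R (\<Sum>l=j..<q. a l)) = (\<Sum>l=p..<q. (\<Sum>j=p..<Suc l. h j) *\<^sub>R a l)"
  proof -
    have "(\<Sum>j=p..<q. h j *\<^sub>R (\<Sum>l=j..<q. a l)) = (\<Sum>j=p..<q. \<Sum>l=p..<q. if j \<le> l then h j *\<^sub>R a l else 0)"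
      unfolding scaleR_sum_right
      by (intro sum.cong refl sum.mono_neutral_cong_left) auto
    also have "\<dots> = (\<Sum>l=p..<q. \<Sum>j=p..<q. if j \<le> l then h j *\<^sub>R a l else 0)" by (rule sum.swap)
    also have "\<dots> = (\<Sum>l=p..<q. (\<Sum>j=p..<Suc l. h j) *\<^sub>R a l)"
      unfolding scaleR_sum_left
      by (intro sum.cong refl sum.mono_neutral_cong_right) auto
    finally show ?thesis .
  qed
  have 2: "(\<Sum>k=q..<r. h k *\<^sub>R (\<Sum>l=q..<k. a l)) = (\<Sum>l=q..<r. (\<Sum>k=Suc l..<r. h k) *\<^sub>R a l)"
  proof -
    have "(\<Sum>k=q..<r. h k *\<^sub>R (\<Sum>l=q..<k. a l)) = (\<Sum>k=q..<r. \<Sum>l=q..<r. if l < k then h k *\<^sub>R a l else 0)"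
      unfolding scaleR_sum_right
      by (intro sum.cong refl sum.mono_neutral_cong_left) auto
    also have "\<dots> = (\<Sum>l=q..<r. \<Sum>k=q..<r. if l < k then h k *\<^sub>R a l else 0)" by (rule sum.swap)
    also have "\<dots> = (\<Sum>l=q..<r. (\<Sum>k=Suc l..<r. h k) *\<^sub>R a l)"
      unfolding scaleR_sum_left
      by (intro sum.cong refl sum.mono_neutral_cong_right) auto
    finally show ?thesis .
  qed
  have "(\<Sum>j=p..<q. \<Sum>k=q..<r. (h j * h k) *\<^sub>R (\<Sum>l=j..<k. a l))
    = (\<Sum>j=p..<q. \<Sum>k=q..<r. h k *\<^sub>R h j *\<^sub>R (\<Sum>l=j..<q. a l) + h j *\<^sub>R h k *\<^sub>R (\<Sum>l=q..<k. a l))"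
  proof (intro sum.cong refl)
    fix j k assume "j \<in> {p..<q}" "k \<in> {q..<r}"
    then have "(\<Sum>l=j..<k. a l) = (\<Sum>l=j..<q. a l) + (\<Sum>l=q..<k. a l)"
      by (simp add: sum.atLeastLessThan_concat)
    then show "(h j * h k) *\<^sub>R (\<Sum>l=j..<k. a l)
      = h k *\<^sub>R h j *\<^sub>R (\<Sum>l=j..<q. a l) + h j *\<^sub>R h k *\<^sub>R (\<Sum>l=q..<k. a l)"
      by (simp add: scaleR_add_right mult.commute)
  qed
  also have "\<dots> = (\<Sum>k=q..<r. h k) *\<^sub>R (\<Sum>j=p..<q. h j *\<^sub>R (\<Sum>l=j..<q. a l))
    + (\<Sum>j=p..<q. h j) *\<^sub>R (\<Sum>k=q..<r. h k *\<^sub>R (\<Sum>l=q..<k. a l))"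
  proof -
    have "(\<Sum>j\<in>J. \<Sum>k\<in>K. f k *\<^sub>R u j + g j *\<^sub>R v k) = sum f K *\<^sub>R sum u J + sum g J *\<^sub>R sum v K"
      for J K :: "nat set" and f g :: "nat \<Rightarrow> real" and u v :: "nat \<Rightarrow> 'a"
      by (simp add: sum.distrib scaleR_sum_left[of f] scaleR_sum_left[of g] scaleR_sum_right[of _ u]
          scaleR_sum_right[of _ v] sum.swap[of _ J K])
    then show ?thesis .
  qed
  finally show ?thesis unfolding 1 2 .
qed

text \<open>Each window consists of the rising flank \<open>Y i\<close> over one block and the
  falling flank \<open>X (Suc i)\<close> over the next. Over a single block the falling flank
  belongs to the earlier window and the rising one to the later, and the quotient of rising by
  falling weights grows with l, as \<open>turns_less_pair\<close> requires.\<close>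

lemma turns_less_windows:
  fixes h :: "nat \<Rightarrow> real" and a :: "nat \<Rightarrow> real^3" and m :: "nat \<Rightarrow> nat"
  assumes h: "\<And>l. 0 \<le> h l" and m: "mono m"
  shows "map (\<lambda>i. \<Sum>j=m i..<m (Suc i). \<Sum>k=m (Suc i)..<m (Suc (Suc i)). (h j * h k) *\<^sub>R (\<Sum>l=j..<k. a l)) [0..<M]
    \<preceq> map a [m 0..<m (Suc M)]"
proof -
  define X where "X i = (\<Sum>l=m i..<m (Suc i). (\<Sum>k=Suc l..<m (Suc i). h k) *\<^sub>R a l)" for i
  define Y where "Y i = (\<Sum>l=m i..<m (Suc i). (\<Sum>j=m i..<Suc l. h j) *\<^sub>R a l)" for i
  let ?B = "\<lambda>i. \<Sum>j=m i..<m (Suc i). \<Sum>k=m (Suc i)..<m (Suc (Suc i)). (h j * h k) *\<^sub>R (\<Sum>l=j..<k. a l)"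
  have B: "[?B i] \<preceq> [Y i, X (Suc i)]" for i
  proof -
    have "?B i = (\<Sum>k=m (Suc i)..<m (Suc (Suc i)). h k) *\<^sub>R Y i + (\<Sum>j=m i..<m (Suc i). h j) *\<^sub>R X (Suc i)"
      unfolding X_def Y_def using m by (intro window_sum) (simp_all add: mono_iff_le_Suc)
    then have "[?B i] \<preceq> [(\<Sum>k=m (Suc i)..<m (Suc (Suc i)). h k) *\<^sub>R Y i] @ [(\<Sum>j=m i..<m (Suc i). h j) *\<^sub>R X (Suc i)]"
      using turns_less_add by simp
    also have "\<dots> \<preceq> [Y i] @ [X (Suc i)]"
      using h by (intro turns_less_append turns_less_scale sum_nonneg)
    finally show ?thesis by simp
  qed
  have XY: "[X i, Y i] \<preceq> map a [m i..<m (Suc i)]" for i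
    unfolding X_def Y_def
  proof (rule turns_less_pair)
    show "m i \<le> m (Suc i)" using m by (simp add: mono_iff_le_Suc)
    fix j k assume "m i \<le> j" "j < k" "k < m (Suc i)"
    then show "(\<Sum>j=m i..<Suc j. h j) * (\<Sum>k=Suc k..<m (Suc i). h k)
      \<le> (\<Sum>j=m i..<Suc k. h j) * (\<Sum>k=Suc j..<m (Suc i). h k)"
      by (intro mult_mono sum_mono2 sum_nonneg) (auto simp: h)
  qed (intro sum_nonneg h)+
  have "map ?B [0..<M] = concat (map (\<lambda>i. [?B i]) [0..<M])" by simp
  also have "\<dots> \<preceq> concat (map (\<lambda>i. [Y i, X (Suc i)]) [0..<M])" by (intro turns_less_concat B)
  \<comment> \<open>Adding one flank at either end shifts the grouping by half a window: pairs from
    two neighbouring blocks become pairs over one block.\<close>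
  also have "\<dots> \<preceq> [X 0] @ concat (map (\<lambda>i. [Y i, X (Suc i)]) [0..<M]) @ [Y M]"
    using turns_less_append[OF Nil_turns_less[of "[X 0]"] turns_less_append_left[OF Nil_turns_less[of "[Y M]"],
      of "concat (map (\<lambda>i. [Y i, X (Suc i)]) [0..<M])"]] by simp
  also have "\<dots> = concat (map (\<lambda>i. [X i, Y i]) [0..<Suc M])" by (induction M) auto
  also have "\<dots> \<preceq> concat (map (\<lambda>i. map a [m i..<m (Suc i)]) [0..<Suc M])" by (intro turns_less_concat XY)
  also have "\<dots> = map a [m 0..<m (Suc M)]"
  proof (induction M)
    case (Suc M)
    have "m 0 \<le> m (Suc M)" "m (Suc M) \<le> m (Suc (Suc M))" using m by (auto simp: mono_def)
    then have "[m 0..<m (Suc (Suc M))] = [m 0..<m (Suc M)] @ [m (Suc M)..<m (Suc (Suc M))]"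
      by (metis le_Suc_ex upt_add_eq_append)
    then show ?case using Suc by simp
  qed simp
  finally show ?thesis .
qed

lemma path_angle_snoc: "y \<noteq> 0 \<Longrightarrow> path_angle u (xs @ [y, z]) = path_angle u (xs @ [y]) + ang y z"
  by (induction xs arbitrary: u) auto

text \<open>The extra vector \<open>p N\<close> makes the last block end like the others; inserting
  it can only increase the turning.\<close>

lemma path_angle_blocks:
  assumes "\<And>l. l \<le> N \<Longrightarrow> p l \<noteq> 0" "\<And>l. l < N \<Longrightarrow> q l \<noteq> 0" "\<And>l. l < N \<Longrightarrow> r l \<noteq> 0"
  shows "path_angle 0 (concat (map (\<lambda>l. [p l, q l, r l]) [0..<N]))
    \<le> (\<Sum>l<N. ang (p l) (q l) + ang (q l) (r l) + ang (r l) (p (Suc l)))"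
proof -
  have "path_angle 0 (concat (map (\<lambda>l. [p l, q l, r l]) [0..<N]) @ [p N])
    = (\<Sum>l<N. ang (p l) (q l) + ang (q l) (r l) + ang (r l) (p (Suc l)))"
    using assms
  proof (induction N)
    case (Suc N)
    let ?c = "concat (map (\<lambda>l. [p l, q l, r l]) [0..<N])"
    have nz: "p N \<noteq> 0" "q N \<noteq> 0" "r N \<noteq> 0" using Suc.prems by auto
    have "path_angle 0 (concat (map (\<lambda>l. [p l, q l, r l]) [0..<Suc N]) @ [p (Suc N)])
      = path_angle 0 ((?c @ [p N, q N]) @ [r N, p (Suc N)])" by simp
    also have "\<dots> = path_angle 0 ((?c @ [p N]) @ [q N, r N]) + ang (r N) (p (Suc N))"
      unfolding path_angle_snoc[OF nz(3)] by simp
    also have "path_angle 0 ((?c @ [p N]) @ [q N, r N]) = path_angle 0 (?c @ [p N, q N]) + ang (q N) (r N)"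
      unfolding path_angle_snoc[OF nz(2)] by simp
    also have "path_angle 0 (?c @ [p N, q N]) = path_angle 0 (?c @ [p N]) + ang (p N) (q N)"
      by (rule path_angle_snoc[OF nz(1)])
    finally show ?case using Suc by simp
  qed simp
  then show ?thesis
    using turns_less_path_angle[OF turns_less_insert[of "concat (map (\<lambda>l. [p l, q l, r l]) [0..<N])" "[]" "[p N]"], of 0]
    by simp
qed

section \<open>Moving frames with finitely many jumps\<close>

text \<open>Formulated with one-sided limits only, so that jumps at x and y and the values taken at
  jump points do not matter.\<close>

definition small_osc :: "real \<Rightarrow> real set \<Rightarrow> (real \<Rightarrow> 'a::real_normed_vector) \<Rightarrow> real \<Rightarrow> real \<Rightarrow> bool" where
  "small_osc L S u \<eta> \<delta> \<longleftrightarrow>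
     (\<forall>x y. 0 \<le> x \<longrightarrow> x < y \<longrightarrow> y \<le> L \<longrightarrow> y - x < \<delta> \<longrightarrow> {x<..<y} \<inter> S = {} \<longrightarrow>
       (\<forall>p\<in>{x..<y}. (\<forall>q\<in>{x..<y}. norm (lim_right u p - lim_right u q) \<le> \<eta>) \<and>
                    (\<forall>q\<in>{x<..y}. norm (lim_right u p - lim_left u q) \<le> \<eta>)))"

lemma small_osc_mono: "small_osc L S u \<eta> \<delta> \<Longrightarrow> \<delta>' \<le> \<delta> \<Longrightarrow> small_osc L S u \<eta> \<delta>'"
  unfolding small_osc_def by (meson less_le_trans)

lemma small_osc_right:
  assumes "small_osc L S u \<eta> \<delta>" "0 \<le> x" "y \<le> L" "y - x < \<delta>" "{x<..<y} \<inter> S = {}" "p \<in> {x..<y}" "q \<in> {x..<y}"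
  shows "norm (lim_right u p - lim_right u q) \<le> \<eta>"
  using assms unfolding small_osc_def by (meson atLeastLessThan_iff le_less_trans)

lemma small_osc_left:
  assumes "small_osc L S u \<eta> \<delta>" "0 \<le> x" "y \<le> L" "y - x < \<delta>" "{x<..<y} \<inter> S = {}" "p \<in> {x..<y}" "q \<in> {x<..y}"
  shows "norm (lim_right u p - lim_left u q) \<le> \<eta>"
  using assms unfolding small_osc_def by (meson atLeastLessThan_iff le_less_trans)

lemma norm_cross_le: "norm (cross3 x y) \<le> norm x * norm y"
proof (rule power2_le_imp_le)
  show "(norm (cross3 x y))\<^sup>2 \<le> (norm x * norm y)\<^sup>2"
    by (simp add: norm_cross power_mult_distrib)
qed simp

lemma lone_point:
  fixes s :: real
  assumes "\<And>z. z \<in> S \<Longrightarrow> z \<in> {X<..<Y} \<Longrightarrow> z = s" "X < s" "s < Y"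
  shows "{X<..<s} \<inter> S = {}" "{s<..<Y} \<inter> S = {}"
proof -
  have "z \<notin> S" if "z \<in> {X<..<Y}" "z \<noteq> s" for z using assms(1)[of z] that by auto
  then show "{X<..<s} \<inter> S = {}" "{s<..<Y} \<inter> S = {}" using assms(2,3) by fastforce+
qed

section \<open>Partitions through the jump points\<close>

definition nodes :: "real \<Rightarrow> real set \<Rightarrow> nat \<Rightarrow> (nat \<Rightarrow> real) \<Rightarrow> bool" where
  "nodes L S N x \<longleftrightarrow> x 0 = 0 \<and> x N = L \<and> (\<forall>i j. i < j \<longrightarrow> j \<le> N \<longrightarrow> x i < x j) \<and> S \<subseteq> x ` {..N}"

lemma nodes_less_iff:
  assumes "nodes L S N x" "i \<le> N" "j \<le> N"
  shows "x i < x j \<longleftrightarrow> i < j"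
proof -
  have "\<And>i j. i < j \<Longrightarrow> j \<le> N \<Longrightarrow> x i < x j" using assms(1) by (simp add: nodes_def)
  from this[of i j] this[of j i] show ?thesis
    using assms(2,3) by (cases i j rule: linorder_cases) auto
qed

lemma nodes_le_iff:
  assumes "nodes L S N x" "i \<le> N" "j \<le> N"
  shows "x i \<le> x j \<longleftrightarrow> i \<le> j"
  using nodes_less_iff[OF assms(1,3,2)] by (meson not_le)

lemma nodes_eq_iff:
  assumes "nodes L S N x" "i \<le> N" "j \<le> N"
  shows "x i = x j \<longleftrightarrow> i = j"
  using nodes_le_iff[OF assms] nodes_le_iff[OF assms(1,3,2)] by (auto simp: order_eq_iff)

lemma nodes_mem:
  assumes "nodes L S N x" "l \<le> N"
  shows "x l \<in> {0..L}"
  using assms nodes_le_iff[OF assms(1), of 0 l] nodes_le_iff[OF assms(1), of l N] by (auto simp: nodes_def)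

lemma nodes_cell:
  assumes "nodes L S N x" "l < N"
  shows "x l \<in> {0..<L}" "x (Suc l) \<in> {0<..L}" "x l < x (Suc l)" "{x l<..<x (Suc l)} \<inter> S = {}"
proof -
  show *: "x l < x (Suc l)" using nodes_less_iff[OF assms(1), of l "Suc l"] assms by simp
  show "x l \<in> {0..<L}" "x (Suc l) \<in> {0<..L}"
    using * nodes_mem[OF assms(1), of l] nodes_mem[OF assms(1), of "Suc l"] assms by auto
  show "{x l<..<x (Suc l)} \<inter> S = {}"
  proof (rule ccontr)
    assume "{x l<..<x (Suc l)} \<inter> S \<noteq> {}"
    then obtain s where s: "x l < s" "s < x (Suc l)" "s \<in> S" by auto
    moreover have "S \<subseteq> x ` {..N}" using assms(1) by (simp add: nodes_def)
    ultimately obtain k where k: "k \<le> N" "x l < x k" "x k < x (Suc l)" by force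
    then show False
      using nodes_less_iff[OF assms(1), of l k] nodes_less_iff[OF assms(1), of k "Suc l"] assms by auto
  qed
qed

text \<open>A uniform grid of step \<open>L / M\<close>, smaller than d, is added to the prescribed
  points; a cell of length at least d would contain a grid point in its interior.\<close>

lemma nodes_exist:
  assumes "0 < L" "finite S" "S \<subseteq> {0..L}" "finite F" "F \<subseteq> {0..L}" "0 < d"
  obtains N x where "nodes L S N x" "F \<subseteq> x ` {..N}" "\<And>l. l < N \<Longrightarrow> x (Suc l) - x l < d"
proof -
  obtain M :: nat where M: "L / d < real M" using reals_Archimedean2 by blast
  then have M0: "0 < M" using assms by (meson divide_pos_pos less_trans of_nat_0_less_iff)
  define g where "g k = L * real k / real M" for k :: nat
  define X where "X = F \<union> S \<union> {0, L} \<union> g ` {..M}"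
  have X: "finite X" "X \<subseteq> {0..L}"
  proof -
    have "g k \<in> {0..L}" if "k \<le> M" for k
      using that assms M0 by (auto simp: g_def field_simps)
    then show "X \<subseteq> {0..L}" using assms by (auto simp: X_def)
  qed (use assms in \<open>auto simp: X_def\<close>)
  define xs where "xs = sorted_list_of_set X"
  define N where "N = length xs - 1"
  define x where "x i = xs ! i" for i
  have xs: "set xs = X" "sorted_wrt (<) xs" using X by (simp_all add: xs_def)
  then have "xs \<noteq> []" by (auto simp: X_def)
  then have len: "length xs = Suc N" by (simp add: N_def)
  have img: "x ` {..N} = X"
    unfolding xs(1)[symmetric] x_def set_conv_nth using len by (auto simp: less_Suc_eq_le)
  have mono: "x i < x j" if "i < j" "j \<le> N" for i j
    using sorted_wrt_nth_less[OF xs(2) that(1)] that len by (simp add: x_def)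
  have "x 0 = 0"
  proof -
    have "0 \<in> x ` {..N}" unfolding img by (simp add: X_def)
    then obtain i where "i \<le> N" "x i = 0" by force
    moreover have "x 0 \<in> X" unfolding img[symmetric] by simp
    then have "x 0 \<ge> 0" using X by auto
    ultimately show ?thesis using mono[of 0 i] by (cases "i = 0") auto
  qed
  moreover have "x N = L"
  proof -
    have "L \<in> x ` {..N}" unfolding img by (simp add: X_def)
    then obtain i where "i \<le> N" "x i = L" by force
    moreover have "x N \<in> X" unfolding img[symmetric] by simp
    then have "x N \<le> L" using X by auto
    ultimately show ?thesis using mono[of i N] by (cases "i = N") auto
  qed
  ultimately have nd: "nodes L S N x" using mono img unfolding nodes_def by (auto simp: X_def)
  show thesis
  proof (rule that[OF nd])
    show "F \<subseteq> x ` {..N}" using img by (auto simp: X_def)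
    fix l assume l: "l < N"
    show "x (Suc l) - x l < d"
    proof (rule ccontr)
      assume "\<not> x (Suc l) - x l < d"
      moreover have "L / real M < d" using M M0 assms by (simp add: field_simps)
      ultimately have gap: "x l + L / real M < x (Suc l)" by simp
      have xl: "0 \<le> x l" "x (Suc l) \<le> L" using nodes_cell[OF nd l] by auto
      \<comment> \<open>This makes \<open>g k\<close> the first grid point strictly to the right of
        \<open>x l\<close>.\<close>
      define k where "k = nat \<lfloor>x l * M / L\<rfloor> + 1"
      have nn: "0 \<le> x l * M / L" using xl assms by simp
      have "real k = of_int \<lfloor>x l * M / L\<rfloor> + 1" using nn by (simp add: k_def)
      then have k: "x l * M / L < real k" "real k \<le> x l * M / L + 1" by linarith+
      have "x l < g k" using k(1) assms M0 by (simp add: g_def field_simps)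
      moreover have "g k \<le> x l + L / M"
        using k(2) assms M0 by (simp add: g_def field_simps)
      ultimately have gk: "x l < g k" "g k < x (Suc l)" using gap by auto
      then have "g k < L" using xl by simp
      then have "k \<le> M" using assms M0 by (simp add: g_def field_simps)
      then have "g k \<in> x ` {..N}" unfolding img by (auto simp: X_def)
      then obtain i where "i \<le> N" "x i = g k" by force
      then show False using gk nodes_less_iff[OF nd, of l i] nodes_less_iff[OF nd, of i "Suc l"] l by auto
    qed
  qed
qed

lemma nodes_indices:
  assumes "nodes L S N x" "sorted_wrt (<) ts" "set ts \<subseteq> x ` {..N}" "ts \<noteq> []"
  obtains m where "mono m" "\<And>i. m i \<le> N" "\<And>i. i < length ts \<Longrightarrow> x (m i) = ts ! i"
proof -
  define idx where "idx y = (SOME k. k \<le> N \<and> x k = y)" for y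
  have idx: "idx y \<le> N \<and> x (idx y) = y" if "y \<in> set ts" for y
  proof -
    have "y \<in> x ` {..N}" using assms(3) that by blast
    then have "\<exists>k. k \<le> N \<and> x k = y" by auto
    then show ?thesis unfolding idx_def by (rule someI_ex)
  qed
  \<comment> \<open>Beyond the list the last index is repeated, so that m is monotone on all natural
    numbers.\<close>
  define m where "m i = idx (ts ! min i (length ts - 1))" for i
  have len: "length ts - 1 < length ts" using assms(4) by (cases ts) auto
  then have mem: "ts ! min i (length ts - 1) \<in> set ts" for i by (intro nth_mem) (simp add: min_less_iff_disj)
  show thesis
  proof
    show "m i \<le> N" for i using idx[OF mem] by (simp add: m_def)
    show "x (m i) = ts ! i" if "i < length ts" for i
    proof -
      have "min i (length ts - 1) = i" using that by simp
      then show ?thesis using idx[OF mem[of i]] by (simp add: m_def)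
    qed
    show "mono m"
    proof
      fix i j :: nat assume "i \<le> j"
      then have "min i (length ts - 1) \<le> min j (length ts - 1)" "min j (length ts - 1) < length ts"
        using len by (auto simp: min_less_iff_disj min_le_iff_disj)
      moreover have "ts ! a \<le> ts ! b" if "a \<le> b" "b < length ts" for a b
        using sorted_wrt_nth_less[OF assms(2), of a b] that by (cases "a = b") auto
      ultimately have "ts ! min i (length ts - 1) \<le> ts ! min j (length ts - 1)" by blast
      then show "m i \<le> m j"
        using idx[OF mem[of i]] idx[OF mem[of j]] nodes_le_iff[OF assms(1), of "m i" "m j"] by (simp add: m_def)
    qed
  qed
qed

text \<open>Inside a cell the angle is at most \<open>1 + \<epsilon>\<close> times the chord, and V
  bounds the sum of the chords; between two cells the direction changes only at a point of S, where
  the passage through \<nu> costs at most \<alpha>. Off S the third vector repeats the left limit,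
  so that every cell contributes three vectors.\<close>

lemma path_bound:
  fixes u :: "real \<Rightarrow> real^3"
  assumes "0 < L" and nd: "nodes L S N x" and "finite S" "S \<subseteq> {0<..<L}" "0 \<le> \<epsilon>"
    and right: "\<And>y. y \<in> {0..<L} \<Longrightarrow> norm (lim_right u y) = 1"
    and left: "\<And>y. y \<in> {0<..L} \<Longrightarrow> norm (lim_left u y) = 1"
    and cont: "\<And>y. y \<in> {0<..<L} - S \<Longrightarrow> lim_left u y = lim_right u y"
    and nu: "\<And>s. s \<in> S \<Longrightarrow> norm (\<nu> s) = 1"
    and jump: "\<And>s. s \<in> S \<Longrightarrow> vec_angle (lim_left u s) (\<nu> s) + vec_angle (\<nu> s) (lim_right u s) \<le> \<alpha> s"
    and cell: "\<And>l. l < N \<Longrightarrow> vec_angle (lim_right u (x l)) (lim_left u (x (Suc l)))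
      \<le> (1 + \<epsilon>) * norm (lim_right u (x l) - lim_left u (x (Suc l)))"
    and V: "(\<Sum>l<N. norm (lim_left u (x (Suc l)) - lim_right u (x l))) \<le> V"
  shows "path_angle 0 (concat (map (\<lambda>l. [lim_right u (x l), lim_left u (x (Suc l)),
      if x (Suc l) \<in> S then \<nu> (x (Suc l)) else lim_left u (x (Suc l))]) [0..<N]))
    \<le> (1 + \<epsilon>) * V + (\<Sum>s\<in>S. \<alpha> s)"
proof -
  \<comment> \<open>The left limit at L closes the path, since nothing is assumed of a right limit
    there.\<close>
  define p where "p l = (if l < N then lim_right u (x l) else lim_left u L)" for l
  define q where "q l = lim_left u (x (Suc l))" for l
  define r where "r l = (if x (Suc l) \<in> S then \<nu> (x (Suc l)) else lim_left u (x (Suc l)))" for l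
  have L: "0 < L" using assms(1) .
  have nz: "p l \<noteq> 0" if "l \<le> N" for l
    using right[of "x l"] left[of L] nodes_cell(1)[OF nd, of l] L by (auto simp: p_def)
  have nz': "q l \<noteq> 0" "r l \<noteq> 0" if "l < N" for l
    using left[OF nodes_cell(2)[OF nd that]] nu[of "x (Suc l)"] by (auto simp: q_def r_def)
  have av: "\<alpha> s \<ge> 0" if "s \<in> S" for s
    using jump[OF that] vec_angle_nonneg[of "lim_left u s" "\<nu> s"] vec_angle_nonneg[of "\<nu> s" "lim_right u s"] by linarith
  have "path_angle 0 (concat (map (\<lambda>l. [lim_right u (x l), lim_left u (x (Suc l)),
      if x (Suc l) \<in> S then \<nu> (x (Suc l)) else lim_left u (x (Suc l))]) [0..<N]))
    = path_angle 0 (concat (map (\<lambda>l. [p l, q l, r l]) [0..<N]))"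
    by (intro arg_cong[where f = "\<lambda>z. path_angle 0 (concat z)"] map_cong) (auto simp: p_def q_def r_def)
  also have "\<dots> \<le> (\<Sum>l<N. ang (p l) (q l) + ang (q l) (r l) + ang (r l) (p (Suc l)))"
    using nz nz' by (rule path_angle_blocks)
  also have "\<dots> \<le> (\<Sum>l<N. (1 + \<epsilon>) * norm (lim_left u (x (Suc l)) - lim_right u (x l))
      + (if x (Suc l) \<in> S then \<alpha> (x (Suc l)) else 0))"
  proof (rule sum_mono)
    fix l assume "l \<in> {..<N}"
    then have l: "l < N" by simp
    have 1: "ang (p l) (q l) \<le> (1 + \<epsilon>) * norm (lim_left u (x (Suc l)) - lim_right u (x l))"
      using cell[OF l] l nz[of l] nz'[OF l] by (simp add: ang_def p_def q_def norm_minus_commute)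
    have 2: "ang (q l) (r l) + ang (r l) (p (Suc l)) \<le> (if x (Suc l) \<in> S then \<alpha> (x (Suc l)) else 0)"
    proof (cases "x (Suc l) \<in> S")
      case True
      then have "x (Suc l) \<noteq> L" using assms(4) by auto
      then have "Suc l < N" using l nd by (metis Suc_lessI nodes_def)
      then show ?thesis using True jump[OF True] nz[of "Suc l"] nz'[OF l] by (simp add: ang_def p_def q_def r_def)
    next
      case False
      have "p (Suc l) = q l"
      proof (cases "Suc l < N")
        case True
        then have "x (Suc l) \<in> {0<..<L} - S"
          using False nodes_cell(1)[OF nd True] nodes_cell(2)[OF nd l] by auto
        then show ?thesis using cont True by (simp add: p_def q_def)
      next
        case False
        then have "Suc l = N" using l by simp
        then show ?thesis using nd by (auto simp: p_def q_def nodes_def)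
      qed
      then show ?thesis using False nz'[OF l] by (simp add: r_def q_def ang_def vec_angle_refl)
    qed
    show "ang (p l) (q l) + ang (q l) (r l) + ang (r l) (p (Suc l))
      \<le> (1 + \<epsilon>) * norm (lim_left u (x (Suc l)) - lim_right u (x l)) + (if x (Suc l) \<in> S then \<alpha> (x (Suc l)) else 0)"
      using 1 2 by linarith
  qed
  also have "\<dots> = (1 + \<epsilon>) * (\<Sum>l<N. norm (lim_left u (x (Suc l)) - lim_right u (x l)))
      + (\<Sum>l\<in>{l\<in>{..<N}. x (Suc l) \<in> S}. \<alpha> (x (Suc l)))"
    unfolding sum.distrib sum_distrib_left by (subst sum.inter_filter) auto
  also have "(\<Sum>l\<in>{l\<in>{..<N}. x (Suc l) \<in> S}. \<alpha> (x (Suc l))) = sum \<alpha> ((\<lambda>l. x (Suc l)) ` {l\<in>{..<N}. x (Suc l) \<in> S})"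
    by (subst sum.reindex) (auto simp: inj_on_def nodes_eq_iff[OF nd])
  also have "\<dots> \<le> sum \<alpha> S" using assms(3) av by (intro sum_mono2) auto
  also have "(1 + \<epsilon>) * (\<Sum>l<N. norm (lim_left u (x (Suc l)) - lim_right u (x l))) \<le> (1 + \<epsilon>) * V"
    using V assms(5) by (intro mult_left_mono) auto
  finally show ?thesis by simp
qed

lemma turns_less_pad: "ys \<preceq> xs @ ys @ zs"
  using turns_less_append[OF Nil_turns_less[of xs] turns_less_append_left[OF Nil_turns_less[of zs], of ys]]
  by simp

lemma upt_split:
  assumes "p \<le> q" "q \<le> r"
  shows "[p..<r] = [p..<q] @ [q..<r]"
  using upt_add_eq_append[of p q "r - q"] assms by simp

text \<open>The properties of the solution on which the geometry rests, free of measures: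
  \<open>tangent_step\<close> is dt = n d\<theta> in the form of a mean value estimate against a
  fixed vector v, \<open>c_step\<close> is c' = t in the same form, and K majorises the increments
  of n. At a jump the cross product of the one-sided tangents has length \<open>w s\<close> and
  direction \<open>\<nu> s\<close>.\<close>

locale moving_frame =
  fixes L :: real and S :: "real set" and t n b c \<nu> :: "real \<Rightarrow> real^3"
    and \<theta> \<alpha> w K :: "real \<Rightarrow> real"
  assumes L_pos: "0 < L" and S_finite: "finite S" and S_subset: "S \<subseteq> {0<..<L}"
    and right_frame: "x \<in> {0..<L} \<Longrightarrow> norm (lim_right t x) = 1 \<and> norm (lim_right n x) = 1 \<and>
      norm (lim_right b x) = 1 \<and> cross3 (lim_right t x) (lim_right n x) = lim_right b x"
    and left_frame: "x \<in> {0<..L} \<Longrightarrow> norm (lim_left t x) = 1 \<and> norm (lim_left b x) = 1"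
    and lim_eq: "x \<in> {0<..<L} - S \<Longrightarrow> lim_left t x = lim_right t x \<and> lim_left n x = lim_right n x \<and>
      lim_left b x = lim_right b x"
    and small_osc_ex: "0 < \<eta> \<Longrightarrow> \<exists>\<delta>>0. small_osc L S t \<eta> \<delta> \<and> small_osc L S n \<eta> \<delta> \<and>
      small_osc L S b \<eta> \<delta> \<and> small_osc L S \<theta> \<eta> \<delta>"
    and theta_less: "0 \<le> x \<Longrightarrow> x < y \<Longrightarrow> y \<le> L \<Longrightarrow> lim_right \<theta> x \<le> lim_left \<theta> y"
    and theta_jump: "x \<in> {0<..<L} \<Longrightarrow> lim_left \<theta> x \<le> lim_right \<theta> x"
    and tangent_step: "\<And>x y v \<eta>. 0 \<le> x \<Longrightarrow> x < y \<Longrightarrow> y \<le> L \<Longrightarrow> {x<..<y} \<inter> S = {} \<Longrightarrow>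
      (\<And>z. z \<in> {x<..<y} \<Longrightarrow> norm (lim_right n z - v) \<le> \<eta>) \<Longrightarrow>
      norm (lim_left t y - lim_right t x - (lim_left \<theta> y - lim_right \<theta> x) *\<^sub>R v)
        \<le> \<eta> * (lim_left \<theta> y - lim_right \<theta> x)"
    and K_mono: "0 \<le> x \<Longrightarrow> x \<le> y \<Longrightarrow> y \<le> L \<Longrightarrow> K x \<le> K y"
    and normal_step: "0 \<le> x \<Longrightarrow> x < y \<Longrightarrow> y \<le> L \<Longrightarrow> norm (lim_left n y - lim_right n x) \<le> K y - K x"
    and nu: "s \<in> S \<Longrightarrow> norm (\<nu> s) = 1"
    and jump_angles: "s \<in> S \<Longrightarrow> 0 < \<alpha> s \<and> \<alpha> s < pi \<and> vec_angle (lim_left t s) (lim_right t s) \<le> \<alpha> s \<and>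
      vec_angle (lim_left b s) (\<nu> s) \<le> \<alpha> s / 2 \<and> vec_angle (\<nu> s) (lim_right b s) \<le> \<alpha> s / 2"
    and jump_cross: "s \<in> S \<Longrightarrow> 0 \<le> w s \<and> cross3 (lim_left t s) (lim_right t s) = w s *\<^sub>R \<nu> s \<and>
      (w s = 0 \<longrightarrow> lim_left t s = lim_right t s)"
    and c_step: "\<And>x y v \<eta>. 0 \<le> x \<Longrightarrow> x < y \<Longrightarrow> y \<le> L \<Longrightarrow> {x<..<y} \<inter> S = {} \<Longrightarrow>
      (\<And>z. z \<in> {x<..<y} \<Longrightarrow> norm (lim_right t z - v) \<le> \<eta>) \<Longrightarrow>
      norm (c y - c x - (y - x) *\<^sub>R v) \<le> \<eta> * (y - x)"
    and c_lipschitz: "0 \<le> x \<Longrightarrow> x \<le> y \<Longrightarrow> y \<le> L \<Longrightarrow> norm (c y - c x) \<le> y - x"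
begin

lemma S_subset': "S \<subseteq> {0..L}"
  using S_subset by auto

lemma lim_eq_S: "x \<in> {0<..<L} \<Longrightarrow> x \<notin> S \<Longrightarrow> lim_left t x = lim_right t x"
  using lim_eq by auto

section \<open>Total curvature\<close>

lemma chord_sum:
  assumes nd: "nodes L S N x" and "p \<le> q" "q \<le> N" and so: "small_osc L S t \<eta> \<delta>"
    and fine: "\<And>l. l < N \<Longrightarrow> x (Suc l) - x l < \<delta>"
  shows "norm ((c (x q) - c (x p)) - (\<Sum>l=p..<q. (x (Suc l) - x l) *\<^sub>R lim_right t (x l))) \<le> \<eta> * (x q - x p)"
proof -
  have "norm (c (x (Suc l)) - c (x l) - (x (Suc l) - x l) *\<^sub>R lim_right t (x l)) \<le> \<eta> * (x (Suc l) - x l)"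
    if "l \<in> {p..<q}" for l
  proof -
    have l: "l < N" using that assms(3) by auto
    note cell = nodes_cell[OF nd l]
    show ?thesis
    proof (rule c_step)
      fix z assume "z \<in> {x l<..<x (Suc l)}"
      then show "norm (lim_right t z - lim_right t (x l)) \<le> \<eta>"
        using cell fine[OF l] by (intro small_osc_right[OF so, of "x l" "x (Suc l)"]) auto
    qed (use cell in auto)
  qed
  then have "norm (\<Sum>l=p..<q. c (x (Suc l)) - c (x l) - (x (Suc l) - x l) *\<^sub>R lim_right t (x l))
    \<le> (\<Sum>l=p..<q. \<eta> * (x (Suc l) - x l))"
    by (rule sum_norm_le)
  then show ?thesis
    unfolding sum_subtractf[of "\<lambda>l. c (x (Suc l)) - c (x l)"] sum_distrib_left[symmetric]
    using sum_Suc_diff'[OF assms(2), of x] sum_Suc_diff'[OF assms(2), of "\<lambda>l. c (x l)"] by simp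
qed

text \<open>The polygon is fixed first. Its segments are limits of Riemann sums of the tangent, so
  by semicontinuity its turning is almost bounded by that of the sums over a fine partition, which
  arise from the sampled tangents by corner cutting.\<close>

lemma TC_bound:
  assumes V: "\<And>N x. nodes L S N x \<Longrightarrow> (\<Sum>l<N. norm (lim_left t (x (Suc l)) - lim_right t (x l))) \<le> V"
    and ts: "inscribed L ts"
  shows "rotation_poly (map c ts) \<le> V + (\<Sum>s\<in>S. \<alpha> s)"
proof (rule field_le_epsilon)
  fix \<epsilon>' :: real assume "0 < \<epsilon>'"
  have ts': "sorted_wrt (<) ts" "set ts \<subseteq> {0..L}" "2 \<le> length ts" "ts \<noteq> []"
    using ts by (auto simp: inscribed_def)
  define M where "M = length ts - 1"
  define \<sigma> where "\<sigma> i = c (ts ! Suc i) - c (ts ! i)" for i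
  \<comment> \<open>Half of \<open>\<epsilon>'\<close> pays for the excess of angles over chords,
    the other half for semicontinuity.\<close>
  define \<epsilon> where "\<epsilon> = \<epsilon>' / (2 * (\<bar>V\<bar> + 1))"
  have eps: "0 < \<epsilon>" "\<epsilon> * V \<le> \<epsilon>' / 2"
  proof -
    show "0 < \<epsilon>" using \<open>0 < \<epsilon>'\<close> by (simp add: \<epsilon>_def add_nonneg_pos)
    have "\<epsilon> * V \<le> \<epsilon> * (\<bar>V\<bar> + 1)" using \<open>0 < \<epsilon>\<close> by (intro mult_left_mono) auto
    also have "\<dots> = \<epsilon>' / 2"
    proof -
      have "\<epsilon>' / (2 * r) * r = \<epsilon>' / 2" if "r \<noteq> 0" for r :: real using that by simp
      moreover have "\<bar>V\<bar> + 1 \<noteq> 0" using abs_ge_zero[of V] by linarith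
      ultimately show ?thesis unfolding \<epsilon>_def by blast
    qed
    finally show "\<epsilon> * V \<le> \<epsilon>' / 2" .
  qed
  obtain e where e: "0 < e" "\<And>Q. (\<And>i. i \<in> set [0..<M] \<Longrightarrow> norm (\<sigma> i - Q i) < e) \<Longrightarrow>
      path_angle 0 (map \<sigma> [0..<M]) \<le> path_angle 0 (map Q [0..<M]) + \<epsilon>' / 2"
    using path_angle_lower_semicontinuous[of "\<epsilon>' / 2" "[0..<M]" \<sigma>] \<open>0 < \<epsilon>'\<close> by auto
  obtain d where d: "0 < d" "\<And>u v :: real^3. norm u = 1 \<Longrightarrow> norm v = 1 \<Longrightarrow> norm (u - v) < d \<Longrightarrow>
      vec_angle u v \<le> (1 + \<epsilon>) * norm (u - v)"
    using vec_angle_le_chord_eps[OF eps(1)] by blast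
  define \<eta> where "\<eta> = min (d / 2) (e / (2 * L))"
  have eta: "0 < \<eta>" "\<eta> < d" "\<eta> * L < e" using d e L_pos by (auto simp: \<eta>_def min_def field_simps)
  obtain \<delta> where dl: "0 < \<delta>" "small_osc L S t \<eta> \<delta>" using small_osc_ex[OF eta(1)] by auto
  obtain N x where nd: "nodes L S N x" and F: "set ts \<subseteq> x ` {..N}" and fine: "\<And>l. l < N \<Longrightarrow> x (Suc l) - x l < \<delta>"
    using nodes_exist[OF L_pos S_finite S_subset' _ ts'(2) dl(1)] by auto
  obtain m where m: "mono m" "\<And>i. m i \<le> N" "\<And>i. i < length ts \<Longrightarrow> x (m i) = ts ! i"
    using nodes_indices[OF nd ts'(1) F ts'(4)] by blast
  define Q where "Q i = (\<Sum>l=m i..<m (Suc i). (x (Suc l) - x l) *\<^sub>R lim_right t (x l))" for i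
  have mle: "m i \<le> m (Suc i)" for i using m(1) by (simp add: monoD)
  have "norm (\<sigma> i - Q i) < e" if "i \<in> set [0..<M]" for i
  proof -
    have i: "Suc i < length ts" using that by (auto simp: M_def)
    have "norm (\<sigma> i - Q i) \<le> \<eta> * (x (m (Suc i)) - x (m i))"
      using chord_sum[OF nd mle[of i] m(2) dl(2) fine] m(3)[of i] m(3)[of "Suc i"] i by (simp add: \<sigma>_def Q_def)
    also have "\<dots> \<le> \<eta> * L"
      using nodes_mem[OF nd m(2)[of i]] nodes_mem[OF nd m(2)[of "Suc i"]] eta(1) by (intro mult_left_mono) auto
    finally show ?thesis using eta(3) by simp
  qed
  note e(2)[OF this]
  moreover have "rotation_poly (map c ts) = path_angle 0 (map \<sigma> [0..<M])"
    unfolding rotation_poly_eq_path_angle map2_tl_conv_nth length_map M_def[symmetric]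
    by (intro arg_cong[where f = "path_angle 0"] map_cong) (auto simp: M_def \<sigma>_def)
  moreover have "path_angle 0 (map Q [0..<M]) \<le> (1 + \<epsilon>) * V + (\<Sum>s\<in>S. \<alpha> s)"
  proof -
    \<comment> \<open>The left tangent takes the place of \<nu>: a jump of the tangent is passed in
      a single turn of at most \<alpha>.\<close>
    let ?f = "\<lambda>l. [lim_right t (x l), lim_left t (x (Suc l)),
      if x (Suc l) \<in> S then lim_left t (x (Suc l)) else lim_left t (x (Suc l))]"
    have "map Q [0..<M] = concat (map (\<lambda>i. [Q i]) [0..<M])" by simp
    also have "\<dots> \<preceq> concat (map (\<lambda>i. map (\<lambda>l. lim_right t (x l)) [m i..<m (Suc i)]) [0..<M])"
    proof (rule turns_less_concat)
      fix i
      have "[\<Sum>l\<leftarrow>[m i..<m (Suc i)]. (x (Suc l) - x l) *\<^sub>R lim_right t (x l)]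
        \<preceq> map (\<lambda>l. lim_right t (x l)) [m i..<m (Suc i)]"
      proof (rule turns_less_sum)
        fix l assume "l \<in> set [m i..<m (Suc i)]"
        then show "0 \<le> x (Suc l) - x l"
          using nodes_cell(3)[OF nd, of l] m(2)[of "Suc i"] by auto
      qed
      then show "[Q i] \<preceq> map (\<lambda>l. lim_right t (x l)) [m i..<m (Suc i)]"
        unfolding Q_def by (simp add: interv_sum_list_conv_sum_set_nat)
    qed
    also have "\<dots> = map (\<lambda>l. lim_right t (x l)) [m 0..<m M]"
    proof (induction M)
      case (Suc M)
      have "m 0 \<le> m M" "m M \<le> m (Suc M)" using m by (auto simp: mono_def)
      then have "[m 0..<m (Suc M)] = [m 0..<m M] @ [m M..<m (Suc M)]"
        by (rule upt_split)
      then show ?case using Suc by simp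
    qed simp
    also have "\<dots> = concat (map (\<lambda>l. [lim_right t (x l)]) [m 0..<m M])" by simp
    also have "\<dots> \<preceq> concat (map ?f [m 0..<m M])"
    proof (intro turns_less_concat)
      have "[p] \<preceq> [p, q, r]" for p q r :: "real^3"
        using turns_less_append_left[OF Nil_turns_less[of "[q, r]"], of "[p]"] by simp
      then show "[lim_right t (x l)] \<preceq> ?f l" for l by blast
    qed
    also have "\<dots> \<preceq> concat (map ?f [0..<m 0]) @ concat (map ?f [m 0..<m M]) @ concat (map ?f [m M..<N])"
      by (rule turns_less_pad)
    also have "\<dots> = concat (map ?f [0..<N])"
    proof -
      have "m 0 \<le> m M" "m M \<le> N" using m by (auto simp: mono_def)
      then have "[0..<N] = [0..<m 0] @ [m 0..<m M] @ [m M..<N]"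
        using upt_split[of 0 "m 0" N] upt_split[of "m 0" "m M" N] by simp
      then show ?thesis by simp
    qed
    finally have "path_angle 0 (map Q [0..<M]) \<le> path_angle 0 (concat (map ?f [0..<N]))"
      by (rule turns_less_path_angle)
    also have "\<dots> \<le> (1 + \<epsilon>) * V + (\<Sum>s\<in>S. \<alpha> s)"
    proof (rule path_bound[OF L_pos nd S_finite S_subset])
      show "norm (lim_left t s) = 1" if "s \<in> S" for s using left_frame[of s] S_subset that by auto
      show "vec_angle (lim_left t s) (lim_left t s) + vec_angle (lim_left t s) (lim_right t s) \<le> \<alpha> s"
        if "s \<in> S" for s
      proof -
        have "lim_left t s \<noteq> 0" using left_frame[of s] S_subset that by auto
        then show ?thesis using jump_angles[OF that] by (simp add: vec_angle_refl)
      qed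
      show "vec_angle (lim_right t (x l)) (lim_left t (x (Suc l)))
        \<le> (1 + \<epsilon>) * norm (lim_right t (x l) - lim_left t (x (Suc l)))" if "l < N" for l
      proof (rule d(2))
        note cell = nodes_cell[OF nd that]
        have "norm (lim_right t (x l) - lim_left t (x (Suc l))) \<le> \<eta>"
          using cell fine[OF that] by (intro small_osc_left[OF dl(2), of "x l" "x (Suc l)"]) auto
        then show "norm (lim_right t (x l) - lim_left t (x (Suc l))) < d" using eta by simp
      qed (use nodes_cell[OF nd that] right_frame left_frame in auto)
    qed (use right_frame left_frame lim_eq V[OF nd] eps in auto)
    finally show ?thesis .
  qed
  ultimately show "rotation_poly (map c ts) \<le> V + (\<Sum>s\<in>S. \<alpha> s) + \<epsilon>'"
    using eps(2) by (simp add: algebra_simps)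
qed

end

section \<open>Cross products of tangents across a window\<close>

context moving_frame
begin

text \<open>The increment of t over the cell is D n up to the oscillation of n. The unit vector v
  will be the tangent at the start of a window; only the part of v - t that is not parallel to n
  causes an error.\<close>

lemma cross_error:
  assumes nd: "nodes L S N x" and l: "l < N" and so: "small_osc L S n \<eta> \<delta>" and fine: "x (Suc l) - x l < \<delta>"
    and v: "norm v = 1"
  shows "norm (cross3 v (lim_left t (x (Suc l)) - lim_right t (x l))
      - (lim_left \<theta> (x (Suc l)) - lim_right \<theta> (x l)) *\<^sub>R lim_right b (x l))
    \<le> (lim_left \<theta> (x (Suc l)) - lim_right \<theta> (x l)) * (norm (cross3 (v - lim_right t (x l)) (lim_right n (x l))) + \<eta>)"
proof -
  note cell = nodes_cell[OF nd l]
  define D where "D = lim_left \<theta> (x (Suc l)) - lim_right \<theta> (x l)"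
  define r where "r = lim_left t (x (Suc l)) - lim_right t (x l) - D *\<^sub>R lim_right n (x l)"
  have r: "norm r \<le> \<eta> * D"
    unfolding r_def D_def
  proof (rule tangent_step)
    fix z assume "z \<in> {x l<..<x (Suc l)}"
    then show "norm (lim_right n z - lim_right n (x l)) \<le> \<eta>"
      using cell fine by (intro small_osc_right[OF so, of "x l" "x (Suc l)"]) auto
  qed (use cell in auto)
  have D: "0 \<le> D" using theta_less[of "x l" "x (Suc l)"] cell by (auto simp: D_def)
  have b: "cross3 (lim_right t (x l)) (lim_right n (x l)) = lim_right b (x l)"
    using right_frame[OF cell(1)] by simp
  have eq: "lim_left t (x (Suc l)) - lim_right t (x l) = D *\<^sub>R lim_right n (x l) + r" by (simp add: r_def)
  have "cross3 v (lim_left t (x (Suc l)) - lim_right t (x l)) - D *\<^sub>R lim_right b (x l)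
    = cross3 v r + D *\<^sub>R cross3 (v - lim_right t (x l)) (lim_right n (x l))"
    unfolding eq b[symmetric]
    by (simp add: cross_add_right cross_mult_right Cross3.left_diff_distrib scaleR_diff_right)
  also have "norm \<dots> \<le> norm (cross3 v r) + D * norm (cross3 (v - lim_right t (x l)) (lim_right n (x l)))"
    using D by (intro order.trans[OF norm_triangle_ineq]) simp
  also have "norm (cross3 v r) \<le> \<eta> * D"
    using norm_cross_le[of v r] r v by simp
  finally show ?thesis by (simp add: D_def algebra_simps)
qed

text \<open>Telescoping in the second factor, starting from the product of a vector with itself;
  without jumps of the tangent each increment is that of a single cell.\<close>

lemma quiet_window:
  assumes nd: "nodes L S N x" and jk: "j \<le> k" "k < N" and so: "small_osc L S n \<eta> \<delta>"
    and fine: "\<And>l. l < N \<Longrightarrow> x (Suc l) - x l < \<delta>"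
    and quiet: "\<And>l. l \<in> {j..<k} \<Longrightarrow> lim_left t (x (Suc l)) = lim_right t (x (Suc l))"
    and e: "\<And>l. l \<in> {j..<k} \<Longrightarrow> norm (cross3 (lim_right t (x j) - lim_right t (x l)) (lim_right n (x l))) \<le> e"
  shows "norm (cross3 (lim_right t (x j)) (lim_right t (x k))
      - (\<Sum>l=j..<k. (lim_left \<theta> (x (Suc l)) - lim_right \<theta> (x l)) *\<^sub>R lim_right b (x l)))
    \<le> (e + \<eta>) * (\<Sum>l=j..<k. lim_left \<theta> (x (Suc l)) - lim_right \<theta> (x l))"
proof -
  let ?D = "\<lambda>l. lim_left \<theta> (x (Suc l)) - lim_right \<theta> (x l)"
  have "cross3 (lim_right t (x j)) (lim_right t (x k))
    = (\<Sum>l=j..<k. cross3 (lim_right t (x j)) (lim_right t (x (Suc l))) - cross3 (lim_right t (x j)) (lim_right t (x l)))"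
    using sum_Suc_diff'[OF jk(1), of "\<lambda>l. cross3 (lim_right t (x j)) (lim_right t (x l))"] by simp
  also have "\<dots> = (\<Sum>l=j..<k. cross3 (lim_right t (x j)) (lim_left t (x (Suc l)) - lim_right t (x l)))"
    by (intro sum.cong refl) (simp add: quiet Cross3.right_diff_distrib)
  finally have "norm (cross3 (lim_right t (x j)) (lim_right t (x k)) - (\<Sum>l=j..<k. ?D l *\<^sub>R lim_right b (x l)))
    = norm (\<Sum>l=j..<k. cross3 (lim_right t (x j)) (lim_left t (x (Suc l)) - lim_right t (x l)) - ?D l *\<^sub>R lim_right b (x l))"
    by (simp add: sum_subtractf)
  also have "\<dots> \<le> (\<Sum>l=j..<k. (e + \<eta>) * ?D l)"
  proof (rule sum_norm_le)
    fix l assume l: "l \<in> {j..<k}"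
    then have lN: "l < N" and jN: "j < N" using jk by auto
    have "norm (cross3 (lim_right t (x j)) (lim_left t (x (Suc l)) - lim_right t (x l)) - ?D l *\<^sub>R lim_right b (x l))
      \<le> ?D l * (norm (cross3 (lim_right t (x j) - lim_right t (x l)) (lim_right n (x l))) + \<eta>)"
      using right_frame[OF nodes_cell(1)[OF nd jN]] by (intro cross_error[OF nd lN so fine[OF lN]]) auto
    also have "\<dots> \<le> ?D l * (e + \<eta>)"
      using e[OF l] theta_less[of "x l" "x (Suc l)"] nodes_cell[OF nd lN] by (intro mult_left_mono) auto
    finally show "norm (cross3 (lim_right t (x j)) (lim_left t (x (Suc l)) - lim_right t (x l)) - ?D l *\<^sub>R lim_right b (x l))
      \<le> (e + \<eta>) * ?D l" by (simp add: mult.commute)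
  qed
  finally show ?thesis by (simp add: sum_distrib_left)
qed

lemma sum_dtheta_le:
  assumes nd: "nodes L S N x" and jk: "j < k" "k \<le> N"
  shows "(\<Sum>l=j..<k. lim_left \<theta> (x (Suc l)) - lim_right \<theta> (x l)) \<le> lim_left \<theta> (x k) - lim_right \<theta> (x j)"
proof -
  have "(\<Sum>l=j..<k. lim_left \<theta> (x (Suc l)) - lim_right \<theta> (x l)) \<le> lim_left \<theta> (x k) - lim_right \<theta> (x j)
    \<and> k \<le> N" if "Suc j \<le> k" "k \<le> N" for k
    using that
  proof (induction k rule: dec_induct)
    case (step k)
    then have "x k \<in> {0<..<L}"
      using nodes_cell(2)[OF nd, of "k - 1"] nodes_cell(1)[OF nd, of k] by auto
    then show ?case using theta_jump[of "x k"] step by simp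
  qed auto
  then show ?thesis using jk by auto
qed

text \<open>
  The binormal of the polygon is governed by the weighted directions atom x l: the rotation of t along a
  cell contributes the binormal b weighted by the increment of \<theta>, and the jump of t at the end of the
  cell contributes the normal \<nu> of the plane of the two one-sided tangents.
\<close>

definition atom :: "(nat \<Rightarrow> real) \<Rightarrow> nat \<Rightarrow> real^3" where
  "atom x l = (lim_left \<theta> (x (Suc l)) - lim_right \<theta> (x l)) *\<^sub>R lim_right b (x l)
    + (if x (Suc l) \<in> S then w (x (Suc l)) *\<^sub>R \<nu> (x (Suc l)) else 0)"

text \<open>Bounds the length of \<open>atom\<close> on each cell and serves as the unit for
  relative errors; unlike the lengths of sums of atoms, it is additive.\<close>

definition weight :: "(nat \<Rightarrow> real) \<Rightarrow> nat \<Rightarrow> real" where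
  "weight x l = (lim_left \<theta> (x (Suc l)) - lim_right \<theta> (x l)) + (if x (Suc l) \<in> S then w (x (Suc l)) else 0)"

lemma weight_nonneg: "nodes L S N x \<Longrightarrow> l < N \<Longrightarrow> 0 \<le> weight x l"
  using theta_less[of "x l" "x (Suc l)"] nodes_cell[of L S N x l] jump_cross by (auto simp: weight_def intro!: add_nonneg_nonneg)

lemma dtheta_le_weight: "(lim_left \<theta> (x (Suc l)) - lim_right \<theta> (x l)) \<le> weight x l"
  using jump_cross by (auto simp: weight_def)

text \<open>The error is relative to the total weight of the cells in between. A jump with w s
  \<noteq> 0 has weight at least w0 and may cause an absolute error 4 \<eta>, whence the term
  \<open>4 / w0\<close>, counted once per jump; the half-open interval makes this count an increment
  of a monotone function of the end points.\<close>

lemma window_error: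
  assumes nd: "nodes L S N x" and son: "small_osc L S n \<eta>' \<delta>'"
    and fine: "\<And>l. l < N \<Longrightarrow> x (Suc l) - x l < \<delta>'" and eta': "0 \<le> \<eta>'"
    and sot: "small_osc L S t \<eta> \<delta>" and soth: "small_osc L S \<theta> \<eta> \<delta>"
    and XY: "0 \<le> X" "X < Y" "Y \<le> L" "Y - X < \<delta>"
    and single: "\<And>s s'. s \<in> S \<Longrightarrow> s' \<in> S \<Longrightarrow> \<bar>s - s'\<bar> < \<delta> \<Longrightarrow> s = s'"
    and w0: "0 < w0" "w0 \<le> 1" "\<And>s. s \<in> S \<Longrightarrow> w s = 0 \<or> w0 \<le> w s"
    and jk: "j \<le> k" "k < N" "X \<le> x j" "x k < Y" and eta: "0 \<le> \<eta>"
  shows "norm (cross3 (lim_right t (x j)) (lim_right t (x k)) - (\<Sum>l=j..<k. atom x l))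
    \<le> (\<eta> * ((K Y - K X) + 4 / w0 * card (S \<inter> {X<..Y})) + \<eta>') * (\<Sum>l=j..<k. weight x l)"
proof -
  let ?D = "\<lambda>l. lim_left \<theta> (x (Suc l)) - lim_right \<theta> (x l)"
  let ?W = "\<Sum>l=j..<k. weight x l"
  have xl: "X \<le> x l" "x l < Y" "x l \<in> {0..<L}" if "l \<in> {j..k}" for l
  proof -
    show "X \<le> x l" "x l < Y" using that jk nodes_le_iff[OF nd, of j l] nodes_le_iff[OF nd, of l k] by auto
    then show "x l \<in> {0..<L}" using XY by auto
  qed
  have xS: "X < x (Suc l)" "x (Suc l) < Y" "x (Suc l) \<in> {0<..<L}" if "l \<in> {j..<k}" for l
    using xl[of l] xl[of "Suc l"] that nodes_cell[OF nd, of l] jk by auto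
  have Wpos: "0 \<le> ?W" using weight_nonneg[OF nd] jk by (intro sum_nonneg) auto
  have DW: "(\<Sum>l=j..<k. ?D l) \<le> ?W" by (intro sum_mono dtheta_le_weight)
  have Kpos: "0 \<le> K Y - K X" using K_mono[of X Y] XY by simp
  have nn: "norm (lim_right n (x l)) = 1" if "l \<in> {j..k}" for l using right_frame[OF xl(3)[OF that]] by simp
  \<comment> \<open>Covers every window whose tangent is continuous between \<open>x j\<close> and
    \<open>x k\<close>; e bounds the part of the tangent difference orthogonal to n.\<close>
  have quiet_case: ?thesis
    if q: "\<And>l. l \<in> {j..<k} \<Longrightarrow> x (Suc l) \<in> S \<Longrightarrow> w (x (Suc l)) = 0"
      and e: "\<And>l. l \<in> {j..<k} \<Longrightarrow> norm (cross3 (lim_right t (x j) - lim_right t (x l)) (lim_right n (x l))) \<le> e"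
      and e0: "0 \<le> e" "e \<le> \<eta> * ((K Y - K X) + 4 / w0 * card (S \<inter> {X<..Y}))" for e
  proof -
    have at: "atom x l = ?D l *\<^sub>R lim_right b (x l)" if "l \<in> {j..<k}" for l
      using q[OF that] by (simp add: atom_def)
    have tt: "lim_left t (x (Suc l)) = lim_right t (x (Suc l))" if "l \<in> {j..<k}" for l
      using q[OF that] lim_eq_S[OF xS(3)[OF that]] jump_cross[of "x (Suc l)"] by (cases "x (Suc l) \<in> S") auto
    have "norm (cross3 (lim_right t (x j)) (lim_right t (x k)) - (\<Sum>l=j..<k. atom x l)) \<le> (e + \<eta>') * (\<Sum>l=j..<k. ?D l)"
      using quiet_window[OF nd jk(1,2) son fine tt e] at by simp
    also have "\<dots> \<le> (e + \<eta>') * ?W" using e0 eta' DW by (intro mult_left_mono) auto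
    also have "\<dots> \<le> (\<eta> * ((K Y - K X) + 4 / w0 * card (S \<inter> {X<..Y})) + \<eta>') * ?W"
      using e0 Wpos by (intro mult_right_mono) auto
    finally show ?thesis .
  qed
  have tj: "norm (cross3 (lim_right t (x j) - lim_right t (x l)) (lim_right n (x l))) \<le> norm (lim_right t (x j) - lim_right t (x l))"
    if "l \<in> {j..<k}" for l
    using norm_cross_le[of "lim_right t (x j) - lim_right t (x l)" "lim_right n (x l)"] nn[of l] that by simp
  show ?thesis
  proof (cases "S \<inter> {X<..<Y} = {}")
    case True
    show ?thesis
    proof (rule quiet_case)
      fix l assume l: "l \<in> {j..<k}"
      show "w (x (Suc l)) = 0" if "x (Suc l) \<in> S" using True xS[OF l] that by auto
      show "norm (cross3 (lim_right t (x j) - lim_right t (x l)) (lim_right n (x l))) \<le> \<eta> * (K Y - K X)"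
      proof (cases "j = l")
        case False
        then have jl: "j < l" "l \<le> N" using l jk by auto
        then have xjl: "x j < x l" using nodes_less_iff[OF nd, of j l] by simp
        have xlS: "x l \<in> {0<..<L} - S"
          using True xl[of l] xl[of j] xjl l by auto
        define T where "T = lim_left \<theta> (x l) - lim_right \<theta> (x j)"
        have T: "0 \<le> T" "T \<le> \<eta>"
        proof -
          show "0 \<le> T" using theta_less[of "x j" "x l"] xjl xl[of j] xl[of l] l by (auto simp: T_def)
          show "T \<le> \<eta>"
            using small_osc_left[OF soth XY(1,3,4) _, of "x j" "x l"] True xjl xl[of j] xl[of l] l
            by (auto simp: T_def Int_commute)
        qed
        have "norm (lim_left t (x l) - lim_right t (x j) - T *\<^sub>R lim_right n (x l)) \<le> (K Y - K X) * T"
          unfolding T_def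
        proof (rule tangent_step)
          show "{x j<..<x l} \<inter> S = {}" using True xl[of j] xl[of l] l by auto
          fix z assume z: "z \<in> {x j<..<x l}"
          have "norm (lim_left n (x l) - lim_right n z) \<le> K (x l) - K z"
            using z xl[of j] xl[of l] l by (intro normal_step) auto
          also have "\<dots> \<le> K Y - K X"
            using K_mono[of X z] K_mono[of "x l" Y] z xl[of j] xl[of l] l XY by auto
          finally show "norm (lim_right n z - lim_right n (x l)) \<le> K Y - K X"
            using lim_eq[OF xlS] by (simp add: norm_minus_commute)
        qed (use xjl xl[of j] xl[of l] l in auto)
        then have 1: "norm (lim_right t (x l) - lim_right t (x j) - T *\<^sub>R lim_right n (x l)) \<le> (K Y - K X) * T"
          using lim_eq[OF xlS] by simp
        \<comment> \<open>The multiple T of the normal at \<open>x l\<close> drops out of the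
          product with that normal; what remains is of second order.\<close>
        have "cross3 (lim_right t (x j) - lim_right t (x l)) (lim_right n (x l))
          = - cross3 (lim_right t (x l) - lim_right t (x j) - T *\<^sub>R lim_right n (x l)) (lim_right n (x l))"
          by (simp add: Cross3.left_diff_distrib cross_mult_left)
        then have "norm (cross3 (lim_right t (x j) - lim_right t (x l)) (lim_right n (x l)))
          \<le> norm (lim_right t (x l) - lim_right t (x j) - T *\<^sub>R lim_right n (x l)) * 1"
          using norm_cross_le[of "lim_right t (x l) - lim_right t (x j) - T *\<^sub>R lim_right n (x l)" "lim_right n (x l)"]
            nn[of l] l by simp
        also have "\<dots> \<le> (K Y - K X) * \<eta>"
          using 1 T Kpos mult_left_mono[OF T(2) Kpos] by simp
        finally show ?thesis by (simp add: mult.commute)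
      qed (use Kpos eta in simp)
    next
      show "0 \<le> \<eta> * (K Y - K X)" using Kpos eta by simp
      show "\<eta> * (K Y - K X) \<le> \<eta> * ((K Y - K X) + 4 / w0 * card (S \<inter> {X<..Y}))"
        using w0 eta by (intro mult_left_mono) auto
    qed
  next
    case False
    then obtain s where s: "s \<in> S" "X < s" "s < Y" by auto
    have uniq: "s' = s" if "s' \<in> S" "s' \<in> {X<..<Y}" for s'
      using single[OF that(1) s(1)] that(2) s XY by (auto simp: abs_real_def)
    have sL: "s \<in> {0<..<L}" using S_subset s(1) by (rule subsetD)
    note free = lone_point[of S X Y s, OF uniq s(2,3)]
    have freeL: "{X<..<s} \<inter> S = {}" by (rule free(1))
    have freeR: "{s<..<Y} \<inter> S = {}" by (rule free(2))
    have card: "1 \<le> real (card (S \<inter> {X<..Y}))"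
    proof -
      have "s \<in> S \<inter> {X<..Y}" using s by auto
      then show ?thesis using S_finite card_gt_0_iff[of "S \<inter> {X<..Y}"] by auto
    qed
    have big: "4 / w0 * \<eta> \<le> \<eta> * ((K Y - K X) + 4 / w0 * card (S \<inter> {X<..Y}))"
    proof -
      have "4 / w0 * 1 \<le> 4 / w0 * card (S \<inter> {X<..Y})" using card w0 by (intro mult_left_mono) auto
      then have "\<eta> * (4 / w0) \<le> \<eta> * ((K Y - K X) + 4 / w0 * card (S \<inter> {X<..Y}))"
        using Kpos eta by (intro mult_left_mono) auto
      then show ?thesis by (simp add: mult.commute)
    qed
    have "4 * \<eta> \<le> 4 / w0 * \<eta>" using w0 eta by (intro mult_right_mono) (auto simp: field_simps)
    then have big2: "2 * \<eta> \<le> \<eta> * ((K Y - K X) + 4 / w0 * card (S \<inter> {X<..Y}))" using big eta by linarith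
    have tL: "norm (lim_right t p - lim_left t s) \<le> \<eta>" if "X \<le> p" "p < s" for p
      using that s XY freeL by (intro small_osc_left[OF sot, of X s]) auto
    have tR: "norm (lim_right t s - lim_right t p) \<le> \<eta>" if "s \<le> p" "p < Y" for p
      using that s XY freeR by (intro small_osc_right[OF sot, of s Y]) auto
    have same: "norm (lim_right t p - lim_right t q) \<le> \<eta>"
      if "X \<le> p" "p \<le> q" "q < Y" "q < s \<or> s \<le> p" for p q
    proof (cases "q < s")
      case True
      then show ?thesis using that s XY freeL by (intro small_osc_right[OF sot, of X s]) auto
    next
      case False
      then show ?thesis using that s XY freeR by (intro small_osc_right[OF sot, of s Y]) auto
    qed
    \<comment> \<open>A jump that leaves the tangent unchanged, a jump not between
      \<open>x j\<close> and \<open>x k\<close>, or a genuine jump of the tangent between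
      them.\<close>
    consider "w s = 0" | "x k < s \<or> s \<le> x j" | "w s \<noteq> 0" "x j < s" "s \<le> x k" by linarith
    then show ?thesis
    proof cases
      case 1
      have eq: "lim_left t s = lim_right t s" using jump_cross[OF s(1)] 1 by simp
      show ?thesis
      proof (rule quiet_case[OF _ _ _ big2])
        fix l assume l: "l \<in> {j..<k}"
        show "w (x (Suc l)) = 0" if "x (Suc l) \<in> S" using uniq[OF that] xS[OF l] 1 by simp
        have xjl: "x j \<le> x l" using nodes_le_iff[OF nd, of j l] l jk by auto
        have "norm (lim_right t (x j) - lim_right t (x l)) \<le> 2 * \<eta>"
        proof (cases "x l < s \<or> s \<le> x j")
          case True
          then show ?thesis using same[of "x j" "x l"] xl[of j] xl[of l] l xjl eta by auto
        next
          case False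
          then have "norm (lim_right t (x j) - lim_left t s) \<le> \<eta>" "norm (lim_right t s - lim_right t (x l)) \<le> \<eta>"
            using xl[of j] xl[of l] l by (auto intro!: tL tR)
          then show ?thesis
            using norm_triangle_ineq[of "lim_right t (x j) - lim_left t s" "lim_right t s - lim_right t (x l)"] eq by simp
        qed
        then show "norm (cross3 (lim_right t (x j) - lim_right t (x l)) (lim_right n (x l))) \<le> 2 * \<eta>"
          using tj[OF l] by simp
      qed (use eta in simp)
    next
      case 2
      show ?thesis
      proof (rule quiet_case[OF _ _ _ big2])
        fix l assume l: "l \<in> {j..<k}"
        have xjl: "x j \<le> x l" "x l < x (Suc l)" "x (Suc l) \<le> x k"
          using nodes_le_iff[OF nd, of j l] nodes_less_iff[OF nd, of l "Suc l"] nodes_le_iff[OF nd, of "Suc l" k] l jk by auto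
        show "w (x (Suc l)) = 0" if "x (Suc l) \<in> S" using uniq[OF that] xS[OF l] xjl 2 by auto
        have "norm (lim_right t (x j) - lim_right t (x l)) \<le> \<eta>"
          using same[of "x j" "x l"] xl[of j] xl[of l] l xjl 2 by auto
        then show "norm (cross3 (lim_right t (x j) - lim_right t (x l)) (lim_right n (x l))) \<le> 2 * \<eta>"
          using tj[OF l] eta by simp
      qed (use eta in simp)
    next
      case 3
      have "s \<in> x ` {..N}" using nd s(1) by (auto simp: nodes_def)
      then obtain r where r: "r \<le> N" "x r = s" by force
      have jr: "j < r" "r \<le> k"
        using nodes_less_iff[OF nd, of j r] nodes_le_iff[OF nd, of r k] r jk 3 by auto
      have ws: "w0 \<le> w s" using w0(3)[OF s(1)] 3 by auto
      have atr: "x (Suc l) \<in> S \<longleftrightarrow> Suc l = r" if "l \<in> {j..<k}" for l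
        using uniq[of "x (Suc l)"] xS[OF that] s(1) r nodes_eq_iff[OF nd, of "Suc l" r] that jk by auto
      have sumS: "(\<Sum>l=j..<k. if x (Suc l) \<in> S then f (x (Suc l)) else 0) = f s" for f :: "real \<Rightarrow> 'a::comm_monoid_add"
      proof -
        have "(\<Sum>l=j..<k. if x (Suc l) \<in> S then f (x (Suc l)) else 0) = (\<Sum>l=j..<k. if l = r - 1 then f s else 0)"
          using atr r jr by (intro sum.cong refl) auto
        also have "\<dots> = f s" using jr by (subst sum.delta) auto
        finally show ?thesis .
      qed
      have at: "(\<Sum>l=j..<k. atom x l) = (\<Sum>l=j..<k. ?D l *\<^sub>R lim_right b (x l)) + w s *\<^sub>R \<nu> s"
        unfolding atom_def sum.distrib sumS[of "\<lambda>s. w s *\<^sub>R \<nu> s"] ..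
      have we: "?W = (\<Sum>l=j..<k. ?D l) + w s"
        unfolding weight_def sum.distrib sumS[of w] ..
      have D0: "0 \<le> ?D l" if "l \<in> {j..<k}" for l
        using theta_less[of "x l" "x (Suc l)"] nodes_cell[OF nd, of l] that jk by auto
      \<comment> \<open>Each side of the jump contributes at most \<eta>; the jump of \<theta>
        itself belongs to no cell.\<close>
      have Dsum: "(\<Sum>l=j..<k. ?D l) \<le> 2 * \<eta>"
      proof -
        have "(\<Sum>l=j..<r. ?D l) \<le> lim_left \<theta> s - lim_right \<theta> (x j)"
          using sum_dtheta_le[OF nd jr(1) r(1)] r by simp
        moreover have "norm (lim_right \<theta> (x j) - lim_left \<theta> s) \<le> \<eta>"
          using freeL s XY jk 3 by (intro small_osc_left[OF soth, of X s]) auto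
        then have "lim_left \<theta> s - lim_right \<theta> (x j) \<le> \<eta>" by simp
        ultimately have 1: "(\<Sum>l=j..<r. ?D l) \<le> \<eta>" by linarith
        have 2: "(\<Sum>l=r..<k. ?D l) \<le> \<eta>"
        proof (cases "r = k")
          case False
          then have "r < k" using jr by simp
          then have "(\<Sum>l=r..<k. ?D l) \<le> lim_left \<theta> (x k) - lim_right \<theta> s"
            using sum_dtheta_le[OF nd, of r k] r jk by simp
          moreover have "s < x k" using nodes_less_iff[OF nd, of r k] r jk \<open>r < k\<close> by auto
          then have "norm (lim_right \<theta> s - lim_left \<theta> (x k)) \<le> \<eta>"
            using freeR s XY jk by (intro small_osc_left[OF soth, of s Y]) auto
          then have "lim_left \<theta> (x k) - lim_right \<theta> s \<le> \<eta>" by simp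
          ultimately show ?thesis by linarith
        qed (use eta in simp)
        have "(\<Sum>l=j..<k. ?D l) = (\<Sum>l=j..<r. ?D l) + (\<Sum>l=r..<k. ?D l)"
          using jr by (simp add: sum.atLeastLessThan_concat)
        then show ?thesis using 1 2 by simp
      qed
      have c1: "norm (cross3 (lim_right t (x j)) (lim_right t (x k)) - w s *\<^sub>R \<nu> s) \<le> 2 * \<eta>"
      proof -
        have "w s *\<^sub>R \<nu> s = cross3 (lim_left t s) (lim_right t s)" using jump_cross[OF s(1)] by simp
        then have "cross3 (lim_right t (x j)) (lim_right t (x k)) - w s *\<^sub>R \<nu> s
          = cross3 (lim_right t (x j) - lim_left t s) (lim_right t (x k)) - cross3 (lim_left t s) (lim_right t s - lim_right t (x k))"
          by (simp add: Cross3.left_diff_distrib Cross3.right_diff_distrib)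
        also have "norm \<dots> \<le> norm (lim_right t (x j) - lim_left t s) * norm (lim_right t (x k))
          + norm (lim_left t s) * norm (lim_right t s - lim_right t (x k))"
          by (intro order.trans[OF norm_triangle_ineq4] add_mono norm_cross_le)
        also have "\<dots> \<le> \<eta> + \<eta>"
        proof -
          have "norm (lim_right t (x k)) = 1" "norm (lim_left t s) = 1"
            using right_frame[of "x k"] left_frame[of s] xl(3)[of k] sL jk by auto
          then show ?thesis using tL[of "x j"] tR[of "x k"] jk 3 by simp
        qed
        finally show ?thesis by simp
      qed
      have c2: "norm (\<Sum>l=j..<k. ?D l *\<^sub>R lim_right b (x l)) \<le> (\<Sum>l=j..<k. ?D l)"
      proof (rule sum_norm_le)
        fix l assume l: "l \<in> {j..<k}"
        then show "norm (?D l *\<^sub>R lim_right b (x l)) \<le> ?D l"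
          using D0[OF l] right_frame[OF xl(3)[of l]] by auto
      qed
      \<comment> \<open>2 \<eta> from replacing the tangents by their limits at s and 2 \<eta> from
        the increments of \<theta>, compared with a total weight of at least w0.\<close>
      have "norm (cross3 (lim_right t (x j)) (lim_right t (x k)) - (\<Sum>l=j..<k. atom x l)) \<le> 4 * \<eta>"
        using norm_triangle_ineq4[of "cross3 (lim_right t (x j)) (lim_right t (x k)) - w s *\<^sub>R \<nu> s" "\<Sum>l=j..<k. ?D l *\<^sub>R lim_right b (x l)"]
          c1 c2 Dsum unfolding at by (simp add: algebra_simps)
      also have "\<dots> = 4 / w0 * \<eta> * w0" using w0 by simp
      also have "\<dots> \<le> (4 / w0 * \<eta>) * ?W"
        using ws we sum_nonneg[of "{j..<k}" ?D, OF D0] w0 eta by (intro mult_left_mono) auto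
      also have "\<dots> \<le> (\<eta> * ((K Y - K X) + 4 / w0 * card (S \<inter> {X<..Y})) + \<eta>') * ?W"
        using big eta' Wpos by (intro mult_right_mono) auto
      finally show ?thesis .
    qed
  qed
qed

text \<open>All atoms of a short window have a definite component along one direction v, which
  excludes cancellation in their sums. Without a jump v is the binormal at X; with a jump it is
  \<open>\<nu> s\<close>, which is within \<alpha>/2 of the one-sided binormals. Of the margin
  \<open>2 * c0\<close>, one half is left for the oscillation \<eta>.\<close>

lemma window_cone:
  assumes nd: "nodes L S N x" and sob: "small_osc L S b \<eta> \<delta>"
    and XY: "0 \<le> X" "X < Y" "Y \<le> L" "Y - X < \<delta>"
    and single: "\<And>s s'. s \<in> S \<Longrightarrow> s' \<in> S \<Longrightarrow> \<bar>s - s'\<bar> < \<delta> \<Longrightarrow> s = s'"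
    and c0: "0 < c0" "c0 \<le> 1/2" "\<And>s. s \<in> S \<Longrightarrow> 2 * c0 \<le> cos (\<alpha> s / 2)" and eta: "\<eta> \<le> c0"
  obtains v where "norm v = 1"
    "\<And>l. l < N \<Longrightarrow> X \<le> x l \<Longrightarrow> x (Suc l) < Y \<Longrightarrow> c0 * weight x l \<le> atom x l \<bullet> v"
proof -
  have key: "c0 * weight x l \<le> atom x l \<bullet> v"
    if l: "l < N" and b: "c0 \<le> lim_right b (x l) \<bullet> v" and j: "x (Suc l) \<in> S \<Longrightarrow> c0 \<le> \<nu> (x (Suc l)) \<bullet> v" for l v
  proof -
    let ?D = "lim_left \<theta> (x (Suc l)) - lim_right \<theta> (x l)"
    have "0 \<le> ?D" using theta_less[of "x l" "x (Suc l)"] nodes_cell[OF nd l] by auto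
    then have "?D * c0 \<le> ?D * (lim_right b (x l) \<bullet> v)" using b by (intro mult_left_mono) auto
    moreover have "w (x (Suc l)) * c0 \<le> w (x (Suc l)) * (\<nu> (x (Suc l)) \<bullet> v)" if "x (Suc l) \<in> S"
      using j[OF that] jump_cross[OF that] by (intro mult_left_mono) auto
    ultimately show ?thesis by (auto simp: atom_def weight_def inner_add_left algebra_simps)
  qed
  have near: "c \<le> p \<bullet> v" if "norm v = 1" "norm (p - q) \<le> \<eta>" "c + \<eta> \<le> q \<bullet> v" for p q v :: "real^3" and c
  proof -
    have "\<bar>(p - q) \<bullet> v\<bar> \<le> \<eta>" using Cauchy_Schwarz_ineq2[of "p - q" v] that by simp
    then show ?thesis using that by (simp add: inner_diff_left)
  qed
  show thesis
  proof (cases "S \<inter> {X<..<Y} = {}")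
    case True
    then have free: "{X<..<Y} \<inter> S = {}" by (simp add: Int_commute)
    show thesis
    proof (rule that)
      show v: "norm (lim_right b X) = 1" using right_frame[of X] XY by simp
      fix l assume l: "l < N" "X \<le> x l" "x (Suc l) < Y"
      show "c0 * weight x l \<le> atom x l \<bullet> lim_right b X"
      proof (rule key[OF l(1)])
        show "c0 \<le> lim_right b (x l) \<bullet> lim_right b X"
        proof (rule near[OF v])
          show "norm (lim_right b (x l) - lim_right b X) \<le> \<eta>"
            using l nodes_cell(3)[OF nd l(1)] XY by (intro small_osc_right[OF sob XY(1,3,4) free]) auto
          show "c0 + \<eta> \<le> lim_right b X \<bullet> lim_right b X" using v c0 eta by (simp add: dot_square_norm)
        qed
        show "c0 \<le> \<nu> (x (Suc l)) \<bullet> lim_right b X" if "x (Suc l) \<in> S"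
        proof -
          have "x (Suc l) \<in> {X<..<Y}" using l nodes_cell(3)[OF nd l(1)] by simp
          then show ?thesis using that True by blast
        qed
      qed
    qed
  next
    case False
    then obtain s where s: "s \<in> S" "X < s" "s < Y" by auto
    have uniq: "s' = s" if "s' \<in> S" "s' \<in> {X<..<Y}" for s'
      using single[OF that(1) s(1)] that(2) s XY by (auto simp: abs_real_def)
    have sL: "s \<in> {0<..<L}" using S_subset s(1) by (rule subsetD)
    note free = lone_point[of S X Y s, OF uniq s(2,3)]
    have freeL: "{X<..<s} \<inter> S = {}" by (rule free(1))
    have freeR: "{s<..<Y} \<inter> S = {}" by (rule free(2))
    have v: "norm (\<nu> s) = 1" using nu[OF s(1)] .
    have unit: "sgn z = z" if "norm z = 1" for z :: "real^3" using that by (simp add: sgn_div_norm)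
    have ang: "2 * c0 \<le> p \<bullet> q" if "vec_angle p q \<le> \<alpha> s / 2" "norm p = 1" "norm q = 1" for p q
    proof -
      have "cos (\<alpha> s / 2) \<le> cos (vec_angle p q)"
        using that jump_angles[OF s(1)] vec_angle_nonneg[of p q] by (intro cos_monotone_0_pi_le) auto
      then show ?thesis using c0(3)[OF s(1)] that by (simp add: cos_vec_angle unit)
    qed
    have bL: "2 * c0 \<le> lim_left b s \<bullet> \<nu> s" and bR: "2 * c0 \<le> lim_right b s \<bullet> \<nu> s"
    proof -
      have "norm (lim_left b s) = 1" "norm (lim_right b s) = 1"
        using left_frame[of s] right_frame[of s] sL by auto
      moreover have "vec_angle (lim_left b s) (\<nu> s) \<le> \<alpha> s / 2" "vec_angle (lim_right b s) (\<nu> s) \<le> \<alpha> s / 2"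
        using jump_angles[OF s(1)] by (simp_all add: vec_angle_commute[of "lim_right b s"])
      ultimately show "2 * c0 \<le> lim_left b s \<bullet> \<nu> s" "2 * c0 \<le> lim_right b s \<bullet> \<nu> s"
        using v ang by blast+
    qed
    show thesis
    proof (rule that[OF v])
      fix l assume l: "l < N" "X \<le> x l" "x (Suc l) < Y"
      note cell = nodes_cell[OF nd l(1)]
      show "c0 * weight x l \<le> atom x l \<bullet> \<nu> s"
      proof (rule key[OF l(1)])
        show "c0 \<le> lim_right b (x l) \<bullet> \<nu> s"
        proof (cases "x l < s")
          case True
          have "norm (lim_right b (x l) - lim_left b s) \<le> \<eta>"
            using True l s XY freeL by (intro small_osc_left[OF sob, of X s]) auto
          from near[OF v this, of c0] show ?thesis using bL eta by simp
        next
          case False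
          have "norm (lim_right b (x l) - lim_right b s) \<le> \<eta>"
            using False l cell(3) s XY freeR by (intro small_osc_right[OF sob, of s Y]) auto
          from near[OF v this, of c0] show ?thesis using bR eta by simp
        qed
        show "c0 \<le> \<nu> (x (Suc l)) \<bullet> \<nu> s" if "x (Suc l) \<in> S"
        proof -
          have "x (Suc l) = s" using l cell(3) by (intro uniq[OF that]) simp
          then show ?thesis using v c0 by (simp add: dot_square_norm)
        qed
      qed
    qed
  qed
qed

end

lemma cross_sum:
  "cross3 (\<Sum>j\<in>A. f j) (\<Sum>k\<in>B. g k) = (\<Sum>j\<in>A. \<Sum>k\<in>B. cross3 (f j) (g k))"
  using bilinear_sum[OF bilinear_cross, of f A g B] by (simp add: sum.cartesian_product)

text \<open>A window spans two segments and neighbouring windows overlap, so their increments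
  telescope with step two and leave two terms at either end.\<close>

lemma sum_two_steps:
  fixes f :: "nat \<Rightarrow> real"
  shows "(\<Sum>i<M. f (Suc (Suc i)) - f i) = f M + f (Suc M) - f 0 - f (Suc 0)"
  by (induction M) auto

section \<open>Local injectivity, the mesh, and the direction of a window\<close>

context moving_frame
begin

text \<open>Let p and q be the one-sided tangents at a jump s in between. If the end points
  coincided, (s - x) p + (y - s) q would have length at most \<eta> (y - x). Its inner product with
  p + q is (y - x) (1 + p \<bullet> q), and 1 + p \<bullet> q is at least 2 cos^2 (\<alpha>/2),
  hence at least 8 c0^2, which contradicts \<open>\<eta> \<le> c0\<^sup>2\<close>.\<close>

lemma c_neq:
  assumes sot: "small_osc L S t \<eta> \<delta>"
    and single: "\<And>s s'. s \<in> S \<Longrightarrow> s' \<in> S \<Longrightarrow> \<bar>s - s'\<bar> < \<delta> \<Longrightarrow> s = s'"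
    and c0: "0 < c0" "c0 \<le> 1/2" "\<And>s. s \<in> S \<Longrightarrow> 2 * c0 \<le> cos (\<alpha> s / 2)" and eta: "\<eta> \<le> c0\<^sup>2"
    and xy: "0 \<le> x" "x < y" "y \<le> L" "y - x < \<delta>"
  shows "c x \<noteq> c y"
proof
  assume eq: "c x = c y"
  have eta1: "\<eta> < 1"
  proof -
    have "c0\<^sup>2 \<le> (1/2)\<^sup>2" using c0 by (intro power_mono) auto
    then show ?thesis using eta by (simp add: power2_eq_square)
  qed
  show False
  proof (cases "{x<..<y} \<inter> S = {}")
    case True
    have "norm (c y - c x - (y - x) *\<^sub>R lim_right t x) \<le> \<eta> * (y - x)"
    proof (rule c_step)
      fix z assume "z \<in> {x<..<y}"
      then show "norm (lim_right t z - lim_right t x) \<le> \<eta>"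
        using True xy by (intro small_osc_right[OF sot, of x y]) auto
    qed (use xy True in auto)
    moreover have "norm (lim_right t x) = 1" using right_frame[of x] xy by auto
    ultimately have "y - x \<le> \<eta> * (y - x)" using eq xy by simp
    moreover have "\<eta> * (y - x) < 1 * (y - x)" using eta1 xy by (intro mult_strict_right_mono) auto
    ultimately show False by simp
  next
    case False
    then obtain s where s: "s \<in> S" "x < s" "s < y" by auto
    have uniq: "s' = s" if "s' \<in> S" "s' \<in> {x<..<y}" for s'
      using single[OF that(1) s(1)] that(2) s xy by (auto simp: abs_real_def)
    note free = lone_point[of S x y s, OF uniq s(2,3)]
    have freeL: "{x<..<s} \<inter> S = {}" by (rule free(1))
    have freeR: "{s<..<y} \<inter> S = {}" by (rule free(2))
    have sL: "s \<in> {0<..<L}" using S_subset s(1) by (rule subsetD)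
    define p q where "p = lim_left t s" and "q = lim_right t s"
    have pq: "norm p = 1" "norm q = 1" using left_frame[of s] right_frame[of s] sL by (auto simp: p_def q_def)
    have 1: "norm (c s - c x - (s - x) *\<^sub>R p) \<le> \<eta> * (s - x)"
      unfolding p_def
    proof (rule c_step)
      fix z assume "z \<in> {x<..<s}"
      then show "norm (lim_right t z - lim_left t s) \<le> \<eta>"
        using freeL xy s by (intro small_osc_left[OF sot, of x s]) auto
    qed (use xy s freeL in auto)
    have 2: "norm (c y - c s - (y - s) *\<^sub>R q) \<le> \<eta> * (y - s)"
      unfolding q_def
    proof (rule c_step)
      fix z assume "z \<in> {s<..<y}"
      then show "norm (lim_right t z - lim_right t s) \<le> \<eta>"
        using freeR xy s by (intro small_osc_right[OF sot, of s y]) auto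
    qed (use xy s freeR in auto)
    have sum: "(c s - c x - (s - x) *\<^sub>R p) + (c y - c s - (y - s) *\<^sub>R q) = - ((s - x) *\<^sub>R p + (y - s) *\<^sub>R q)"
      using eq by simp
    have "norm ((s - x) *\<^sub>R p + (y - s) *\<^sub>R q) \<le> \<eta> * (s - x) + \<eta> * (y - s)"
      using norm_triangle_ineq[of "c s - c x - (s - x) *\<^sub>R p" "c y - c s - (y - s) *\<^sub>R q"] 1 2
      unfolding sum norm_minus_cancel by linarith
    also have "\<dots> = \<eta> * (y - x)" by (simp add: algebra_simps)
    finally have 3: "norm ((s - x) *\<^sub>R p + (y - s) *\<^sub>R q) \<le> \<eta> * (y - x)" .
    have "p \<bullet> p = 1" "q \<bullet> q = 1" using pq by (simp_all add: dot_square_norm)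
    then have "((s - x) *\<^sub>R p + (y - s) *\<^sub>R q) \<bullet> (p + q) = (y - x) * (1 + p \<bullet> q)"
      by (simp add: inner_add_left inner_add_right inner_commute algebra_simps)
    then have "(y - x) * (1 + p \<bullet> q) \<le> norm ((s - x) *\<^sub>R p + (y - s) *\<^sub>R q) * norm (p + q)"
      using norm_cauchy_schwarz[of "(s - x) *\<^sub>R p + (y - s) *\<^sub>R q" "p + q"] by simp
    also have "\<dots> \<le> (\<eta> * (y - x)) * 2"
      using 3 pq norm_triangle_ineq[of p q] order_trans[OF norm_ge_zero 3] by (intro mult_mono) auto
    finally have "(y - x) * (1 + p \<bullet> q) \<le> (y - x) * (2 * \<eta>)" by (simp add: algebra_simps)
    then have "1 + p \<bullet> q \<le> 2 * \<eta>" using xy by simp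
    moreover have "cos (\<alpha> s) \<le> p \<bullet> q"
    proof -
      have "cos (\<alpha> s) \<le> cos (vec_angle p q)"
        using jump_angles[OF s(1)] vec_angle_nonneg[of p q]
        by (intro cos_monotone_0_pi_le) (auto simp: p_def q_def)
      then show ?thesis using pq by (simp add: cos_vec_angle sgn_div_norm)
    qed
    moreover have "cos (\<alpha> s) = 2 * (cos (\<alpha> s / 2))\<^sup>2 - 1" using cos_double_cos[of "\<alpha> s / 2"] by simp
    moreover have "(2 * c0)\<^sup>2 \<le> (cos (\<alpha> s / 2))\<^sup>2" using c0(1) c0(3)[OF s(1)] by (intro power_mono) auto
    moreover have "0 < c0\<^sup>2" using c0 by simp
    ultimately show False using eta by (simp add: power_mult_distrib)
  qed
qed

lemma uniform_constants:
  obtains c0 w0 \<delta>0 where "0 < c0" "c0 \<le> 1/2" "\<And>s. s \<in> S \<Longrightarrow> 2 * c0 \<le> cos (\<alpha> s / 2)"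
    "0 < w0" "w0 \<le> 1" "\<And>s. s \<in> S \<Longrightarrow> w s = 0 \<or> w0 \<le> w s"
    "0 < \<delta>0" "\<And>s s'. s \<in> S \<Longrightarrow> s' \<in> S \<Longrightarrow> \<bar>s - s'\<bar> < \<delta>0 \<Longrightarrow> s = s'"
proof -
  \<comment> \<open>The inserted 1 covers an empty S and provides the upper bounds on c0 and
    w0.\<close>
  define c0 where "c0 = Min (insert 1 ((\<lambda>s. cos (\<alpha> s / 2)) ` S)) / 2"
  define w0 where "w0 = Min (insert 1 (w ` {s\<in>S. w s \<noteq> 0}))"
  define \<delta>0 where "\<delta>0 = Min (insert 1 ((\<lambda>(s, s'). \<bar>s - s'\<bar>) ` {(s, s'). s \<in> S \<and> s' \<in> S \<and> s \<noteq> s'}))"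
  have fin: "finite {(s, s'). s \<in> S \<and> s' \<in> S \<and> s \<noteq> s'}"
    by (rule finite_subset[of _ "S \<times> S"]) (use S_finite in auto)
  show thesis
  proof
    have "0 < cos (\<alpha> s / 2)" if "s \<in> S" for s
      using jump_angles[OF that] by (intro cos_gt_zero_pi) auto
    then show "0 < c0" using S_finite by (simp add: c0_def)
    show "c0 \<le> 1/2" using S_finite by (simp add: c0_def)
    show "2 * c0 \<le> cos (\<alpha> s / 2)" if "s \<in> S" for s using S_finite that by (simp add: c0_def)
    have "0 < w s" if "s \<in> S" "w s \<noteq> 0" for s using jump_cross[OF that(1)] that(2) by simp
    then show "0 < w0" using S_finite by (simp add: w0_def)
    show "w0 \<le> 1" using S_finite by (simp add: w0_def)
    show "w s = 0 \<or> w0 \<le> w s" if "s \<in> S" for s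
    proof (cases "w s = 0")
      case False
      then have "w0 \<le> w s" unfolding w0_def using S_finite that by (intro Min_le) auto
      then show ?thesis ..
    qed simp
    show "0 < \<delta>0" using fin unfolding \<delta>0_def by (subst Min_gr_iff) auto
    show "s = s'" if "s \<in> S" "s' \<in> S" "\<bar>s - s'\<bar> < \<delta>0" for s s'
    proof (rule ccontr)
      assume "s \<noteq> s'"
      then have "\<delta>0 \<le> \<bar>s - s'\<bar>" unfolding \<delta>0_def using fin that by (intro Min_le) force+
      then show False using that by simp
    qed
  qed
qed

text \<open>The mesh measures diameters in space, whereas the windows must be short in the
  parameter. Finitely many pairs of nearby parameters with distinct images are fixed; a long
  parameter interval contains one of these pairs, so its arc has diameter at least e.\<close>

lemma mesh_small:
  assumes "0 < \<delta>"
  obtains e where "0 < e" "\<And>ts i. inscribed L ts \<Longrightarrow> mesh c ts < e \<Longrightarrow> Suc i < length ts \<Longrightarrow> ts ! Suc i - ts ! i < \<delta>"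
proof -
  obtain c0 w0 \<delta>0 where c0: "0 < c0" "c0 \<le> 1/2" "\<And>s. s \<in> S \<Longrightarrow> 2 * c0 \<le> cos (\<alpha> s / 2)"
    and d0: "0 < \<delta>0" "\<And>s s'. s \<in> S \<Longrightarrow> s' \<in> S \<Longrightarrow> \<bar>s - s'\<bar> < \<delta>0 \<Longrightarrow> s = s'"
    using uniform_constants by metis
  obtain \<delta>1 where d1: "0 < \<delta>1" "small_osc L S t (c0\<^sup>2) \<delta>1"
    using small_osc_ex[of "c0\<^sup>2"] c0 by auto
  define d where "d = min \<delta>0 \<delta>1"
  have d: "0 < d" "small_osc L S t (c0\<^sup>2) d" "\<And>s s'. s \<in> S \<Longrightarrow> s' \<in> S \<Longrightarrow> \<bar>s - s'\<bar> < d \<Longrightarrow> s = s'"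
    using d0 d1 small_osc_mono[OF d1(2), of d] by (auto simp: d_def)
  obtain M :: nat where M: "2 * L / \<delta> < real M" using reals_Archimedean2 by blast
  have "0 < 2 * L / \<delta>" using L_pos assms by simp
  then have M0: "0 < real M" using M by linarith
  define h where "h = L / M"
  have h: "0 < h" "2 * h < \<delta>" "h * M = L"
    using M M0 L_pos assms by (auto simp: h_def field_simps)
  \<comment> \<open>Close enough to k h for local injectivity and less than h away from it, so that
    an interval longer than 2 h contains such a pair.\<close>
  define q where "q k = real k * h + min (h / 2) (d / 2)" for k :: nat
  have q: "real k * h < q k" "q k < real k * h + h" "q k - real k * h < d" for k
    using h(1) d(1) by (auto simp: q_def min_def)
  define e where "e = Min ((\<lambda>k. norm (c (real k * h) - c (q k))) ` {..<M})"
  have kh: "real k * h + h \<le> L" if "k < M" for k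
  proof -
    have "real (Suc k) * h \<le> real M * h" using that h by (intro mult_right_mono) auto
    then show ?thesis using h by (simp add: algebra_simps)
  qed
  show thesis
  proof
    have "c (real k * h) \<noteq> c (q k)" if "k < M" for k
      using q[of k] kh[OF that] h by (intro c_neq[OF d(2,3) c0]) auto
    then show "0 < e" unfolding e_def using M0 by (subst Min_gr_iff) auto
    fix ts i assume ts: "inscribed L ts" "mesh c ts < e" "Suc i < length ts"
    show "ts ! Suc i - ts ! i < \<delta>"
    proof (rule ccontr)
      assume "\<not> ts ! Suc i - ts ! i < \<delta>"
      then have gap: "ts ! i + 2 * h < ts ! Suc i" using h by simp
      have mem: "ts ! i \<in> {0..L}" "ts ! Suc i \<in> {0..L}"
      proof -
        have "set ts \<subseteq> {0..L}" using ts(1) by (simp add: inscribed_def)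
        then show "ts ! i \<in> {0..L}" "ts ! Suc i \<in> {0..L}"
          using ts(3) by (meson Suc_lessD nth_mem subsetD)+
      qed
      define k where "k = nat \<lceil>ts ! i / h\<rceil>"
      have "0 \<le> ts ! i / h" using mem h by simp
      then have "ts ! i / h \<le> real k" "real k < ts ! i / h + 1" unfolding k_def by linarith+
      then have k: "ts ! i \<le> real k * h" "real k * h < ts ! i + h"
        using h by (simp_all add: field_simps)
      then have "real k * h < real M * h" using gap mem h by (simp add: mult.commute)
      then have kM: "k < M" using h by simp
      let ?A = "{ts ! i..ts ! Suc i}"
      have in_A: "real k * h \<in> ?A" "q k \<in> ?A" using k q[of k] gap h by auto
      have "bounded (c ` ?A)"
      proof (rule boundedI)
        fix z assume "z \<in> c ` ?A"
        then obtain y where y: "y \<in> ?A" "z = c y" by blast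
        then have "norm (c y - c 0) \<le> y - 0" using mem by (intro c_lipschitz) auto
        then show "norm z \<le> norm (c 0) + L"
          using norm_triangle_ineq2[of "c y" "c 0"] y mem by auto
      qed
      then have "dist (c (real k * h)) (c (q k)) \<le> diameter (c ` ?A)"
        using in_A by (intro diameter_bounded_bound) auto
      moreover have "diameter (c ` ?A) \<le> mesh c ts"
        unfolding mesh_def
      proof (rule Max_ge)
        have "finite {i. Suc i < length ts}" by (rule finite_subset[of _ "{..<length ts}"]) auto
        then show "finite ((\<lambda>i. diameter (c ` {ts ! i..ts ! Suc i})) ` {i. Suc i < length ts})" by simp
      qed (use ts(3) in simp)
      moreover have "e \<le> dist (c (real k * h)) (c (q k))"
        unfolding e_def dist_norm using kM by (intro Min_le) auto
      ultimately show False using ts(2) by simp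
    qed
  qed
qed

text \<open>Let T be the same average with the weights in place of the atoms. Then P and Q differ by
  at most E T, while the component of Q along v is at least c0 T. Thus E / c0 controls the angle,
  and Q can vanish only together with P.\<close>

lemma window_angle:
  assumes nd: "nodes L S N x" and son: "small_osc L S n \<eta>' \<delta>'"
    and fine: "\<And>l. l < N \<Longrightarrow> x (Suc l) - x l < \<delta>'" and eta': "0 \<le> \<eta>'"
    and so: "small_osc L S t \<eta> \<delta>" "small_osc L S \<theta> \<eta> \<delta>" "small_osc L S b \<eta> \<delta>"
    and single: "\<And>s s'. s \<in> S \<Longrightarrow> s' \<in> S \<Longrightarrow> \<bar>s - s'\<bar> < \<delta> \<Longrightarrow> s = s'"
    and c0: "0 < c0" "c0 \<le> 1/2" "\<And>s. s \<in> S \<Longrightarrow> 2 * c0 \<le> cos (\<alpha> s / 2)"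
    and w0: "0 < w0" "w0 \<le> 1" "\<And>s. s \<in> S \<Longrightarrow> w s = 0 \<or> w0 \<le> w s"
    and eta: "0 \<le> \<eta>" "\<eta> \<le> c0"
    and pqr: "p \<le> q" "q \<le> r" "r \<le> N" "x r - x p < \<delta>"
    and h: "\<And>l. 0 \<le> h l"
  defines "P \<equiv> cross3 (\<Sum>j=p..<q. h j *\<^sub>R lim_right t (x j)) (\<Sum>k=q..<r. h k *\<^sub>R lim_right t (x k))"
    and "Q \<equiv> (\<Sum>j=p..<q. \<Sum>k=q..<r. (h j * h k) *\<^sub>R (\<Sum>l=j..<k. atom x l))"
    and "E \<equiv> \<eta> * ((K (x r) - K (x p)) + 4 / w0 * card (S \<inter> {x p<..x r})) + \<eta>'"
  assumes P0: "P \<noteq> 0"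
  shows "Q \<noteq> 0 \<and> vec_angle P Q \<le> pi * (E / c0)"
proof -
  have "p < q" "q < r" using P0 by (auto simp: P_def intro!: le_neq_implies_less pqr)
  then have XY: "0 \<le> x p" "x p < x r" "x r \<le> L"
    using nodes_mem[OF nd, of p] nodes_mem[OF nd, of r] nodes_less_iff[OF nd, of p r] pqr by auto
  have E: "0 \<le> E"
    unfolding E_def using eta w0 eta' K_mono[of "x p" "x r"] XY by (intro add_nonneg_nonneg mult_nonneg_nonneg) auto
  have loc: "x p \<le> x l" "x l < x r" if "p \<le> l" "l < r" for l
    using that pqr nodes_le_iff[OF nd, of p l] nodes_less_iff[OF nd, of l r] by auto
  obtain v where v: "norm v = 1" "\<And>l. l < N \<Longrightarrow> x p \<le> x l \<Longrightarrow> x (Suc l) < x r \<Longrightarrow> c0 * weight x l \<le> atom x l \<bullet> v"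
    using window_cone[OF nd so(3) XY pqr(4) single c0 eta(2)] by blast
  define T where "T = (\<Sum>j=p..<q. \<Sum>k=q..<r. (h j * h k) * (\<Sum>l=j..<k. weight x l))"
  have PQ: "norm (P - Q) \<le> E * T"
  proof -
    have "P - Q = (\<Sum>j=p..<q. \<Sum>k=q..<r. (h j * h k) *\<^sub>R
        (cross3 (lim_right t (x j)) (lim_right t (x k)) - (\<Sum>l=j..<k. atom x l)))"
      unfolding P_def Q_def cross_sum
      by (simp add: sum_subtractf scaleR_diff_right cross_mult_left cross_mult_right mult.commute)
    also have "norm \<dots> \<le> (\<Sum>j=p..<q. \<Sum>k=q..<r. (h j * h k) * (E * (\<Sum>l=j..<k. weight x l)))"
    proof (intro sum_norm_le)
      fix j k assume jk: "j \<in> {p..<q}" "k \<in> {q..<r}"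
      have "norm (cross3 (lim_right t (x j)) (lim_right t (x k)) - (\<Sum>l=j..<k. atom x l)) \<le> E * (\<Sum>l=j..<k. weight x l)"
        unfolding E_def
        using jk pqr loc[of j] loc[of k]
        by (intro window_error[OF nd son fine eta' so(1,2) XY pqr(4) single w0 _ _ _ _ eta(1)]) auto
      then show "norm ((h j * h k) *\<^sub>R (cross3 (lim_right t (x j)) (lim_right t (x k)) - (\<Sum>l=j..<k. atom x l)))
        \<le> (h j * h k) * (E * (\<Sum>l=j..<k. weight x l))"
        using h by (simp add: mult_left_mono)
    qed
    also have "\<dots> = E * T"
      unfolding T_def
      by (subst sum_distrib_left, intro sum.cong refl, subst sum_distrib_left, intro sum.cong refl)
        (simp only: mult_ac)
    finally show ?thesis .
  qed
  have QT: "c0 * T \<le> norm Q"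
  proof -
    have "c0 * T = (\<Sum>j=p..<q. \<Sum>k=q..<r. (h j * h k) * (\<Sum>l=j..<k. c0 * weight x l))"
      unfolding T_def sum_distrib_left[symmetric, of c0 "weight x"]
      by (subst sum_distrib_left, intro sum.cong refl, subst sum_distrib_left, intro sum.cong refl)
        (simp only: mult_ac)
    also have "\<dots> \<le> (\<Sum>j=p..<q. \<Sum>k=q..<r. (h j * h k) * (\<Sum>l=j..<k. atom x l \<bullet> v))"
    proof (intro sum_mono mult_left_mono)
      fix j k l assume jkl: "j \<in> {p..<q}" "k \<in> {q..<r}" "l \<in> {j..<k}"
      then show "c0 * weight x l \<le> atom x l \<bullet> v"
        using pqr loc[of l] loc[of "Suc l"] by (intro v(2)) auto
    qed (use h in simp)
    also have "\<dots> = Q \<bullet> v" by (simp add: Q_def inner_sum_left)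
    also have "\<dots> \<le> norm Q" using norm_cauchy_schwarz[of Q v] v by simp
    finally show ?thesis .
  qed
  have T0: "0 \<le> T"
    unfolding T_def using h weight_nonneg[OF nd] pqr
    by (intro sum_nonneg mult_nonneg_nonneg) auto
  have Q0: "Q \<noteq> 0"
  proof
    assume "Q = 0"
    then have "T = 0" using QT T0 c0 by (simp add: mult_le_0_iff)
    then show False using PQ \<open>Q = 0\<close> P0 by simp
  qed
  have "vec_angle Q P \<le> pi * (norm (Q - P) / norm Q)" using Q0 P0 by (rule vec_angle_le_relative)
  also have "norm (Q - P) / norm Q \<le> E / c0"
  proof -
    have "norm (Q - P) * c0 \<le> (E * T) * c0"
      using PQ c0 by (intro mult_right_mono) (auto simp: norm_minus_commute)
    also have "\<dots> \<le> E * norm Q" using mult_left_mono[OF QT E] by (simp add: mult_ac)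
    finally show ?thesis using Q0 c0 by (simp add: field_simps)
  qed
  finally show ?thesis using Q0 by (simp add: vec_angle_commute)
qed

text \<open>The left binormal is inserted to obtain the triples of
  \<open>path_bound\<close>.\<close>

lemma atom_turns_less:
  assumes "nodes L S N x" "l < N"
  shows "[atom x l] \<preceq> [lim_right b (x l), lim_left b (x (Suc l)),
      if x (Suc l) \<in> S then \<nu> (x (Suc l)) else lim_left b (x (Suc l))]"
proof -
  let ?\<nu> = "if x (Suc l) \<in> S then \<nu> (x (Suc l)) else lim_left b (x (Suc l))"
  let ?W = "if x (Suc l) \<in> S then w (x (Suc l)) else 0"
  have D: "0 \<le> lim_left \<theta> (x (Suc l)) - lim_right \<theta> (x l)"
    using theta_less[of "x l" "x (Suc l)"] nodes_cell[OF assms] by auto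
  have W: "0 \<le> ?W" using jump_cross by auto
  have "atom x l = (lim_left \<theta> (x (Suc l)) - lim_right \<theta> (x l)) *\<^sub>R lim_right b (x l) + ?W *\<^sub>R ?\<nu>"
    by (simp add: atom_def)
  then have "[atom x l] \<preceq> [(lim_left \<theta> (x (Suc l)) - lim_right \<theta> (x l)) *\<^sub>R lim_right b (x l)] @ [?W *\<^sub>R ?\<nu>]"
    using turns_less_add by simp
  also have "\<dots> \<preceq> [lim_right b (x l)] @ [?\<nu>]" using D W by (intro turns_less_append turns_less_scale)
  also have "\<dots> \<preceq> [lim_right b (x l)] @ [lim_left b (x (Suc l))] @ [?\<nu>]" by (rule turns_less_insert)
  finally show ?thesis by simp
qed

end

section \<open>Total absolute torsion\<close>

context moving_frame
begin

text \<open>\<epsilon> is spent in four quarters: semicontinuity, the window errors of scale \<eta>,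
  those of scale \<open>\<eta>'\<close>, and the excess of angles over chords. The scale \<eta>
  fixes the mesh e and must not depend on the polygon; \<open>\<eta>'\<close> is chosen once the
  polygon and its number of windows are known.\<close>

lemma TAT_bound:
  assumes V: "\<And>N x. nodes L S N x \<Longrightarrow> (\<Sum>l<N. norm (lim_left b (x (Suc l)) - lim_right b (x l))) \<le> V"
    and "0 < \<epsilon>"
  obtains e where "0 < e" "\<And>ts. inscribed L ts \<Longrightarrow> mesh c ts < e \<Longrightarrow>
    TAT_poly (map c ts) \<le> V + (\<Sum>s\<in>S. \<alpha> s) + \<epsilon>"
proof -
  obtain c0 w0 \<delta>0 where c0: "0 < c0" "c0 \<le> 1/2" "\<And>s. s \<in> S \<Longrightarrow> 2 * c0 \<le> cos (\<alpha> s / 2)"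
    and w0: "0 < w0" "w0 \<le> 1" "\<And>s. s \<in> S \<Longrightarrow> w s = 0 \<or> w0 \<le> w s"
    and d0: "0 < \<delta>0" "\<And>s s'. s \<in> S \<Longrightarrow> s' \<in> S \<Longrightarrow> \<bar>s - s'\<bar> < \<delta>0 \<Longrightarrow> s = s'"
    using uniform_constants by blast
  \<comment> \<open>Joins both kinds of window error into increments of one monotone function: the
    variation of n, and a mass \<open>4 / w0\<close> at every jump.\<close>
  define Kt where "Kt y = K y + 4 / w0 * card (S \<inter> {..y})" for y
  have Kt_diff: "Kt y - Kt z = (K y - K z) + 4 / w0 * card (S \<inter> {z<..y})" if "z \<le> y" for y z
  proof -
    have "S \<inter> {..y} = (S \<inter> {..z}) \<union> (S \<inter> {z<..y})" using that by auto
    moreover have "card ((S \<inter> {..z}) \<union> (S \<inter> {z<..y})) = card (S \<inter> {..z}) + card (S \<inter> {z<..y})"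
      using S_finite by (intro card_Un_disjoint) auto
    ultimately show ?thesis by (simp add: Kt_def distrib_left)
  qed
  have Kt_mono: "Kt z \<le> Kt y" if "0 \<le> z" "z \<le> y" "y \<le> L" for y z
  proof -
    have "0 \<le> 4 / w0 * card (S \<inter> {z<..y})" using w0(1) by simp
    then show ?thesis using Kt_diff[OF that(2)] K_mono[OF that] by linarith
  qed
  \<comment> \<open>Overlapping windows count the total increment at most twice; the 1 keeps R
    positive.\<close>
  define R where "R = 2 * (Kt L - Kt 0) + 1"
  have R: "0 < R" using Kt_mono[of 0 L] L_pos by (simp add: R_def)
  define \<eta> where "\<eta> = min (c0\<^sup>2) (\<epsilon> * c0 / (8 * pi * R))"
  have eta: "0 < \<eta>" "\<eta> \<le> c0\<^sup>2" "\<eta> \<le> c0" "2 * pi / c0 * (\<eta> * R) \<le> \<epsilon> / 4"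
  proof -
    show "0 < \<eta>" using c0 R assms(2) by (simp add: \<eta>_def)
    show 1: "\<eta> \<le> c0\<^sup>2" by (simp add: \<eta>_def)
    have "c0\<^sup>2 \<le> c0 * 1" unfolding power2_eq_square using c0 by (intro mult_left_mono) auto
    then show "\<eta> \<le> c0" using 1 by simp
    have "2 * pi / c0 * (\<eta> * R) \<le> 2 * pi / c0 * (\<epsilon> * c0 / (8 * pi * R) * R)"
      using c0 R by (intro mult_left_mono mult_right_mono) (auto simp: \<eta>_def)
    also have "\<dots> = \<epsilon> / 4" using c0 R by simp
    finally show "2 * pi / c0 * (\<eta> * R) \<le> \<epsilon> / 4" .
  qed
  obtain \<delta>1 where d1: "0 < \<delta>1" "small_osc L S t \<eta> \<delta>1" "small_osc L S b \<eta> \<delta>1" "small_osc L S \<theta> \<eta> \<delta>1"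
    using small_osc_ex[OF eta(1)] by blast
  define \<delta> where "\<delta> = min \<delta>0 \<delta>1"
  have d: "0 < \<delta>" "\<delta> \<le> \<delta>1" "\<delta> \<le> \<delta>0" using d0 d1 by (auto simp: \<delta>_def)
  note so = small_osc_mono[OF d1(2) d(2)] small_osc_mono[OF d1(4) d(2)] small_osc_mono[OF d1(3) d(2)]
  have single: "s = s'" if "s \<in> S" "s' \<in> S" "\<bar>s - s'\<bar> < \<delta>" for s s'
    using d0(2)[OF that(1,2)] that(3) d(3) by simp
  \<comment> \<open>A window consists of two consecutive segments, hence half of \<delta> for
    each.\<close>
  obtain e where e: "0 < e" "\<And>ts i. inscribed L ts \<Longrightarrow> mesh c ts < e \<Longrightarrow> Suc i < length ts \<Longrightarrow> ts ! Suc i - ts ! i < \<delta> / 2"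
    using mesh_small[of "\<delta> / 2"] d by (metis half_gt_zero)
  show thesis
  proof (rule that[OF e(1)])
    fix ts assume ts: "inscribed L ts" "mesh c ts < e"
    have gap: "ts ! Suc i - ts ! i < \<delta> / 2" if "Suc i < length ts" for i using e(2)[OF ts that] .
    have ts': "sorted_wrt (<) ts" "set ts \<subseteq> {0..L}" "2 \<le> length ts" "ts \<noteq> []"
      using ts by (auto simp: inscribed_def)
    have step: "0 \<le> ts ! i" "ts ! i < ts ! Suc i" "ts ! Suc i \<le> L" if "Suc i < length ts" for i
      using sorted_wrt_nth_less[OF ts'(1), of i "Suc i"] that
        subsetD[OF ts'(2) nth_mem[of i]] subsetD[OF ts'(2) nth_mem[of "Suc i"]] by auto
    \<comment> \<open>The number of consecutive pairs of segments, that is, of cross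
      products.\<close>
    define M where "M = length ts - 2"
    have len: "length ts = Suc (Suc M)" using ts'(3) by (simp add: M_def)
    define \<sigma> where "\<sigma> i = c (ts ! Suc i) - c (ts ! i)" for i
    define B where "B i = cross3 (\<sigma> i) (\<sigma> (Suc i))" for i
    obtain e1 where e1: "0 < e1" "\<And>Q. (\<And>i. i \<in> set [0..<M] \<Longrightarrow> norm (B i - Q i) < e1) \<Longrightarrow>
        path_angle 0 (map B [0..<M]) \<le> path_angle 0 (map Q [0..<M]) + \<epsilon> / 4"
      using path_angle_lower_semicontinuous[of "\<epsilon> / 4" "[0..<M]" B] assms(2) by auto
    define \<epsilon>1 where "\<epsilon>1 = \<epsilon> / (4 * (\<bar>V\<bar> + 1))"
    have eps1: "0 < \<epsilon>1" "\<epsilon>1 * V \<le> \<epsilon> / 4"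
    proof -
      have V1: "0 < \<bar>V\<bar> + 1" by simp
      then show pos: "0 < \<epsilon>1" using assms(2) by (simp add: \<epsilon>1_def)
      have "\<epsilon>1 * V \<le> \<epsilon>1 * (\<bar>V\<bar> + 1)" using pos by (intro mult_left_mono) auto
      also have "\<dots> = \<epsilon> / 4"
      proof -
        have "\<epsilon> / (4 * r) * r = \<epsilon> / 4" if "0 < r" for r :: real using that by simp
        from this[OF V1] show ?thesis by (simp only: \<epsilon>1_def)
      qed
      finally show "\<epsilon>1 * V \<le> \<epsilon> / 4" .
    qed
    obtain dc where dc: "0 < dc" "\<And>u v :: real^3. norm u = 1 \<Longrightarrow> norm v = 1 \<Longrightarrow> norm (u - v) < dc \<Longrightarrow>
        vec_angle u v \<le> (1 + \<epsilon>1) * norm (u - v)"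
      using vec_angle_le_chord_eps[OF eps1(1)] by blast
    \<comment> \<open>Three demands: cross products of segments and of Riemann sums differ by less
      than e1, chords in a cell are short enough to be compared with angles, and the M additional
      window errors stay within a quarter of \<epsilon>.\<close>
    define \<eta>' where "\<eta>' = Min {e1 / (4 * L\<^sup>2), dc / 2, \<epsilon> * c0 / (8 * pi * (real M + 1))}"
    have eta': "0 < \<eta>'" "3 * \<eta>' * L\<^sup>2 < e1" "\<eta>' < dc" "2 * pi / c0 * (real M * \<eta>') \<le> \<epsilon> / 4"
    proof -
      have M1: "0 < real M + 1" by simp
      show pos: "0 < \<eta>'" using e1 L_pos dc assms(2) c0 M1 by (simp add: \<eta>'_def)
      have "\<eta>' \<le> e1 / (4 * L\<^sup>2)" by (simp add: \<eta>'_def)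
      then have "\<eta>' * (4 * L\<^sup>2) \<le> e1" using L_pos by (simp add: le_divide_eq)
      moreover have "0 < \<eta>' * L\<^sup>2" using pos L_pos by simp
      moreover have "\<eta>' * (4 * L\<^sup>2) = 4 * (\<eta>' * L\<^sup>2)" "3 * \<eta>' * L\<^sup>2 = 3 * (\<eta>' * L\<^sup>2)" by simp_all
      ultimately show "3 * \<eta>' * L\<^sup>2 < e1" using e1(1) by linarith
      have "\<eta>' \<le> dc / 2" by (simp add: \<eta>'_def)
      then show "\<eta>' < dc" using dc by simp
      have "2 * pi / c0 * (real M * \<eta>') \<le> 2 * pi / c0 * ((real M + 1) * (\<epsilon> * c0 / (8 * pi * (real M + 1))))"
        using c0 pos by (intro mult_left_mono mult_mono) (auto simp: \<eta>'_def)
      also have "\<dots> = \<epsilon> / 4"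
      proof -
        have "2 * pi / c0 * (r * (\<epsilon> * c0 / (8 * pi * r))) = \<epsilon> / 4" if "0 < r" for r using that c0 by simp
        from this[OF M1] show ?thesis .
      qed
      finally show "2 * pi / c0 * (real M * \<eta>') \<le> \<epsilon> / 4" .
    qed
    obtain \<delta>' where dl: "0 < \<delta>'" "small_osc L S t \<eta>' \<delta>'" "small_osc L S n \<eta>' \<delta>'" "small_osc L S b \<eta>' \<delta>'"
      using small_osc_ex[OF eta'(1)] by blast
    obtain N x where nd: "nodes L S N x" and F: "set ts \<subseteq> x ` {..N}" and fine: "\<And>l. l < N \<Longrightarrow> x (Suc l) - x l < \<delta>'"
      using nodes_exist[OF L_pos S_finite S_subset' _ ts'(2) dl(1)] by blast
    obtain m where m: "mono m" "\<And>i. m i \<le> N" "\<And>i. i < length ts \<Longrightarrow> x (m i) = ts ! i"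
      using nodes_indices[OF nd ts'(1) F ts'(4)] by blast
    have mle: "m i \<le> m (Suc i)" for i using m(1) by (simp add: monoD)
    \<comment> \<open>Extended by zero beyond the partition, because
      \<open>turns_less_windows\<close> asks for nonnegative weights at every index.\<close>
    define h where "h l = (if l < N then x (Suc l) - x l else 0)" for l
    have h: "0 \<le> h l" for l using nodes_cell(3)[OF nd, of l] by (auto simp: h_def)
    define q where "q i = (\<Sum>l=m i..<m (Suc i). h l *\<^sub>R lim_right t (x l))" for i
    have q_eq: "q i = (\<Sum>l=m i..<m (Suc i). (x (Suc l) - x l) *\<^sub>R lim_right t (x l))" for i
      unfolding q_def using m(2)[of "Suc i"] by (intro sum.cong refl) (simp add: h_def)
    have q: "norm (\<sigma> i - q i) \<le> \<eta>' * L" "norm (\<sigma> i) \<le> L" "norm (q i) \<le> L" if "Suc i < length ts" for i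
    proof -
      have "norm (\<sigma> i - q i) \<le> \<eta>' * (x (m (Suc i)) - x (m i))"
        using chord_sum[OF nd mle[of i] m(2) dl(2) fine] m(3)[of i] m(3)[of "Suc i"] that by (simp add: \<sigma>_def q_eq)
      also have "\<dots> \<le> \<eta>' * L"
        using nodes_mem[OF nd m(2)[of i]] nodes_mem[OF nd m(2)[of "Suc i"]] eta'(1) by (intro mult_left_mono) auto
      finally show "norm (\<sigma> i - q i) \<le> \<eta>' * L" .
      show "norm (\<sigma> i) \<le> L"
        using c_lipschitz[of "ts ! i" "ts ! Suc i"] step[OF that] by (simp add: \<sigma>_def)
      have "norm (q i) \<le> (\<Sum>l=m i..<m (Suc i). x (Suc l) - x l)"
        unfolding q_eq
      proof (rule sum_norm_le)
        fix l assume "l \<in> {m i..<m (Suc i)}"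
        then have l: "l < N" using m(2)[of "Suc i"] by simp
        show "norm ((x (Suc l) - x l) *\<^sub>R lim_right t (x l)) \<le> x (Suc l) - x l"
          using nodes_cell(3)[OF nd l] right_frame[OF nodes_cell(1)[OF nd l]] by simp
      qed
      also have "\<dots> = x (m (Suc i)) - x (m i)" by (rule sum_Suc_diff'[OF mle])
      also have "\<dots> \<le> L" using nodes_mem[OF nd m(2)[of i]] nodes_mem[OF nd m(2)[of "Suc i"]] by auto
      finally show "norm (q i) \<le> L" .
    qed
    define P where "P i = cross3 (q i) (q (Suc i))" for i
    define Q where "Q i = (\<Sum>j=m i..<m (Suc i). \<Sum>k=m (Suc i)..<m (Suc (Suc i)). (h j * h k) *\<^sub>R (\<Sum>l=j..<k. atom x l))" for i
    have BP: "norm (B i - P i) < e1" if "i \<in> set [0..<M]" for i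
    proof -
      have i: "Suc i < length ts" "Suc (Suc i) < length ts" using that len by auto
      have "B i - P i = cross3 (\<sigma> i - q i) (\<sigma> (Suc i)) + cross3 (q i) (\<sigma> (Suc i) - q (Suc i))"
        by (simp add: B_def P_def Cross3.left_diff_distrib Cross3.right_diff_distrib)
      also have "norm \<dots> \<le> norm (\<sigma> i - q i) * norm (\<sigma> (Suc i)) + norm (q i) * norm (\<sigma> (Suc i) - q (Suc i))"
        by (intro order.trans[OF norm_triangle_ineq] add_mono norm_cross_le)
      also have "\<dots> \<le> (\<eta>' * L) * L + L * (\<eta>' * L)"
        using q[OF i(1)] q[OF i(2)] eta'(1) L_pos by (intro add_mono mult_mono) auto
      also have "\<dots> \<le> 3 * \<eta>' * L\<^sup>2" using eta'(1) L_pos by (simp add: power2_eq_square)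
      finally show ?thesis using eta'(2) by simp
    qed
    define E where "E i = \<eta> * (Kt (ts ! Suc (Suc i)) - Kt (ts ! i)) + \<eta>'" for i
    have ang: "Q i \<noteq> 0 \<and> vec_angle (P i) (Q i) \<le> pi * (E i / c0)" if "i \<in> set [0..<M]" "P i \<noteq> 0" for i
    proof -
      have i: "Suc i < length ts" "Suc (Suc i) < length ts" using that len by auto
      have xm: "x (m i) = ts ! i" "x (m (Suc (Suc i))) = ts ! Suc (Suc i)" using m(3) i by auto
      have "ts ! i \<le> ts ! Suc (Suc i)" using step(2)[OF i(1)] step(2)[OF i(2)] by simp
      note Kd = Kt_diff[OF this]
      have short: "x (m (Suc (Suc i))) - x (m i) < \<delta>"
        unfolding xm using gap[OF i(1)] gap[OF i(2)] by simp
      show ?thesis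
        unfolding P_def Q_def E_def Kd q_def unfolding xm[symmetric]
        by (rule window_angle[OF nd dl(3) fine less_imp_le[OF eta'(1)] so single c0 w0 less_imp_le[OF eta(1)] eta(3)
            mle mle m(2) short h that(2)[unfolded P_def q_def]])
    qed
    have E0: "0 \<le> E i" if "i \<in> set [0..<M]" for i
    proof -
      have i: "Suc i < length ts" "Suc (Suc i) < length ts" using that len by auto
      have "Kt (ts ! i) \<le> Kt (ts ! Suc (Suc i))"
        using step[OF i(1)] step[OF i(2)] by (intro Kt_mono) auto
      then show ?thesis using eta(1) eta'(1) by (simp add: E_def)
    qed
    have sumE: "(\<Sum>i<M. E i) \<le> \<eta> * R + real M * \<eta>'"
    proof -
      have K1: "Kt (ts ! M) \<le> Kt L" "Kt (ts ! Suc M) \<le> Kt L" "Kt 0 \<le> Kt (ts ! 0)" "Kt 0 \<le> Kt (ts ! Suc 0)"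
        using step[of M] step[of 0] len by (auto intro!: Kt_mono)
      have "(\<Sum>i<M. E i) = \<eta> * (Kt (ts ! M) + Kt (ts ! Suc M) - Kt (ts ! 0) - Kt (ts ! Suc 0)) + real M * \<eta>'"
        unfolding E_def sum.distrib sum_distrib_left[symmetric] sum_two_steps[of "\<lambda>i. Kt (ts ! i)"] by simp
      also have "\<dots> \<le> \<eta> * R + real M * \<eta>'"
        using K1 eta(1) by (intro add_right_mono mult_left_mono) (auto simp: R_def)
      finally show ?thesis .
    qed
    let ?f = "\<lambda>l. [lim_right b (x l), lim_left b (x (Suc l)),
      if x (Suc l) \<in> S then \<nu> (x (Suc l)) else lim_left b (x (Suc l))]"
    have "TAT_poly (map c ts) \<le> path_angle 0 (map B [0..<M])"
    proof -
      have ss: "map2 (-) (tl (map c ts)) (map c ts) = map \<sigma> [0..<Suc M]"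
        unfolding map2_tl_conv_nth by (rule map_cong) (auto simp: len \<sigma>_def)
      have nz: "z \<noteq> 0" if zin: "z \<in> set (map2 (-) (tl (map c ts)) (map c ts))" for z
      proof -
        have "z \<in> \<sigma> ` {..<Suc M}" using zin unfolding ss set_map by (simp only: set_upt atLeast0LessThan)
        then obtain i where i: "i < Suc M" "z = \<sigma> i" by blast
        then have i': "Suc i < length ts" using len by simp
        have "c (ts ! i) \<noteq> c (ts ! Suc i)"
          by (rule c_neq[OF so(1) single c0 eta(2) step(1)[OF i'] step(2)[OF i'] step(3)[OF i']])
            (use gap[OF i'] d in auto)
        then show ?thesis using i by (simp add: \<sigma>_def)
      qed
      have eq: "map2 cross3 (map \<sigma> [0..<Suc M]) (tl (map \<sigma> [0..<Suc M])) = map B [0..<M]"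
        unfolding map2_conv_nth_tl by (rule map_cong) (auto simp: B_def simp del: upt_Suc)
      show ?thesis using TAT_poly_le_path_angle[of "map c ts", OF nz] unfolding ss eq .
    qed
    also have "\<dots> \<le> path_angle 0 (map P [0..<M]) + \<epsilon> / 4" by (rule e1(2)[OF BP])
    also have "path_angle 0 (map P [0..<M]) \<le> path_angle 0 (map Q [0..<M]) + 2 * (\<Sum>i\<leftarrow>[0..<M]. pi * (E i / c0))"
      using ang E0 c0 by (intro path_angle_compare) auto
    also have "2 * (\<Sum>i\<leftarrow>[0..<M]. pi * (E i / c0)) \<le> \<epsilon> / 2"
    proof -
      have "2 * (\<Sum>i\<leftarrow>[0..<M]. pi * (E i / c0)) = 2 * (\<Sum>i<M. pi * (E i / c0))"
        by (simp add: interv_sum_list_conv_sum_set_nat atLeast0LessThan)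
      also have "\<dots> = 2 * pi / c0 * (\<Sum>i<M. E i)"
        unfolding sum_distrib_left by (intro sum.cong refl) simp
      also have "\<dots> \<le> 2 * pi / c0 * (\<eta> * R + real M * \<eta>')"
        using c0 sumE by (intro mult_left_mono) auto
      also have "\<dots> = 2 * pi / c0 * (\<eta> * R) + 2 * pi / c0 * (real M * \<eta>')" by (rule distrib_left)
      finally show ?thesis using eta(4) eta'(4) by linarith
    qed
    also have "path_angle 0 (map Q [0..<M]) \<le> path_angle 0 (concat (map ?f [0..<N]))"
    proof (rule turns_less_path_angle)
      have "map Q [0..<M] \<preceq> map (atom x) [m 0..<m (Suc M)]"
        unfolding Q_def by (rule turns_less_windows[OF h m(1)])
      also have "\<dots> = concat (map (\<lambda>l. [atom x l]) [m 0..<m (Suc M)])" by simp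
      also have "\<dots> \<preceq> concat (map ?f [m 0..<m (Suc M)])"
      proof (rule turns_less_concat)
        fix l assume "l \<in> set [m 0..<m (Suc M)]"
        then have "l < N" using m(2)[of "Suc M"] by simp
        then show "[atom x l] \<preceq> ?f l" by (rule atom_turns_less[OF nd])
      qed
      also have "\<dots> \<preceq> concat (map ?f [0..<m 0]) @ concat (map ?f [m 0..<m (Suc M)]) @ concat (map ?f [m (Suc M)..<N])"
        by (rule turns_less_pad)
      also have "\<dots> = concat (map ?f [0..<N])"
      proof -
        have "m 0 \<le> m (Suc M)" "m (Suc M) \<le> N" using m by (auto simp: mono_def)
        then have "[0..<N] = [0..<m 0] @ [m 0..<m (Suc M)] @ [m (Suc M)..<N]"
          using upt_split[of 0 "m 0" N] upt_split[of "m 0" "m (Suc M)" N] by simp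
        then show ?thesis by simp
      qed
      finally show "map Q [0..<M] \<preceq> concat (map ?f [0..<N])" .
    qed
    also have "\<dots> \<le> (1 + \<epsilon>1) * V + (\<Sum>s\<in>S. \<alpha> s)"
    proof (rule path_bound[OF L_pos nd S_finite S_subset])
      show "norm (\<nu> s) = 1" if "s \<in> S" for s using nu[OF that] .
      show "vec_angle (lim_left b s) (\<nu> s) + vec_angle (\<nu> s) (lim_right b s) \<le> \<alpha> s" if "s \<in> S" for s
        using jump_angles[OF that] by linarith
      show "vec_angle (lim_right b (x l)) (lim_left b (x (Suc l)))
        \<le> (1 + \<epsilon>1) * norm (lim_right b (x l) - lim_left b (x (Suc l)))" if "l < N" for l
      proof (rule dc(2))
        note cell = nodes_cell[OF nd that]
        have "norm (lim_right b (x l) - lim_left b (x (Suc l))) \<le> \<eta>'"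
          using cell fine[OF that] by (intro small_osc_left[OF dl(4), of "x l" "x (Suc l)"]) auto
        then show "norm (lim_right b (x l) - lim_left b (x (Suc l))) < dc" using eta'(3) by simp
      qed (use nodes_cell[OF nd that] right_frame left_frame in auto)
    qed (use right_frame left_frame lim_eq V[OF nd] eps1 in auto)
    finally show "TAT_poly (map c ts) \<le> V + (\<Sum>s\<in>S. \<alpha> s) + \<epsilon>"
      using eps1(2) by (simp add: algebra_simps)
  qed
qed

end

section \<open>Functions of bounded variation on an interval\<close>

lemma BV_tendsto_left: "BV L u \<Longrightarrow> s \<in> {0<..L} \<Longrightarrow> (u \<longlongrightarrow> lim_left u s) (at_left s)"
  unfolding BV_def lim_left_def by (metis tendsto_Lim trivial_limit_at_left_real)

lemma BV_tendsto_right: "BV L u \<Longrightarrow> s \<in> {0..<L} \<Longrightarrow> (u \<longlongrightarrow> lim_right u s) (at_right s)"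
  unfolding BV_def lim_right_def by (metis tendsto_Lim trivial_limit_at_right_real)

lemma lim_left_eq: "(u \<longlongrightarrow> l) (at_left s) \<Longrightarrow> lim_left u s = l"
  unfolding lim_left_def by (rule tendsto_Lim) (simp_all add: trivial_limit_at_left_real)

lemma lim_right_eq: "(u \<longlongrightarrow> l) (at_right s) \<Longrightarrow> lim_right u s = l"
  unfolding lim_right_def by (rule tendsto_Lim) (simp_all add: trivial_limit_at_right_real)

lemma BV_distr_deriv: "BV L u \<Longrightarrow> distr_deriv L u (deriv_measure L u)"
  unfolding BV_def deriv_measure_def by (metis someI_ex)

lemma has_density_sets:
  assumes "has_density E \<mu> \<nu> f" "A \<in> sets borel" "A \<subseteq> E"
  shows "A \<in> sets \<nu>"
proof -
  have "A = E \<inter> A" using assms by auto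
  then show ?thesis using assms by (auto simp: has_density_def sets_restrict_space)
qed

lemma has_density_measurable:
  assumes "has_density E \<mu> \<nu> f" "g \<in> borel_measurable borel"
  shows "g \<in> borel_measurable \<nu>"
proof -
  have "g \<in> borel_measurable (restrict_space borel E)" using assms(2) by (rule measurable_restrict_space1)
  moreover have "sets \<nu> = sets (restrict_space borel E)" using assms by (simp add: has_density_def)
  ultimately show ?thesis using measurable_cong_sets by blast
qed

lemma integrable_scaleR_bounded:
  fixes f :: "'a \<Rightarrow> 'b::euclidean_space"
  assumes "g \<in> borel_measurable M" "\<And>x. \<bar>g x\<bar> \<le> C" "integrable M f"
  shows "integrable M (\<lambda>x. g x *\<^sub>R f x)"
proof (rule Bochner_Integration.integrable_bound)
  show "integrable M (\<lambda>x. C *\<^sub>R f x)" using assms(3) by simp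
  show "(\<lambda>x. g x *\<^sub>R f x) \<in> borel_measurable M" using assms by simp
  have "\<bar>g x\<bar> \<le> \<bar>C\<bar>" for x using assms(2)[of x] by linarith
  then show "AE x in M. norm (g x *\<^sub>R f x) \<le> norm (C *\<^sub>R f x)" by (auto intro!: mult_right_mono)
qed

lemma bounded_on_Icc:
  fixes g :: "real \<Rightarrow> real"
  assumes "continuous_on UNIV g"
  obtains C where "0 \<le> C" "\<And>x. x \<in> {a..b} \<Longrightarrow> \<bar>g x\<bar> \<le> C"
proof -
  have "bounded (g ` {a..b})"
    by (intro compact_imp_bounded compact_continuous_image continuous_on_subset[OF assms]) auto
  then obtain C where C: "\<forall>x\<in>{a..b}. \<bar>g x\<bar> \<le> C" by (auto simp: bounded_iff)
  have "\<bar>g x\<bar> \<le> \<bar>C\<bar>" if "x \<in> {a..b}" for x using bspec[OF C that] by linarith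
  then show thesis using that[of "\<bar>C\<bar>"] by auto
qed

lemma set_integrable_scaleR_continuous:
  fixes u :: "real \<Rightarrow> 'a::euclidean_space"
  assumes "continuous_on UNIV g" "set_integrable lborel {0<..<L} u"
  shows "set_integrable lborel {0<..<L} (\<lambda>x. g x *\<^sub>R u x)"
proof -
  obtain C where C: "0 \<le> C" "\<And>x. x \<in> {0..L} \<Longrightarrow> \<bar>g x\<bar> \<le> C" using bounded_on_Icc[OF assms(1), of 0 L] by blast
  have "integrable lborel (\<lambda>x. (indicator {0<..<L} x * g x) *\<^sub>R (indicator {0<..<L} x *\<^sub>R u x))"
  proof (rule integrable_scaleR_bounded)
    have "g \<in> borel_measurable borel" using assms(1) by (rule borel_measurable_continuous_onI)
    then show "(\<lambda>x. indicator {0<..<L} x * g x) \<in> borel_measurable lborel" by simp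
    show "\<bar>indicator {0<..<L} x * g x\<bar> \<le> C" for x using C(1) C(2)[of x] by (auto simp: indicator_def)
  qed (use assms(2) in \<open>simp add: set_integrable_def\<close>)
  also have "(\<lambda>x. (indicator {0<..<L} x * g x) *\<^sub>R (indicator {0<..<L} x *\<^sub>R u x))
    = (\<lambda>x. indicator {0<..<L} x *\<^sub>R g x *\<^sub>R u x)" by (auto simp: indicator_def fun_eq_iff)
  finally show ?thesis by (simp add: set_integrable_def)
qed

lemma test_function_bounded:
  fixes g :: "real \<Rightarrow> real"
  assumes "\<And>x. (g has_real_derivative g' x) (at x)" "\<And>x. x \<notin> {a..b} \<Longrightarrow> g x = 0"
  obtains C where "g \<in> borel_measurable borel" "\<And>x. \<bar>g x\<bar> \<le> C"
proof -
  have "continuous_on UNIV g" using assms(1) DERIV_isCont continuous_at_imp_continuous_on by blast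
  moreover obtain C where "0 \<le> C" "\<And>x. x \<in> {a..b} \<Longrightarrow> \<bar>g x\<bar> \<le> C" using bounded_on_Icc[OF calculation] by blast
  ultimately show thesis using that[of C] assms(2) borel_measurable_continuous_onI by (metis abs_zero)
qed

lemma has_density_linear:
  assumes F: "bounded_linear F" and "has_density E \<mu> \<nu> f"
  shows "has_density E (\<lambda>A. F (\<mu> A)) \<nu> (\<lambda>x. F (f x))"
  unfolding has_density_def
proof (intro conjI ballI)
  have int: "integrable \<nu> f" using assms by (simp add: has_density_def)
  show "integrable \<nu> (\<lambda>x. F (f x))" using integrable_bounded_linear[OF F int] .
  fix A assume A: "A \<in> sets \<nu>"
  have "integrable \<nu> (\<lambda>x. indicator A x *\<^sub>R f x)" using integrable_mult_indicator[OF A int] .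
  from integral_bounded_linear[OF F this] show "F (\<mu> A) = (LINT x:A|\<nu>. F (f x))"
    using assms A by (simp add: has_density_def set_lebesgue_integral_def linear_simps[OF F])
qed (use assms in \<open>auto simp: has_density_def\<close>)

lemma distr_deriv_linear:
  fixes u :: "real \<Rightarrow> 'a::euclidean_space" and F :: "'a \<Rightarrow> 'b::euclidean_space"
  assumes F: "bounded_linear F" and u: "set_integrable lborel {0<..<L} u" and "distr_deriv L u \<mu>"
  shows "distr_deriv L (\<lambda>s. F (u s)) (\<lambda>A. F (\<mu> A))"
proof -
  obtain \<nu> f where d: "has_density {0<..<L} \<mu> \<nu> f" and
    test: "\<And>g g'. (\<forall>x. (g has_real_derivative g' x) (at x)) \<and> continuous_on UNIV g' \<and>
      (\<exists>a b. 0 < a \<and> b < L \<and> (\<forall>x. x \<notin> {a..b} \<longrightarrow> g x = 0)) \<Longrightarrow>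
      (LINT x:{0<..<L}|lborel. g' x *\<^sub>R u x) = - (LINT x|\<nu>. g x *\<^sub>R f x)"
    using assms(3) unfolding distr_deriv_def by blast
  show ?thesis
    unfolding distr_deriv_def
  proof (intro exI conjI allI impI)
    show "has_density {0<..<L} (\<lambda>A. F (\<mu> A)) \<nu> (\<lambda>x. F (f x))" by (rule has_density_linear[OF F d])
    fix g g' :: "real \<Rightarrow> real" assume *: "(\<forall>x. (g has_real_derivative g' x) (at x)) \<and> continuous_on UNIV g' \<and>
      (\<exists>a b. 0 < a \<and> b < L \<and> (\<forall>x. x \<notin> {a..b} \<longrightarrow> g x = 0))"
    then obtain a b where ab: "\<And>x. x \<notin> {a..b} \<Longrightarrow> g x = 0" by blast
    obtain C where C: "g \<in> borel_measurable borel" "\<And>x. \<bar>g x\<bar> \<le> C"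
      by (rule test_function_bounded[of g g' a b]) (use * ab in auto)
    have i1: "integrable lborel (\<lambda>x. indicator {0<..<L} x *\<^sub>R g' x *\<^sub>R u x)"
      using set_integrable_scaleR_continuous[OF _ u, of g'] * by (simp add: set_integrable_def)
    have i2: "integrable \<nu> (\<lambda>x. g x *\<^sub>R f x)"
      using d by (intro integrable_scaleR_bounded[OF has_density_measurable[OF d C(1)] C(2)]) (simp add: has_density_def)
    have "(LINT x:{0<..<L}|lborel. g' x *\<^sub>R F (u x)) = F (LINT x:{0<..<L}|lborel. g' x *\<^sub>R u x)"
      using integral_bounded_linear[OF F i1] by (simp add: set_lebesgue_integral_def linear_simps[OF F])
    also have "\<dots> = - F (LINT x|\<nu>. g x *\<^sub>R f x)" unfolding test[OF *] by (simp add: linear_simps[OF F])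
    also have "F (LINT x|\<nu>. g x *\<^sub>R f x) = (LINT x|\<nu>. g x *\<^sub>R F (f x))"
      using integral_bounded_linear[OF F i2] by (simp add: linear_simps[OF F])
    finally show "(LINT x:{0<..<L}|lborel. g' x *\<^sub>R F (u x)) = - (LINT x|\<nu>. g x *\<^sub>R F (f x))" .
  qed
qed

lemma BV_linear:
  fixes u :: "real \<Rightarrow> 'a::euclidean_space" and F :: "'a \<Rightarrow> 'b::euclidean_space"
  assumes F: "bounded_linear F" and "BV L u"
  shows "BV L (\<lambda>s. F (u s))"
  unfolding BV_def
proof (intro conjI ballI)
  have u: "set_integrable lborel {0<..<L} u" using assms by (simp add: BV_def)
  show "set_integrable lborel {0<..<L} (\<lambda>s. F (u s))"
    using integrable_bounded_linear[OF F u[unfolded set_integrable_def]]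
    by (simp add: set_integrable_def linear_simps[OF F])
  show "\<exists>\<mu>. distr_deriv L (\<lambda>s. F (u s)) \<mu>"
    using distr_deriv_linear[OF F u BV_distr_deriv[OF assms(2)]] by blast
  show "\<exists>l. ((\<lambda>s. F (u s)) \<longlongrightarrow> l) (at_left s)" if "s \<in> {0<..L}" for s
    using bounded_linear.tendsto[OF F BV_tendsto_left[OF assms(2) that]] by blast
  show "\<exists>l. ((\<lambda>s. F (u s)) \<longlongrightarrow> l) (at_right s)" if "s \<in> {0..<L}" for s
    using bounded_linear.tendsto[OF F BV_tendsto_right[OF assms(2) that]] by blast
qed

lemma lim_linear:
  assumes F: "bounded_linear F" and "BV L u"
  shows "s \<in> {0<..L} \<Longrightarrow> lim_left (\<lambda>s. F (u s)) s = F (lim_left u s)"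
    and "s \<in> {0..<L} \<Longrightarrow> lim_right (\<lambda>s. F (u s)) s = F (lim_right u s)"
  using bounded_linear.tendsto[OF F BV_tendsto_left[OF assms(2)]]
    bounded_linear.tendsto[OF F BV_tendsto_right[OF assms(2)]]
  by (auto intro: lim_left_eq lim_right_eq)

text \<open>Densities can be added only over one reference measure. The sum of the two measures
  dominates both, and the Radon-Nikodym derivatives may be taken real-valued because all measures
  are finite.\<close>

lemma common_density:
  assumes 1: "has_density E \<mu>1 \<nu>1 f1" and 2: "has_density E \<mu>2 \<nu>2 f2"
  obtains M h1 h2 where "finite_measure M" "sets M = sets (restrict_space borel E)"
    "h1 \<in> borel_measurable M" "h2 \<in> borel_measurable M" "\<And>x. 0 \<le> h1 x" "\<And>x. 0 \<le> h2 x"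
    "\<nu>1 = density M (\<lambda>x. ennreal (h1 x))" "\<nu>2 = density M (\<lambda>x. ennreal (h2 x))"
proof -
  let ?s = "sets (restrict_space borel E)"
  have s: "sets \<nu>1 = ?s" "sets \<nu>2 = ?s" using 1 2 by (simp_all add: has_density_def)
  interpret f1: finite_measure \<nu>1 using 1 by (simp add: has_density_def)
  interpret f2: finite_measure \<nu>2 using 2 by (simp add: has_density_def)
  define M where "M = measure_of (space \<nu>1) (sets \<nu>1) (\<lambda>A. emeasure \<nu>1 A + emeasure \<nu>2 A)"
  have sM: "sets M = sets \<nu>1" and spM: "space M = space \<nu>1" by (simp_all add: M_def sets.space_closed sets.sigma_sets_eq)
  have em: "emeasure M A = emeasure \<nu>1 A + emeasure \<nu>2 A" if "A \<in> sets \<nu>1" for A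
    unfolding M_def
  proof (rule emeasure_measure_of_sigma)
    show "sigma_algebra (space \<nu>1) (sets \<nu>1)" by (rule sets.sigma_algebra_axioms)
    show "positive (sets \<nu>1) (\<lambda>A. emeasure \<nu>1 A + emeasure \<nu>2 A)" by (simp add: positive_def)
    show "countably_additive (sets \<nu>1) (\<lambda>A. emeasure \<nu>1 A + emeasure \<nu>2 A)"
      unfolding countably_additive_def
      using s by (auto simp: suminf_add[symmetric] suminf_emeasure simp flip: suminf_emeasure)
  qed (use that in simp)
  have fM: "finite_measure M"
    by (rule finite_measureI) (simp add: spM em)
  interpret M: finite_measure M by (rule fM)
  have ac: "absolutely_continuous M N" if "N = \<nu>1 \<or> N = \<nu>2" for N
    unfolding absolutely_continuous_def using that em sM s by (auto simp: null_sets_def)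
  have D: "\<exists>h. h \<in> borel_measurable M \<and> (\<forall>x. 0 \<le> h x) \<and> N = density M (\<lambda>x. ennreal (h x))"
    if N12: "N = \<nu>1 \<or> N = \<nu>2" for N
  proof -
    have N: "finite_measure N" "sets N = sets M" using N12 s sM f1.finite_measure_axioms f2.finite_measure_axioms by auto
    obtain D where D: "D \<in> borel_measurable M" "AE x in M. RN_deriv M N x = ennreal (D x)" "\<And>x. 0 \<le> D x"
      using M.real_RN_deriv[OF N(1) ac[OF N12] N(2)] by metis
    have "density M (\<lambda>x. ennreal (D x)) = density M (RN_deriv M N)"
      using D by (intro density_cong) auto
    also have "\<dots> = N" using M.density_RN_deriv[OF ac[OF N12] N(2)] .
    finally show ?thesis using D by metis
  qed
  show thesis using that[OF fM] D[of \<nu>1] D[of \<nu>2] sM s by metis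
qed

lemma has_density_change:
  fixes f :: "real \<Rightarrow> 'a::euclidean_space"
  assumes "has_density E \<mu> (density M (\<lambda>x. ennreal (h x))) f" "finite_measure M"
    and h: "h \<in> borel_measurable M" "\<And>x. 0 \<le> h x"
  shows "has_density E \<mu> M (\<lambda>x. h x *\<^sub>R f x)"
    and "(\<lambda>x. g x *\<^sub>R f x) \<in> borel_measurable M \<Longrightarrow>
      (LINT x|density M (\<lambda>x. ennreal (h x)). g x *\<^sub>R f x) = (LINT x|M. g x *\<^sub>R h x *\<^sub>R f x)"
proof -
  have f: "f \<in> borel_measurable M" "integrable (density M (\<lambda>x. ennreal (h x))) f"
    using assms(1) by (auto simp: has_density_def dest: borel_measurable_integrable)
  have AE: "AE x in M. 0 \<le> h x" using h by simp
  show "has_density E \<mu> M (\<lambda>x. h x *\<^sub>R f x)"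
    unfolding has_density_def
  proof (intro conjI ballI)
    show "integrable M (\<lambda>x. h x *\<^sub>R f x)" using f integrable_density[OF f(1) h(1) AE] by simp
    fix A assume A: "A \<in> sets M"
    have "\<mu> A = (LINT x|density M (\<lambda>x. ennreal (h x)). indicator A x *\<^sub>R f x)"
      using assms(1) A by (simp add: has_density_def set_lebesgue_integral_def)
    also have "\<dots> = (LINT x|M. h x *\<^sub>R indicator A x *\<^sub>R f x)"
      using f A h by (intro integral_density AE) simp_all
    finally show "\<mu> A = (LINT x:A|M. h x *\<^sub>R f x)" by (simp add: set_lebesgue_integral_def mult.commute)
  qed (use assms in \<open>auto simp: has_density_def\<close>)
  assume "(\<lambda>x. g x *\<^sub>R f x) \<in> borel_measurable M"
  then show "(LINT x|density M (\<lambda>x. ennreal (h x)). g x *\<^sub>R f x) = (LINT x|M. g x *\<^sub>R h x *\<^sub>R f x)"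
    using integral_density[of "\<lambda>x. g x *\<^sub>R f x" M h] h AE by (simp add: mult.commute)
qed

text \<open>The two derivatives come with unrelated reference measures, so both densities are first
  transferred to a common one. This is what makes \<open>Omega\<close> BV when \<theta> and \<phi>
  are.\<close>

lemma distr_deriv_add:
  fixes u v :: "real \<Rightarrow> 'a::euclidean_space"
  assumes iu: "set_integrable lborel {0<..<L} u" and iv: "set_integrable lborel {0<..<L} v"
    and "distr_deriv L u \<mu>1" "distr_deriv L v \<mu>2"
  shows "distr_deriv L (\<lambda>s. u s + v s) (\<lambda>A. \<mu>1 A + \<mu>2 A)"
proof -
  obtain \<nu>1 f1 where d1: "has_density {0<..<L} \<mu>1 \<nu>1 f1" and
    t1: "\<And>g g'. (\<forall>x. (g has_real_derivative g' x) (at x)) \<and> continuous_on UNIV g' \<and>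
      (\<exists>a b. 0 < a \<and> b < L \<and> (\<forall>x. x \<notin> {a..b} \<longrightarrow> g x = 0)) \<Longrightarrow>
      (LINT x:{0<..<L}|lborel. g' x *\<^sub>R u x) = - (LINT x|\<nu>1. g x *\<^sub>R f1 x)"
    using assms(3) unfolding distr_deriv_def by blast
  obtain \<nu>2 f2 where d2: "has_density {0<..<L} \<mu>2 \<nu>2 f2" and
    t2: "\<And>g g'. (\<forall>x. (g has_real_derivative g' x) (at x)) \<and> continuous_on UNIV g' \<and>
      (\<exists>a b. 0 < a \<and> b < L \<and> (\<forall>x. x \<notin> {a..b} \<longrightarrow> g x = 0)) \<Longrightarrow>
      (LINT x:{0<..<L}|lborel. g' x *\<^sub>R v x) = - (LINT x|\<nu>2. g x *\<^sub>R f2 x)"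
    using assms(4) unfolding distr_deriv_def by blast
  obtain M h1 h2 where M: "finite_measure M" "sets M = sets (restrict_space borel {0<..<L})"
    and h: "h1 \<in> borel_measurable M" "h2 \<in> borel_measurable M" "\<And>x. 0 \<le> h1 x" "\<And>x. 0 \<le> h2 x"
    and dens: "\<nu>1 = density M (\<lambda>x. ennreal (h1 x))" "\<nu>2 = density M (\<lambda>x. ennreal (h2 x))"
    using common_density[OF d1 d2] by blast
  have D1: "has_density {0<..<L} \<mu>1 M (\<lambda>x. h1 x *\<^sub>R f1 x)"
    using d1 unfolding dens by (rule has_density_change(1)[OF _ M(1) h(1,3)])
  have D2: "has_density {0<..<L} \<mu>2 M (\<lambda>x. h2 x *\<^sub>R f2 x)"
    using d2 unfolding dens by (rule has_density_change(1)[OF _ M(1) h(2,4)])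
  have int: "integrable M (\<lambda>x. h1 x *\<^sub>R f1 x)" "integrable M (\<lambda>x. h2 x *\<^sub>R f2 x)"
    using D1 D2 by (simp_all add: has_density_def)
  have meas: "f1 \<in> borel_measurable M" "f2 \<in> borel_measurable M"
    using d1 d2 by (auto simp: has_density_def dens dest: borel_measurable_integrable)
  show ?thesis
    unfolding distr_deriv_def
  proof (intro exI conjI allI impI)
    show "has_density {0<..<L} (\<lambda>A. \<mu>1 A + \<mu>2 A) M (\<lambda>x. h1 x *\<^sub>R f1 x + h2 x *\<^sub>R f2 x)"
      unfolding has_density_def
    proof (intro conjI ballI)
      fix A assume A: "A \<in> sets M"
      then show "\<mu>1 A + \<mu>2 A = (LINT x:A|M. h1 x *\<^sub>R f1 x + h2 x *\<^sub>R f2 x)"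
        using D1 D2 integrable_mult_indicator[OF A int(1)] integrable_mult_indicator[OF A int(2)]
        by (subst set_integral_add) (auto simp: has_density_def set_integrable_def)
    qed (use M int in auto)
    fix g g' :: "real \<Rightarrow> real" assume *: "(\<forall>x. (g has_real_derivative g' x) (at x)) \<and> continuous_on UNIV g' \<and>
      (\<exists>a b. 0 < a \<and> b < L \<and> (\<forall>x. x \<notin> {a..b} \<longrightarrow> g x = 0))"
    then obtain a b where ab: "\<And>x. x \<notin> {a..b} \<Longrightarrow> g x = 0" by blast
    obtain C where C: "g \<in> borel_measurable borel" "\<And>x. \<bar>g x\<bar> \<le> C"
      by (rule test_function_bounded[of g g' a b]) (use * ab in auto)
    have gM: "g \<in> borel_measurable M" by (rule has_density_measurable[OF D1 C(1)])
    have i: "integrable M (\<lambda>x. g x *\<^sub>R h1 x *\<^sub>R f1 x)" "integrable M (\<lambda>x. g x *\<^sub>R h2 x *\<^sub>R f2 x)"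
      by (intro integrable_scaleR_bounded[OF gM C(2)] int)+
    have "(LINT x:{0<..<L}|lborel. g' x *\<^sub>R (u x + v x))
      = (LINT x:{0<..<L}|lborel. g' x *\<^sub>R u x) + (LINT x:{0<..<L}|lborel. g' x *\<^sub>R v x)"
      unfolding scaleR_add_right
      using * by (intro set_integral_add set_integrable_scaleR_continuous iu iv) auto
    also have "\<dots> = - (LINT x|\<nu>1. g x *\<^sub>R f1 x) + - (LINT x|\<nu>2. g x *\<^sub>R f2 x)"
      unfolding t1[OF *] t2[OF *] ..
    also have "(LINT x|\<nu>1. g x *\<^sub>R f1 x) = (LINT x|M. g x *\<^sub>R h1 x *\<^sub>R f1 x)"
      using d1 gM meas unfolding dens by (intro has_density_change(2)[OF _ M(1) h(1,3)]) auto
    also have "(LINT x|\<nu>2. g x *\<^sub>R f2 x) = (LINT x|M. g x *\<^sub>R h2 x *\<^sub>R f2 x)"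
      using d2 gM meas unfolding dens by (intro has_density_change(2)[OF _ M(1) h(2,4)]) auto
    finally show "(LINT x:{0<..<L}|lborel. g' x *\<^sub>R (u x + v x))
      = - (LINT x|M. g x *\<^sub>R (h1 x *\<^sub>R f1 x + h2 x *\<^sub>R f2 x))"
      unfolding scaleR_add_right using Bochner_Integration.integral_add[OF i] by simp
  qed
qed

lemma BV_add:
  fixes u v :: "real \<Rightarrow> 'a::euclidean_space"
  assumes u: "BV L u" and v: "BV L v"
  shows "BV L (\<lambda>s. u s + v s)"
  unfolding BV_def
proof (intro conjI ballI)
  have i: "set_integrable lborel {0<..<L} u" "set_integrable lborel {0<..<L} v"
    using u v by (simp_all add: BV_def)
  then show "set_integrable lborel {0<..<L} (\<lambda>s. u s + v s)" by (rule set_integral_add(1))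
  show "\<exists>\<mu>. distr_deriv L (\<lambda>s. u s + v s) \<mu>"
    using distr_deriv_add[OF i BV_distr_deriv[OF u] BV_distr_deriv[OF v]] by blast
  show "\<exists>l. ((\<lambda>s. u s + v s) \<longlongrightarrow> l) (at_left s)" if "s \<in> {0<..L}" for s
    using tendsto_add[OF BV_tendsto_left[OF u that] BV_tendsto_left[OF v that]] by blast
  show "\<exists>l. ((\<lambda>s. u s + v s) \<longlongrightarrow> l) (at_right s)" if "s \<in> {0..<L}" for s
    using tendsto_add[OF BV_tendsto_right[OF u that] BV_tendsto_right[OF v that]] by blast
qed

section \<open>Increments of functions of bounded variation\<close>

text \<open>A C1 step from 0 to 1: its derivative is the tent function with vertices 0, 1/2 and 1.\<close>

definition step_fun :: "real \<Rightarrow> real" where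
  "step_fun z = 2 * (max 0 z)\<^sup>2 - 4 * (max 0 (z - 1/2))\<^sup>2 + 2 * (max 0 (z - 1))\<^sup>2"

definition tent_fun :: "real \<Rightarrow> real" where
  "tent_fun z = 4 * max 0 z - 8 * max 0 (z - 1/2) + 4 * max 0 (z - 1)"

lemma step_fun_eq: "z \<le> 0 \<Longrightarrow> step_fun z = 0" "1 \<le> z \<Longrightarrow> step_fun z = 1"
  by (auto simp: step_fun_def max_def power2_eq_square algebra_simps)

lemma tent_fun_eq: "z \<le> 0 \<Longrightarrow> tent_fun z = 0" "1 \<le> z \<Longrightarrow> tent_fun z = 0"
  by (auto simp: tent_fun_def max_def)

lemma tent_fun_nonneg: "0 \<le> tent_fun z"
  by (auto simp: tent_fun_def max_def)

lemma step_fun_bounds: "0 \<le> step_fun z" "step_fun z \<le> 1"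
proof -
  consider "z \<le> 0" | "0 \<le> z" "z \<le> 1/2" | "1/2 \<le> z" "z \<le> 1" | "1 \<le> z" by linarith
  then have "0 \<le> step_fun z \<and> step_fun z \<le> 1"
  proof cases
    case 2
    then have "z\<^sup>2 \<le> (1/2)\<^sup>2" by (intro power_mono) auto
    moreover have "max 0 z = z" "max 0 (z - 1/2) = 0" "max 0 (z - 1) = 0" using 2 by auto
    ultimately show ?thesis by (simp add: step_fun_def power2_eq_square)
  next
    case 3
    then have "(1 - z)\<^sup>2 \<le> (1/2)\<^sup>2" by (intro power_mono) auto
    moreover have "step_fun z = 1 - 2 * (1 - z)\<^sup>2"
      using 3 by (simp add: step_fun_def max_def power2_eq_square algebra_simps)
    ultimately show ?thesis by (simp add: power2_eq_square)
  qed (auto simp: step_fun_eq)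
  then show "0 \<le> step_fun z" "step_fun z \<le> 1" by auto
qed

lemma DERIV_max_sq: "((\<lambda>z::real. (max 0 z)\<^sup>2) has_real_derivative 2 * max 0 z) (at z)"
proof -
  consider "z < 0" | "z = 0" | "z > 0" by linarith
  then show ?thesis
  proof cases
    case 1
    have "((\<lambda>z::real. 0) has_real_derivative 2 * max 0 z) (at z)" using 1 by simp
    then show ?thesis
      by (rule has_field_derivative_transform_within_open[where S = "{..<0}"]) (use 1 in \<open>auto simp: max_def\<close>)
  next
    case 3
    have "((\<lambda>z::real. z\<^sup>2) has_real_derivative 2 * max 0 z) (at z)"
      using 3 by (auto intro!: derivative_eq_intros)
    then show ?thesis
      by (rule has_field_derivative_transform_within_open[where S = "{0<..}"]) (use 3 in \<open>auto simp: max_def\<close>)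
  next
    case 2
    have "((\<lambda>h::real. (max 0 h)\<^sup>2 / h) \<longlongrightarrow> 0) (at 0)"
    proof (rule Lim_null_comparison)
      show "\<forall>\<^sub>F h::real in at 0. norm ((max 0 h)\<^sup>2 / h) \<le> \<bar>h\<bar>"
        by (rule always_eventually) (auto simp: max_def power2_eq_square)
      show "((\<lambda>h::real. \<bar>h\<bar>) \<longlongrightarrow> 0) (at 0)" by (rule tendsto_eq_intros refl | simp)+
    qed
    then show ?thesis using 2 by (simp add: DERIV_def)
  qed
qed

lemma DERIV_step_fun: "(step_fun has_real_derivative tent_fun z) (at z)"
proof -
  have shift: "((\<lambda>z. (max 0 (z - k))\<^sup>2) has_real_derivative 2 * max 0 (z - k)) (at z)" for k :: real
    using DERIV_chain2[where f = "\<lambda>z. (max 0 z)\<^sup>2" and g = "\<lambda>z. z - k" and Db = 1, OF DERIV_max_sq]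
      DERIV_diff[OF DERIV_ident DERIV_const, of k z] by simp
  show ?thesis
    unfolding step_fun_def tent_fun_def
    by (rule derivative_eq_intros shift shift[of 0, simplified] refl | simp)+
qed

lemma continuous_tent_fun: "continuous_on A (\<lambda>x. tent_fun (f x))" if "continuous_on A f"
  unfolding tent_fun_def using that by (intro continuous_intros)

lemma DERIV_step_fun_scaled:
  "((\<lambda>s. step_fun (n * (s - p))) has_real_derivative n * tent_fun (n * (s - p))) (at s)"
proof -
  have "((\<lambda>s. step_fun (n * (s - p))) has_real_derivative tent_fun (n * (s - p)) * n) (at s)"
    by (rule DERIV_chain2[OF DERIV_step_fun]) (auto intro!: derivative_eq_intros)
  then show ?thesis by (simp add: mult.commute)
qed

text \<open>The scaled tent is a probability density, its integral being the increment of the step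
  from 0 to 1; averaging against it stays within the oscillation of u.\<close>

lemma tent_average:
  fixes u :: "real \<Rightarrow> 'a::euclidean_space"
  assumes u: "set_integrable lborel {0<..<L} u" and n: "0 < n" and J: "{p..p + 1/n} \<subseteq> {0<..<L}"
    and e: "\<And>z. z \<in> {p..p + 1/n} \<Longrightarrow> norm (u z - l) \<le> \<epsilon>"
  shows "norm ((LINT s:{0<..<L}|lborel. (n * tent_fun (n * (s - p))) *\<^sub>R u s) - l) \<le> \<epsilon>"
proof -
  define \<rho> where "\<rho> s = n * tent_fun (n * (s - p))" for s
  have cont: "continuous_on A \<rho>" for A
    unfolding \<rho>_def by (intro continuous_intros continuous_tent_fun)
  have rho0: "\<rho> s = 0" if "s \<notin> {p..p + 1/n}" for s
    using that n tent_fun_eq[of "n * (s - p)"] by (auto simp: \<rho>_def field_simps mult_le_0_iff)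
  have rho_nonneg: "0 \<le> \<rho> s" for s using n by (simp add: \<rho>_def tent_fun_nonneg)
  have hb: "has_bochner_integral lborel (\<lambda>s. indicator {p..p + 1/n} s *\<^sub>R \<rho> s)
      (step_fun (n * (p + 1/n - p)) - step_fun (n * (p - p)))"
  proof (rule has_bochner_integral_FTC_Icc)
    show "p \<le> p + 1/n" using n by simp
    show "((\<lambda>s. step_fun (n * (s - p))) has_vector_derivative \<rho> x) (at x within {p..p + 1/n})" for x
      using DERIV_step_fun_scaled[of n p x] unfolding \<rho>_def
      by (simp add: has_real_derivative_iff_has_vector_derivative has_vector_derivative_at_within)
  qed (rule cont)
  have "(\<lambda>s. indicator {p..p + 1/n} s *\<^sub>R \<rho> s) = \<rho>"
  proof
    fix s show "indicator {p..p + 1/n} s *\<^sub>R \<rho> s = \<rho> s" using rho0[of s] by (auto simp: indicator_def)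
  qed
  from hb[unfolded this] have hb1: "has_bochner_integral lborel \<rho> 1" using n by (simp add: step_fun_eq)
  then have irho: "integrable lborel \<rho>" and vrho: "integral\<^sup>L lborel \<rho> = 1"
    by (auto simp: has_bochner_integral_iff)
  have "set_integrable lborel {0<..<L} (\<lambda>s. \<rho> s *\<^sub>R u s)"
    by (rule set_integrable_scaleR_continuous[OF cont u])
  then have i1: "integrable lborel (\<lambda>s. indicator {0<..<L} s *\<^sub>R \<rho> s *\<^sub>R u s)" by (simp add: set_integrable_def)
  have i2: "integrable lborel (\<lambda>s. \<rho> s *\<^sub>R l)" using irho by simp
  have i3: "integrable lborel (\<lambda>s. \<epsilon> * \<rho> s)" using irho by simp
  have "(LINT s:{0<..<L}|lborel. \<rho> s *\<^sub>R u s) - l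
    = (LINT s|lborel. indicator {0<..<L} s *\<^sub>R \<rho> s *\<^sub>R u s) - (LINT s|lborel. \<rho> s *\<^sub>R l)"
    using vrho irho by (simp add: set_lebesgue_integral_def)
  also have "\<dots> = (LINT s|lborel. indicator {0<..<L} s *\<^sub>R \<rho> s *\<^sub>R u s - \<rho> s *\<^sub>R l)"
    using i1 i2 by simp
  also have "norm \<dots> \<le> (LINT s|lborel. \<epsilon> * \<rho> s)"
  proof (rule order.trans[OF integral_norm_bound integral_mono])
    fix s
    show "norm (indicator {0<..<L} s *\<^sub>R \<rho> s *\<^sub>R u s - \<rho> s *\<^sub>R l) \<le> \<epsilon> * \<rho> s"
    proof (cases "s \<in> {p..p + 1/n}")
      case True
      then have "indicator {0<..<L} s *\<^sub>R \<rho> s *\<^sub>R u s - \<rho> s *\<^sub>R l = \<rho> s *\<^sub>R (u s - l)"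
        using J by (auto simp: indicator_def scaleR_diff_right)
      then show ?thesis using e[OF True] rho_nonneg[of s] by (simp add: mult_left_mono mult.commute[of \<epsilon>])
    qed (simp add: rho0)
  qed (use i1 i2 i3 in \<open>auto intro!: integrable_norm\<close>)
  also have "\<dots> = \<epsilon>" using vrho by simp
  finally show ?thesis by (simp add: \<rho>_def)
qed

lemma step_fun_scaled: "0 < n \<Longrightarrow> z \<le> 0 \<Longrightarrow> step_fun (n * z) = 0" "0 < n \<Longrightarrow> 1 / n \<le> z \<Longrightarrow> step_fun (n * z) = 1"
  by (rule step_fun_eq, simp add: mult_nonneg_nonpos) (rule step_fun_eq, simp add: divide_le_eq mult.commute)

lemma eventually_div_Suc_less: "0 < d \<Longrightarrow> eventually (\<lambda>k. c / real (Suc k) < d) sequentially"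
proof -
  assume "0 < d"
  have "(\<lambda>k. c * inverse (real (Suc k))) \<longlonglongrightarrow> c * 0"
    by (intro tendsto_mult tendsto_const LIMSEQ_inverse_real_of_nat)
  then have "(\<lambda>k. c / real (Suc k)) \<longlonglongrightarrow> 0" by (simp add: divide_inverse)
  then show ?thesis using \<open>0 < d\<close> by (rule order_tendstoD)
qed

text \<open>The averaging interval from x + 1/n to x + 2/n keeps away from x, because this closed
  interval has to lie in the open domain even for x = 0.\<close>

lemma tent_average_right:
  fixes u :: "real \<Rightarrow> 'a::euclidean_space"
  assumes u: "set_integrable lborel {0<..<L} u" and x: "0 \<le> x" "x < L" and l: "(u \<longlongrightarrow> l) (at_right x)"
  shows "(\<lambda>k. LINT s:{0<..<L}|lborel. (real (Suc k) * tent_fun (real (Suc k) * (s - (x + 1 / real (Suc k))))) *\<^sub>R u s)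
    \<longlonglongrightarrow> l"
proof (rule tendstoI)
  fix \<epsilon> :: real assume e: "0 < \<epsilon>"
  have "eventually (\<lambda>z. dist (u z) l < \<epsilon> / 2) (at_right x)" using e by (intro tendstoD[OF l]) simp
  then obtain d where d: "x < d" "\<And>z. x < z \<Longrightarrow> z < d \<Longrightarrow> dist (u z) l < \<epsilon> / 2"
    unfolding eventually_at_right_field by blast
  have "eventually (\<lambda>k. 2 / real (Suc k) < min d L - x) sequentially"
    by (rule eventually_div_Suc_less) (use d x in simp)
  then show "eventually (\<lambda>k. dist (LINT s:{0<..<L}|lborel.
      (real (Suc k) * tent_fun (real (Suc k) * (s - (x + 1 / real (Suc k))))) *\<^sub>R u s) l < \<epsilon>) sequentially"
  proof eventually_elim
    case (elim k)
    define n where "n = real (Suc k)"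
    have n: "0 < n" "2 / n < min d L - x" using elim by (simp_all add: n_def)
    define m where "m = 1 / n"
    have m: "1 / n = m" "2 / n = 2 * m" "0 < m" using n by (simp_all add: m_def)
    have two: "x + 1 / n + 1 / n = x + 2 / n" by simp
    have "norm ((LINT s:{0<..<L}|lborel. (n * tent_fun (n * (s - (x + 1/n)))) *\<^sub>R u s) - l) \<le> \<epsilon> / 2"
    proof (rule tent_average[OF u n(1)])
      show "{x + 1/n..x + 1/n + 1/n} \<subseteq> {0<..<L}" using n x m(3) unfolding two m(1,2) by auto
      fix z assume "z \<in> {x + 1/n..x + 1/n + 1/n}"
      then have "x < z" "z < d" using n(2) m(3) unfolding two m(1,2) by auto
      from d(2)[OF this] show "norm (u z - l) \<le> \<epsilon> / 2" by (simp add: dist_norm)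
    qed
    then show ?case using e unfolding n_def by (simp add: dist_norm del: of_nat_Suc)
  qed
qed

lemma tent_average_left:
  fixes u :: "real \<Rightarrow> 'a::euclidean_space"
  assumes u: "set_integrable lborel {0<..<L} u" and x: "0 < x" "x \<le> L" and l: "(u \<longlongrightarrow> l) (at_left x)"
  shows "(\<lambda>k. LINT s:{0<..<L}|lborel. (real (Suc k) * tent_fun (real (Suc k) * (s - (x - 2 / real (Suc k))))) *\<^sub>R u s)
    \<longlonglongrightarrow> l"
proof (rule tendstoI)
  fix \<epsilon> :: real assume e: "0 < \<epsilon>"
  have "eventually (\<lambda>z. dist (u z) l < \<epsilon> / 2) (at_left x)" using e by (intro tendstoD[OF l]) simp
  then obtain d where d: "d < x" "\<And>z. d < z \<Longrightarrow> z < x \<Longrightarrow> dist (u z) l < \<epsilon> / 2"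
    unfolding eventually_at_left_field by blast
  have "eventually (\<lambda>k. 2 / real (Suc k) < x - max d 0) sequentially"
    by (rule eventually_div_Suc_less) (use d x in simp)
  then show "eventually (\<lambda>k. dist (LINT s:{0<..<L}|lborel.
      (real (Suc k) * tent_fun (real (Suc k) * (s - (x - 2 / real (Suc k))))) *\<^sub>R u s) l < \<epsilon>) sequentially"
  proof eventually_elim
    case (elim k)
    define n where "n = real (Suc k)"
    have n: "0 < n" "2 / n < x - max d 0" using elim by (simp_all add: n_def)
    define m where "m = 1 / n"
    have m: "1 / n = m" "2 / n = 2 * m" "0 < m" using n by (simp_all add: m_def)
    have two: "x - 2 / n + 1 / n = x - 1 / n" by simp
    have "norm ((LINT s:{0<..<L}|lborel. (n * tent_fun (n * (s - (x - 2/n)))) *\<^sub>R u s) - l) \<le> \<epsilon> / 2"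
    proof (rule tent_average[OF u n(1)])
      show "{x - 2/n..x - 2/n + 1/n} \<subseteq> {0<..<L}" using n x m(3) unfolding two m(1,2) by auto
      fix z assume "z \<in> {x - 2/n..x - 2/n + 1/n}"
      then have "d < z" "z < x" using n(2) m(3) unfolding two m(1,2) by auto
      from d(2)[OF this] show "norm (u z - l) \<le> \<epsilon> / 2" by (simp add: dist_norm)
    qed
    then show ?case using e unfolding n_def by (simp add: dist_norm del: of_nat_Suc)
  qed
qed

text \<open>The test function rises just to the right of x and falls just to the left of y. Its
  derivative is a difference of two tents, whose averages of u tend to the one-sided limits; the
  function itself tends boundedly to the indicator of the open interval, so that the other side
  tends to the measure of that interval.\<close>

lemma distr_deriv_interval:
  fixes u :: "real \<Rightarrow> 'a::euclidean_space"
  assumes BV: "BV L u" and "distr_deriv L u \<mu>" and xy: "0 \<le> x" "x < y" "y \<le> L"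
  shows "\<mu> {x<..<y} = lim_left u y - lim_right u x"
proof -
  have u: "set_integrable lborel {0<..<L} u" using BV by (simp add: BV_def)
  obtain \<nu> f where d: "has_density {0<..<L} \<mu> \<nu> f" and
    test: "\<And>g g'. (\<forall>x. (g has_real_derivative g' x) (at x)) \<and> continuous_on UNIV g' \<and>
      (\<exists>a b. 0 < a \<and> b < L \<and> (\<forall>x. x \<notin> {a..b} \<longrightarrow> g x = 0)) \<Longrightarrow>
      (LINT x:{0<..<L}|lborel. g' x *\<^sub>R u x) = - (LINT x|\<nu>. g x *\<^sub>R f x)"
    using assms(2) unfolding distr_deriv_def by blast
  have f: "integrable \<nu> f" using d by (simp add: has_density_def)
  let ?n = "\<lambda>k. real (Suc k)"
  define g where "g k s = step_fun (?n k * (s - (x + 1 / ?n k))) - step_fun (?n k * (s - (y - 2 / ?n k)))" for k s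
  define A where "A k = (LINT s:{0<..<L}|lborel. (?n k * tent_fun (?n k * (s - (x + 1 / ?n k)))) *\<^sub>R u s)" for k
  define B where "B k = (LINT s:{0<..<L}|lborel. (?n k * tent_fun (?n k * (s - (y - 2 / ?n k)))) *\<^sub>R u s)" for k
  have "A \<longlonglongrightarrow> lim_right u x"
    unfolding A_def using BV_tendsto_right[OF BV] xy by (intro tent_average_right u) auto
  moreover have "B \<longlonglongrightarrow> lim_left u y"
    unfolding B_def using BV_tendsto_left[OF BV] xy by (intro tent_average_left u) auto
  ultimately have lim1: "(\<lambda>k. B k - A k) \<longlonglongrightarrow> lim_left u y - lim_right u x" by (intro tendsto_diff)
  have eq: "eventually (\<lambda>k. B k - A k = (LINT s|\<nu>. g k s *\<^sub>R f s)) sequentially"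
  proof -
    \<comment> \<open>Enough to make both steps vanish left of x + 1/n and equal 1 right of y - 1/n;
      rise and fall may still overlap.\<close>
    have "eventually (\<lambda>k. 3 / real (Suc k) < y - x) sequentially"
      by (rule eventually_div_Suc_less) (use xy in simp)
    then show ?thesis
  proof eventually_elim
    case (elim k)
    define n where "n = real (Suc k)"
    have n: "0 < n" "3 / n < y - x" using elim by (simp_all add: n_def)
    define m where "m = 1 / n"
    have m: "1 / n = m" "2 / n = 2 * m" "3 / n = 3 * m" "0 < m" using n by (simp_all add: m_def)
    let ?g' = "\<lambda>s. n * tent_fun (n * (s - (x + 1 / n))) - n * tent_fun (n * (s - (y - 2 / n)))"
    have cont: "continuous_on UNIV (\<lambda>s. n * tent_fun (n * (s - p)))" for p
      by (intro continuous_intros continuous_tent_fun)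
    have "(LINT s:{0<..<L}|lborel. ?g' s *\<^sub>R u s) = - (LINT s|\<nu>. g k s *\<^sub>R f s)"
    proof (rule test, intro conjI allI)
      show "(g k has_real_derivative ?g' s) (at s)" for s
        unfolding g_def n_def[symmetric] by (intro DERIV_diff DERIV_step_fun_scaled)
      show "continuous_on UNIV ?g'" by (intro continuous_on_diff cont)
      show "\<exists>a b. 0 < a \<and> b < L \<and> (\<forall>s. s \<notin> {a..b} \<longrightarrow> g k s = 0)"
      proof (intro exI conjI allI impI)
        show "0 < x + 1 / n" "y - 1 / n < L" using m(4) xy unfolding m by auto
        fix s assume "s \<notin> {x + 1 / n..y - 1 / n}"
        then consider "s < x + 1 / n" | "y - 1 / n < s" by force
        then show "g k s = 0"
        proof cases
          case 1
          then have "s - (x + 1 / n) \<le> 0" "s - (y - 2 / n) \<le> 0" using n(2) m(4) unfolding m by auto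
          then show ?thesis unfolding g_def n_def[symmetric] using step_fun_scaled(1)[OF n(1)] by simp
        next
          case 2
          then have "1 / n \<le> s - (x + 1 / n)" "1 / n \<le> s - (y - 2 / n)" using n(2) m(4) unfolding m by auto
          then show ?thesis unfolding g_def n_def[symmetric] using step_fun_scaled(2)[OF n(1)] by simp
        qed
      qed
    qed
    moreover have "(LINT s:{0<..<L}|lborel. ?g' s *\<^sub>R u s) = A k - B k"
      unfolding A_def B_def n_def[symmetric] scaleR_diff_left
      by (intro set_integral_diff set_integrable_scaleR_continuous cont u)
    ultimately show "B k - A k = (LINT s|\<nu>. g k s *\<^sub>R f s)" by (simp add: algebra_simps)
  qed
  qed
  have lim2: "(\<lambda>k. LINT s|\<nu>. g k s *\<^sub>R f s) \<longlonglongrightarrow> (LINT s|\<nu>. indicator {x<..<y} s *\<^sub>R f s)"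
  proof (rule integral_dominated_convergence[where w = "\<lambda>s. norm (f s)"])
    have gb: "g k \<in> borel_measurable borel" for k
    proof -
      have "continuous_on UNIV (g k)"
        unfolding g_def by (intro continuous_at_imp_continuous_on ballI isCont_diff DERIV_isCont[OF DERIV_step_fun_scaled])
      then show ?thesis by (rule borel_measurable_continuous_onI)
    qed
    then show "(\<lambda>s. g k s *\<^sub>R f s) \<in> borel_measurable \<nu>" for k
      using has_density_measurable[OF d] f by (intro borel_measurable_scaleR) auto
    have xyb: "{x<..<y} \<in> sets \<nu>" using xy by (intro has_density_sets[OF d]) auto
    show "(\<lambda>s. indicator {x<..<y} s *\<^sub>R f s) \<in> borel_measurable \<nu>"
      using xyb f by (intro borel_measurable_scaleR borel_measurable_indicator) auto
    show "AE s in \<nu>. (\<lambda>k. g k s *\<^sub>R f s) \<longlonglongrightarrow> indicator {x<..<y} s *\<^sub>R f s"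
    proof (rule AE_I2)
      fix s
      \<comment> \<open>Inside the interval n has to be large compared with the distance of s to the
        end points, outside only compared with y - x.\<close>
      define r where "r = (if x < s \<and> s < y then min (s - x) (y - s) else y - x)"
      have "eventually (\<lambda>k. 3 / real (Suc k) < r) sequentially"
        by (rule eventually_div_Suc_less) (use xy in \<open>auto simp: r_def\<close>)
      then have "eventually (\<lambda>k. g k s = indicator {x<..<y} s) sequentially"
      proof eventually_elim
        case (elim k)
        define n where "n = real (Suc k)"
        have n: "0 < n" "3 / n < r" using elim by (simp_all add: n_def)
        define m where "m = 1 / n"
    have m: "1 / n = m" "2 / n = 2 * m" "3 / n = 3 * m" "0 < m" using n by (simp_all add: m_def)
        note st = step_fun_scaled[OF n(1)]
        consider "x < s" "s < y" | "s \<le> x" | "y \<le> s" "x < s" using xy by linarith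
        then show ?case
        proof cases
          case 1
          then have "1 / n \<le> s - (x + 1 / n)" "s - (y - 2 / n) \<le> 0" using n(2) m(4) xy unfolding m by (auto simp: r_def)
          then show ?thesis unfolding g_def n_def[symmetric] using st 1 by simp
        next
          case 2
          then have "s - (x + 1 / n) \<le> 0" "s - (y - 2 / n) \<le> 0" using n(2) m(4) xy unfolding m by (auto simp: r_def)
          then show ?thesis unfolding g_def n_def[symmetric] using st 2 by simp
        next
          case 3
          then have "1 / n \<le> s - (x + 1 / n)" "1 / n \<le> s - (y - 2 / n)" using n(2) m(4) xy unfolding m by (auto simp: r_def)
          then show ?thesis unfolding g_def n_def[symmetric] using st 3 by simp
        qed
      qed
      then have "eventually (\<lambda>k. g k s *\<^sub>R f s = indicator {x<..<y} s *\<^sub>R f s) sequentially"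
        by eventually_elim simp
      then show "(\<lambda>k. g k s *\<^sub>R f s) \<longlonglongrightarrow> indicator {x<..<y} s *\<^sub>R f s" by (rule tendsto_eventually)
    qed
    show "AE s in \<nu>. norm (g k s *\<^sub>R f s) \<le> norm (f s)" for k
    proof (rule AE_I2)
      fix s
      have "\<bar>g k s\<bar> \<le> 1"
        using step_fun_bounds[of "?n k * (s - (x + 1 / ?n k))"] step_fun_bounds[of "?n k * (s - (y - 2 / ?n k))"]
        unfolding g_def by linarith
      then show "norm (g k s *\<^sub>R f s) \<le> norm (f s)" by (simp add: mult_left_le_one_le)
    qed
  qed (use f in simp)
  have "{x<..<y} \<in> sets \<nu>" using xy by (intro has_density_sets[OF d]) auto
  then have "\<mu> {x<..<y} = (LINT s|\<nu>. indicator {x<..<y} s *\<^sub>R f s)"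
    using d unfolding has_density_def set_lebesgue_integral_def by blast
  also have "\<dots> = lim_left u y - lim_right u x"
    using LIMSEQ_unique[OF lim2 Lim_transform_eventually[OF lim1 eq]] .
  finally show ?thesis .
qed

section \<open>Total variation, cumulative variation and uniform oscillation\<close>

lemma total_variation_ge:
  fixes \<mu> :: "real set \<Rightarrow> 'a::euclidean_space" and A :: "nat \<Rightarrow> real set"
  assumes A: "\<And>i. i < N \<Longrightarrow> A i \<in> sets borel" "\<And>i. i < N \<Longrightarrow> A i \<subseteq> {0<..<L}"
    and dis: "disjoint_family_on A {..<N}"
  shows "ennreal (\<Sum>i<N. norm (\<mu> (A i))) \<le> total_variation L \<mu>"
proof -
  \<comment> \<open>The definition admits only partitions of the whole interval, so the remainder
    becomes an additional piece at index N.\<close>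
  define B where "B i = (if i < N then A i else if i = N then {0<..<L} - (\<Union>j<N. A j) else {})" for i
  have "ennreal (\<Sum>i<N. norm (\<mu> (A i))) = (\<Sum>i<N. ennreal (norm (\<mu> (B i))))"
    by (simp add: B_def sum_ennreal)
  also have "\<dots> \<le> (\<Sum>i. ennreal (norm (\<mu> (B i))))" by (rule sum_le_suminf) auto
  also have "\<dots> \<le> total_variation L \<mu>"
    unfolding total_variation_def
  proof (rule SUP_upper, intro CollectI conjI)
    show "range B \<subseteq> sets borel" using A(1) by (auto simp: B_def)
    show "disjoint_family B"
      using dis by (auto simp: disjoint_family_on_def B_def)
    show "(\<Union>i. B i) = {0<..<L}"
    proof
      show "(\<Union>i. B i) \<subseteq> {0<..<L}" using A(2) by (force simp: B_def split: if_splits)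
      show "{0<..<L} \<subseteq> (\<Union>i. B i)"
      proof
        fix s assume s: "s \<in> {0<..<L}"
        show "s \<in> (\<Union>i. B i)"
        proof (cases "\<exists>j<N. s \<in> A j")
          case True
          then obtain j where "j < N" "s \<in> A j" by blast
          then have "s \<in> B j" by (simp add: B_def)
          then show ?thesis by blast
        next
          case False
          then have "s \<in> B N" using s by (simp add: B_def)
          then show ?thesis by blast
        qed
      qed
    qed
  qed
  finally show ?thesis .
qed

text \<open>K is the cumulative variation of \<mu> on E. Its increment integrates over a half-open
  interval and so majorises the integral over the open one, even if there is mass at y.\<close>

lemma density_cumulative:
  assumes d: "has_density E \<mu> \<nu> f"
  obtains K :: "real \<Rightarrow> real" where "mono K"
    "\<And>x y (g :: real \<Rightarrow> 'b::euclidean_space) B. x < y \<Longrightarrow> {x<..<y} \<subseteq> E \<Longrightarrow> integrable \<nu> g \<Longrightarrow> 0 \<le> B \<Longrightarrow>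
      (\<And>z. z \<in> {x<..<y} \<Longrightarrow> norm (g z) \<le> B * norm (f z)) \<Longrightarrow>
      norm (LINT z:{x<..<y}|\<nu>. g z) \<le> B * (K y - K x)"
proof -
  have f: "integrable \<nu> (\<lambda>z. norm (f z))" using d by (simp add: has_density_def)
  have sets: "E \<inter> A \<in> sets \<nu>" if "A \<in> sets borel" for A
    using d that by (auto simp: has_density_def sets_restrict_space)
  have int: "integrable \<nu> (\<lambda>z. indicator (E \<inter> A) z *\<^sub>R norm (f z))" if "A \<in> sets borel" for A
    by (rule integrable_mult_indicator[OF sets[OF that] f])
  define K where "K s = (LINT z|\<nu>. indicator (E \<inter> {..s}) z *\<^sub>R norm (f z))" for s
  show thesis
  proof (rule that[of K])
    show "mono K"
    proof (rule monoI)
      fix x y :: real assume "x \<le> y"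
      then show "K x \<le> K y"
        unfolding K_def by (intro integral_mono int) (auto simp: indicator_def)
    qed
    fix x y :: real and g :: "real \<Rightarrow> 'b" and B
    assume xy: "x < y" and sub: "{x<..<y} \<subseteq> E" and g: "integrable \<nu> g" and B: "0 \<le> B"
      and le: "\<And>z. z \<in> {x<..<y} \<Longrightarrow> norm (g z) \<le> B * norm (f z)"
    have sxy: "{x<..<y} \<in> sets \<nu>" using sets[of "{x<..<y}"] sub by (simp add: Int_absorb1)
    have ig: "integrable \<nu> (\<lambda>z. indicator {x<..<y} z *\<^sub>R g z)" by (rule integrable_mult_indicator[OF sxy g])
    have "norm (LINT z:{x<..<y}|\<nu>. g z) \<le> (LINT z|\<nu>. norm (indicator {x<..<y} z *\<^sub>R g z))"
      unfolding set_lebesgue_integral_def by (rule integral_norm_bound)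
    also have "\<dots> \<le> (LINT z|\<nu>. B * (indicator (E \<inter> {..y}) z *\<^sub>R norm (f z) - indicator (E \<inter> {..x}) z *\<^sub>R norm (f z)))"
    proof (rule integral_mono)
      show "integrable \<nu> (\<lambda>z. norm (indicator {x<..<y} z *\<^sub>R g z))" using ig by (rule integrable_norm)
      show "integrable \<nu> (\<lambda>z. B * (indicator (E \<inter> {..y}) z *\<^sub>R norm (f z) - indicator (E \<inter> {..x}) z *\<^sub>R norm (f z)))"
        by (intro integrable_mult_right Bochner_Integration.integrable_diff int) auto
      fix z
      show "norm (indicator {x<..<y} z *\<^sub>R g z)
        \<le> B * (indicator (E \<inter> {..y}) z *\<^sub>R norm (f z) - indicator (E \<inter> {..x}) z *\<^sub>R norm (f z))"
      proof (cases "z \<in> {x<..<y}")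
        case True
        then have "z \<in> E" using sub by blast
        then show ?thesis using True le[OF True] by simp
      next
        case False
        then show ?thesis using B xy by (auto simp: indicator_def)
      qed
    qed
    also have "\<dots> = B * (K y - K x)"
      unfolding K_def using int[of "{..y}"] int[of "{..x}"] by simp
    finally show "norm (LINT z:{x<..<y}|\<nu>. g z) \<le> B * (K y - K x)" .
  qed
qed

text \<open>The inequality is additive over adjacent intervals, so equal steps shorter than d can be
  chained.\<close>

lemma local_to_global:
  fixes F :: "real \<Rightarrow> 'a::real_normed_vector" and g :: "real \<Rightarrow> real"
  assumes "0 < d" "a \<le> b"
    and loc: "\<And>p q. a \<le> p \<Longrightarrow> p \<le> q \<Longrightarrow> q \<le> b \<Longrightarrow> q - p < d \<Longrightarrow> norm (F q - F p) \<le> g q - g p"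
  shows "norm (F b - F a) \<le> g b - g a"
proof -
  obtain M :: nat where M: "(b - a) / d < real M" using reals_Archimedean2 by blast
  have "0 \<le> (b - a) / d" using assms by simp
  then have M0: "0 < real M" using M by linarith
  define h where "h = (b - a) / M"
  have h: "0 \<le> h" "h < d" "a + real M * h = b"
    using assms M M0 by (auto simp: h_def field_simps)
  have "i \<le> M \<Longrightarrow> norm (F (a + real i * h) - F a) \<le> g (a + real i * h) - g a" for i
  proof (induction i)
    case (Suc i)
    have "real (Suc i) * h \<le> real M * h" using Suc.prems h by (intro mult_right_mono) auto
    then have "norm (F (a + real (Suc i) * h) - F (a + real i * h)) \<le> g (a + real (Suc i) * h) - g (a + real i * h)"
      using h by (intro loc) (auto simp: algebra_simps)
    then show ?case
      using norm_triangle_ineq[of "F (a + real (Suc i) * h) - F (a + real i * h)" "F (a + real i * h) - F a"] Suc by simp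
  qed simp
  from this[of M] show ?thesis using h by simp
qed

text \<open>\<delta> is a Lebesgue number of the cover by balls on which u is close to its one-sided
  limits at the centre. If the centre lies inside the given interval, it is not in S and the two
  limits agree; otherwise the interval lies on one side of it.\<close>

lemma regulated_osc:
  fixes u :: "real \<Rightarrow> 'a::real_normed_vector"
  assumes left: "\<And>s. s \<in> {0<..L} \<Longrightarrow> (u \<longlongrightarrow> lim_left u s) (at_left s)"
    and right: "\<And>s. s \<in> {0..<L} \<Longrightarrow> (u \<longlongrightarrow> lim_right u s) (at_right s)"
    and cont: "\<And>s. s \<in> {0<..<L} - S \<Longrightarrow> lim_left u s = u s \<and> lim_right u s = u s"
    and "0 < \<eta>"
  obtains \<delta> where "0 < \<delta>" "\<And>x y p q. 0 \<le> x \<Longrightarrow> x < y \<Longrightarrow> y \<le> L \<Longrightarrow> y - x < \<delta> \<Longrightarrow> {x<..<y} \<inter> S = {} \<Longrightarrow>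
    p \<in> {x<..<y} \<Longrightarrow> q \<in> {x<..<y} \<Longrightarrow> norm (u p - u q) \<le> \<eta>"
proof -
  have ex: "\<exists>r>0. (\<forall>z. 0 < z \<and> s - r < z \<and> z < s \<longrightarrow> norm (u z - lim_left u s) < \<eta> / 2) \<and>
      (\<forall>z. z < L \<and> s < z \<and> z < s + r \<longrightarrow> norm (u z - lim_right u s) < \<eta> / 2)" if s: "s \<in> {0..L}" for s
  proof -
    have "\<exists>r>0. \<forall>z. 0 < z \<and> s - r < z \<and> z < s \<longrightarrow> norm (u z - lim_left u s) < \<eta> / 2"
    proof (cases "s = 0")
      case False
      then have "eventually (\<lambda>z. dist (u z) (lim_left u s) < \<eta> / 2) (at_left s)"
        using s assms(4) by (intro tendstoD[OF left]) auto
      then obtain d where "d < s" "\<And>z. d < z \<Longrightarrow> z < s \<Longrightarrow> dist (u z) (lim_left u s) < \<eta> / 2"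
        unfolding eventually_at_left_field by blast
      then show ?thesis by (intro exI[of _ "s - d"]) (auto simp: dist_norm)
    qed (auto intro!: exI[of _ 1])
    moreover have "\<exists>r>0. \<forall>z. z < L \<and> s < z \<and> z < s + r \<longrightarrow> norm (u z - lim_right u s) < \<eta> / 2"
    proof (cases "s = L")
      case False
      then have "eventually (\<lambda>z. dist (u z) (lim_right u s) < \<eta> / 2) (at_right s)"
        using s assms(4) by (intro tendstoD[OF right]) auto
      then obtain d where "s < d" "\<And>z. s < z \<Longrightarrow> z < d \<Longrightarrow> dist (u z) (lim_right u s) < \<eta> / 2"
        unfolding eventually_at_right_field by blast
      then show ?thesis by (intro exI[of _ "d - s"]) (auto simp: dist_norm)
    qed (auto intro!: exI[of _ 1])
    ultimately obtain r1 r2 where "r1 > 0" "r2 > 0"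
      "\<forall>z. 0 < z \<and> s - r1 < z \<and> z < s \<longrightarrow> norm (u z - lim_left u s) < \<eta> / 2"
      "\<forall>z. z < L \<and> s < z \<and> z < s + r2 \<longrightarrow> norm (u z - lim_right u s) < \<eta> / 2" by blast
    then show ?thesis by (intro exI[of _ "min r1 r2"]) auto
  qed
  obtain r where r: "\<And>s. s \<in> {0..L} \<Longrightarrow> 0 < r s"
    "\<And>s z. s \<in> {0..L} \<Longrightarrow> 0 < z \<Longrightarrow> s - r s < z \<Longrightarrow> z < s \<Longrightarrow> norm (u z - lim_left u s) < \<eta> / 2"
    "\<And>s z. s \<in> {0..L} \<Longrightarrow> z < L \<Longrightarrow> s < z \<Longrightarrow> z < s + r s \<Longrightarrow> norm (u z - lim_right u s) < \<eta> / 2"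
    using ex by metis
  have cover: "{0..L} \<subseteq> \<Union>((\<lambda>s. ball s (r s)) ` {0..L})" using r(1) by force
  have op: "\<And>G. G \<in> (\<lambda>s. ball s (r s)) ` {0..L} \<Longrightarrow> open G" by auto
  obtain \<delta> where dl: "0 < \<delta>" "\<And>x. x \<in> {0..L} \<Longrightarrow> \<exists>G\<in>(\<lambda>s. ball s (r s)) ` {0..L}. ball x \<delta> \<subseteq> G"
    using Heine_Borel_lemma[OF compact_Icc cover op] by metis
  show thesis
  proof (rule that[OF dl(1)])
    fix x y p q assume xy: "0 \<le> x" "x < y" "y \<le> L" "y - x < \<delta>" and free: "{x<..<y} \<inter> S = {}"
      and pq: "p \<in> {x<..<y}" "q \<in> {x<..<y}"
    obtain s where s: "s \<in> {0..L}" "ball x \<delta> \<subseteq> ball s (r s)" using dl(2)[of x] xy by auto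
    have in_ball: "s - r s < z" "z < s + r s" if "z \<in> {x<..<y}" for z
    proof -
      have "z \<in> ball x \<delta>" using that xy by (auto simp: dist_real_def)
      then have "z \<in> ball s (r s)" using s(2) by blast
      then show "s - r s < z" "z < s + r s" by (auto simp: dist_real_def abs_real_def split: if_splits)
    qed
    have close: "norm (u p - u q) \<le> \<eta>" if "norm (u p - l) < \<eta> / 2" "norm (u q - l) < \<eta> / 2" for l
      using norm_triangle_ineq4[of "u p - l" "u q - l"] that by simp
    show "norm (u p - u q) \<le> \<eta>"
    proof (cases "s \<in> {x<..<y}")
      case True
      then have "s \<in> {0<..<L} - S" using free xy by auto
      note c = cont[OF this]
      have "norm (u z - u s) < \<eta> / 2" if "z \<in> {x<..<y}" for z
        using r(2)[OF s(1), of z] r(3)[OF s(1), of z] in_ball[OF that] that xy assms(4) c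
        by (cases z s rule: linorder_cases) auto
      then show ?thesis using pq by (intro close[of "u s"]) auto
    next
      case False
      then consider "y \<le> s" | "s \<le> x" by force
      then show ?thesis
      proof cases
        case 1
        then have "norm (u z - lim_left u s) < \<eta> / 2" if "z \<in> {x<..<y}" for z
          using r(2)[OF s(1), of z] in_ball[OF that] that xy by auto
        then show ?thesis using pq by (intro close[of "lim_left u s"]) auto
      next
        case 2
        then have "norm (u z - lim_right u s) < \<eta> / 2" if "z \<in> {x<..<y}" for z
          using r(3)[OF s(1), of z] in_ball[OF that] that xy by auto
        then show ?thesis using pq by (intro close[of "lim_right u s"]) auto
      qed
    qed
  qed
qed

lemma small_osc_regulated:
  fixes u :: "real \<Rightarrow> 'a::real_normed_vector"
  assumes left: "\<And>s. s \<in> {0<..L} \<Longrightarrow> (u \<longlongrightarrow> lim_left u s) (at_left s)"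
    and right: "\<And>s. s \<in> {0..<L} \<Longrightarrow> (u \<longlongrightarrow> lim_right u s) (at_right s)"
    and cont: "\<And>s. s \<in> {0<..<L} - S \<Longrightarrow> lim_left u s = u s \<and> lim_right u s = u s"
    and "0 < \<eta>"
  shows "\<exists>\<delta>>0. small_osc L S u \<eta> \<delta>"
proof -
  obtain \<delta> where dl: "0 < \<delta>" "\<And>x y p q. 0 \<le> x \<Longrightarrow> x < y \<Longrightarrow> y \<le> L \<Longrightarrow> y - x < \<delta> \<Longrightarrow> {x<..<y} \<inter> S = {} \<Longrightarrow>
    p \<in> {x<..<y} \<Longrightarrow> q \<in> {x<..<y} \<Longrightarrow> norm (u p - u q) \<le> \<eta>"
    using regulated_osc[OF left right cont assms(4)] by blast
  have "small_osc L S u \<eta> \<delta>"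
    unfolding small_osc_def
  proof (intro allI impI ballI conjI)
    fix x y p assume xy: "0 \<le> x" "x < y" "y \<le> L" "y - x < \<delta>" "{x<..<y} \<inter> S = {}" and p: "p \<in> {x..<y}"
    have 1: "norm (lim_right u p - u z) \<le> \<eta>" if z: "z \<in> {x<..<y}" for z
    proof (rule tendsto_upperbound[OF tendsto_norm[OF tendsto_diff[OF right tendsto_const]]])
      show "p \<in> {0..<L}" using p xy by auto
      have "eventually (\<lambda>z'. z' \<in> {p<..<y}) (at_right p)"
        using p by (intro eventually_at_rightI[of p y]) auto
      then show "\<forall>\<^sub>F z' in at_right p. norm (u z' - u z) \<le> \<eta>"
        by eventually_elim (use dl(2)[OF xy _ z] p in auto)
    qed (simp add: trivial_limit_at_right_real)
    show "norm (lim_right u p - lim_right u q) \<le> \<eta>" if q: "q \<in> {x..<y}" for q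
    proof (rule tendsto_upperbound[OF tendsto_norm[OF tendsto_diff[OF tendsto_const right]]])
      show "q \<in> {0..<L}" using q xy by auto
      have "eventually (\<lambda>z'. z' \<in> {q<..<y}) (at_right q)"
        using q by (intro eventually_at_rightI[of q y]) auto
      then show "\<forall>\<^sub>F z' in at_right q. norm (lim_right u p - u z') \<le> \<eta>"
        by eventually_elim (use 1 q in auto)
    qed (simp add: trivial_limit_at_right_real)
    show "norm (lim_right u p - lim_left u q) \<le> \<eta>" if q: "q \<in> {x<..y}" for q
    proof (rule tendsto_upperbound[OF tendsto_norm[OF tendsto_diff[OF tendsto_const left]]])
      show "q \<in> {0<..L}" using q xy by auto
      have "eventually (\<lambda>z'. z' \<in> {x<..<q}) (at_left q)"
        using q by (intro eventually_at_leftI[of x q]) auto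
      then show "\<forall>\<^sub>F z' in at_left q. norm (lim_right u p - u z') \<le> \<eta>"
        by eventually_elim (use 1 q in auto)
    qed (simp add: trivial_limit_at_left_real)
  qed
  then show ?thesis using dl(1) by blast
qed

section \<open>Orthonormal frames and their jumps\<close>

definition oriented_frame :: "real^3 \<Rightarrow> real^3 \<Rightarrow> real^3 \<Rightarrow> bool" where
  "oriented_frame t n b \<longleftrightarrow> norm t = 1 \<and> norm n = 1 \<and> norm b = 1 \<and> cross3 t n = b"

lemma oriented_frame_relations:
  assumes "oriented_frame t n b"
  shows "t \<bullet> t = 1" "n \<bullet> n = 1" "b \<bullet> b = 1" "t \<bullet> n = 0" "t \<bullet> b = 0" "n \<bullet> b = 0"
    "n \<bullet> t = 0" "b \<bullet> t = 0" "b \<bullet> n = 0" "cross3 n b = t" "cross3 b t = n" "cross3 t b = - n"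
proof -
  have u: "norm t = 1" "norm n = 1" "norm b = 1" and b: "cross3 t n = b"
    using assms by (simp_all add: oriented_frame_def)
  show sq: "t \<bullet> t = 1" "n \<bullet> n = 1" "b \<bullet> b = 1" using u by (simp_all add: norm_eq_1)
  show tn: "t \<bullet> n = 0" using norm_cross_dot[of t n] u b by simp
  then show "n \<bullet> t = 0" by (simp add: inner_commute)
  show "t \<bullet> b = 0" "n \<bullet> b = 0" using dot_cross_self[of t n] dot_cross_self[of n t] b by simp_all
  then show "b \<bullet> t = 0" "b \<bullet> n = 0" by (simp_all add: inner_commute)
  show "cross3 n b = t" using Lagrange[of n t n] b sq tn by (simp add: inner_commute)
  show tb: "cross3 t b = - n" using Lagrange[of t t n] b sq tn by simp
  show "cross3 b t = n" using tb cross_skew[of b t] by simp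
qed

lemma rotation_matrix_frame:
  assumes "rotation_matrix A"
  shows "oriented_frame (A *v axis 1 1) (A *v axis 2 1) (A *v axis 3 1)"
proof -
  have "orthogonal_transformation (\<lambda>x. A *v x)"
    using assms by (simp add: rotation_matrix_def orthogonal_transformation_matrix)
  then have "norm (A *v axis i 1) = 1" for i
    by (simp add: orthogonal_transformation_norm)
  moreover have "cross3 (A *v axis 1 1) (A *v axis 2 1) = A *v axis 3 1"
    using cross_rotation_matrix[OF assms] cross_basis(1) by metis
  ultimately show ?thesis by (simp add: oriented_frame_def)
qed

lemma oriented_frame_limit:
  assumes "F \<noteq> bot" "(t \<longlongrightarrow> t0) F" "(n \<longlongrightarrow> n0) F" "(b \<longlongrightarrow> b0) F"
    and ev: "eventually (\<lambda>z. oriented_frame (t z) (n z) (b z)) F"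
  shows "oriented_frame t0 n0 b0"
proof -
  have lim1: "norm u0 = 1" if "(u \<longlongrightarrow> u0) F" "eventually (\<lambda>z. norm (u z) = 1) F" for u :: "'a \<Rightarrow> real^3" and u0
    using tendsto_unique[OF assms(1) tendsto_norm[OF that(1)] tendsto_eventually[OF that(2)]] .
  have "bounded_bilinear (cross3 :: real^3 \<Rightarrow> _)"
    using bilinear_cross bilinear_conv_bounded_bilinear by blast
  then have "((\<lambda>z. cross3 (t z) (n z)) \<longlongrightarrow> cross3 t0 n0) F"
    by (rule bounded_bilinear.tendsto) (rule assms)+
  moreover have "eventually (\<lambda>z. cross3 (t z) (n z) = b z) F"
    using ev by eventually_elim (simp add: oriented_frame_def)
  ultimately have "(b \<longlongrightarrow> cross3 t0 n0) F" by (rule Lim_transform_eventually)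
  then have "cross3 t0 n0 = b0" using tendsto_unique[OF assms(1) _ assms(4)] by blast
  moreover have "norm t0 = 1" "norm n0 = 1" "norm b0 = 1"
    by (rule lim1[OF assms(2)] lim1[OF assms(3)] lim1[OF assms(4)],
        use ev in eventually_elim, simp add: oriented_frame_def)+
  ultimately show ?thesis by (simp add: oriented_frame_def)
qed

lemma rotation_about_apply:
  "rotation_about a r *v x = cos r *\<^sub>R x + sin r *\<^sub>R cross3 a x + ((1 - cos r) * (a \<bullet> x)) *\<^sub>R a"
proof -
  have "linear (\<lambda>x. cos r *\<^sub>R x + sin r *\<^sub>R cross3 a x + ((1 - cos r) * (a \<bullet> x)) *\<^sub>R a)"
    by (rule linearI)
      (simp_all add: cross_add_right cross_mult_right inner_add_right algebra_simps scaleR_add_right scaleR_add_left)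
  then show ?thesis unfolding rotation_about_def by (intro matrix_works) (simp only: linear_matrix_vector_mul_eq)
qed

text \<open>
  With c = cos (\<alpha>/2) and s = sin (\<alpha>/2), the common normal of t and its image t' under the rotation of
  angle \<alpha> about a = p t + q b is proportional to m = c b - p s n, and both b and its image make with m
  an angle whose cosine is c / norm m, hence an angle at most \<alpha>/2.
\<close>

lemma jump_geometry:
  fixes t n b :: "real^3"
  assumes fr: "oriented_frame t n b" and pq: "p\<^sup>2 + q\<^sup>2 = 1" "0 \<le> q" and al: "0 < r" "r < pi"
  defines "a \<equiv> p *\<^sub>R t + q *\<^sub>R b"
  shows "vec_angle t (rotation_about a r *v t) \<le> r"
    "\<exists>\<nu> w. norm \<nu> = 1 \<and> 0 \<le> w \<and> cross3 t (rotation_about a r *v t) = w *\<^sub>R \<nu> \<and>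
      (w = 0 \<longrightarrow> t = rotation_about a r *v t) \<and>
      vec_angle b \<nu> \<le> r / 2 \<and> vec_angle \<nu> (rotation_about a r *v b) \<le> r / 2"
proof -
  note rel = oriented_frame_relations[OF fr]
  have b: "cross3 t n = b" using fr by (simp add: oriented_frame_def)
  define c s where "c = cos (r/2)" and "s = sin (r/2)"
  have cs: "c\<^sup>2 + s\<^sup>2 = 1" by (simp add: c_def s_def)
  have c0: "0 < c" and s0: "0 < s" using al by (auto simp: c_def s_def intro!: cos_gt_zero_pi sin_gt_zero)
  have r: "cos r = c\<^sup>2 - s\<^sup>2" "sin r = 2 * s * c" "1 - cos r = 2 * s\<^sup>2"
  proof -
    show 1: "cos r = c\<^sup>2 - s\<^sup>2" using cos_double[of "r/2"] by (simp add: c_def s_def)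
    show "sin r = 2 * s * c" using sin_double[of "r/2"] by (simp add: c_def s_def)
    show "1 - cos r = 2 * s\<^sup>2" using 1 cs by simp
  qed
  have at: "cross3 a t = q *\<^sub>R n" "cross3 a b = - (p *\<^sub>R n)" "a \<bullet> t = p" "a \<bullet> b = q"
    using rel by (simp_all add: a_def cross_add_left cross_mult_left inner_add_left)
  define t' b' where "t' = rotation_about a r *v t" and "b' = rotation_about a r *v b"
  have t': "t' = cos r *\<^sub>R t + (sin r * q) *\<^sub>R n + ((1 - cos r) * p) *\<^sub>R a"
    by (simp add: t'_def rotation_about_apply at)
  have b': "b' = cos r *\<^sub>R b - (sin r * p) *\<^sub>R n + ((1 - cos r) * q) *\<^sub>R a"
    by (simp add: b'_def rotation_about_apply at)
  define m where "m = c *\<^sub>R b - (p * s) *\<^sub>R n"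
  have mm: "m \<bullet> m = c\<^sup>2 + (p * s)\<^sup>2"
    using rel by (simp add: m_def inner_diff_left inner_diff_right power2_eq_square)
  have nm: "0 < norm m" "norm m \<le> 1"
  proof -
    have "0 < m \<bullet> m" using c0 mm by (simp add: add_pos_nonneg)
    then show "0 < norm m" by auto
    have "p\<^sup>2 \<le> 1" using pq by (smt (verit) zero_le_power2)
    then have "(p * s)\<^sup>2 \<le> 1 * s\<^sup>2" unfolding power_mult_distrib by (intro mult_right_mono) auto
    then have "(norm m)\<^sup>2 \<le> 1\<^sup>2" using mm cs by (simp add: power2_norm_eq_inner)
    then show "norm m \<le> 1" by (rule power2_le_imp_le) simp
  qed
  define \<nu> where "\<nu> = (1 / norm m) *\<^sub>R m"
  have nu: "norm \<nu> = 1" using nm by (simp add: \<nu>_def)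
  define w where "w = 2 * q * s * norm m"
  have "p\<^sup>2 = 1 - q\<^sup>2" using pq by simp
  have tt': "cross3 t t' = w *\<^sub>R \<nu>"
  proof -
    have "cross3 t t' = (sin r * q) *\<^sub>R b + ((1 - cos r) * p * q) *\<^sub>R (- n)"
      unfolding t' a_def using rel b by (simp add: cross_add_right cross_mult_right mult.assoc)
    also have "\<dots> = (2 * q * s) *\<^sub>R m"
      unfolding r(2,3) m_def by (simp add: scaleR_diff_right power2_eq_square mult_ac)
    also have "\<dots> = w *\<^sub>R \<nu>" using nm by (simp add: w_def \<nu>_def)
    finally show ?thesis .
  qed
  have tdot: "t \<bullet> t' = cos r + (1 - cos r) * p\<^sup>2"
    unfolding t' using rel at by (simp add: inner_add_right inner_commute[of t a] power2_eq_square)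
  have bm: "b \<bullet> m = c" using rel by (simp add: m_def inner_diff_right)
  have b'm: "b' \<bullet> m = c"
  proof -
    have am: "a \<bullet> m = q * c" using rel by (simp add: a_def m_def inner_diff_right inner_add_left)
    have nm: "n \<bullet> m = - (p * s)" using rel by (simp add: m_def inner_diff_right)
    have "b' \<bullet> m = cos r * c + (sin r * p) * (p * s) + ((1 - cos r) * q) * (q * c)"
      unfolding b' by (simp add: inner_add_left inner_diff_left bm am nm)
    also have "\<dots> = (c\<^sup>2 - s\<^sup>2) * c + 2 * s\<^sup>2 * c * (p\<^sup>2 + q\<^sup>2)"
      unfolding r(2,3) unfolding r(1) by (simp add: power2_eq_square algebra_simps)
    also have "\<dots> = (c\<^sup>2 + s\<^sup>2) * c" unfolding pq by (simp add: algebra_simps)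
    finally show ?thesis using cs by simp
  qed
  have cross_norm: "norm t' = 1" "norm b' = 1"
  proof -
    have aa: "a \<bullet> a = 1" using rel pq by (simp add: a_def inner_add_left inner_add_right power2_eq_square)
    have an: "a \<bullet> n = 0" "n \<bullet> a = 0" using rel by (simp_all add: a_def inner_add_left inner_add_right)
    \<comment> \<open>Writing the squared sine as a product leaves an identity of polynomials in cos
      r, p and q.\<close>
    have sc: "(sin r)\<^sup>2 = (1 - cos r) * (1 + cos r)"
      using sin_squared_eq[of r] by (simp add: power2_eq_square algebra_simps)
    have "t' \<bullet> t' = (cos r)\<^sup>2 + (sin r)\<^sup>2 * q\<^sup>2 + ((1 - cos r)\<^sup>2 * p\<^sup>2 + 2 * cos r * (1 - cos r) * p\<^sup>2)"
      unfolding t' using rel at aa an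
      by (simp add: inner_add_left inner_add_right inner_commute[of t a] power2_eq_square algebra_simps)
    also have "\<dots> = (cos r)\<^sup>2 + (sin r)\<^sup>2 * (p\<^sup>2 + q\<^sup>2)"
      unfolding sc by (simp add: power2_eq_square algebra_simps)
    finally show "norm t' = 1" unfolding pq by (simp add: norm_eq_1)
    have "b' \<bullet> b' = (cos r)\<^sup>2 + (sin r)\<^sup>2 * p\<^sup>2 + ((1 - cos r)\<^sup>2 * q\<^sup>2 + 2 * cos r * (1 - cos r) * q\<^sup>2)"
      unfolding b' using rel at aa an
      by (simp add: inner_add_left inner_add_right inner_diff_left inner_diff_right inner_commute[of b a] power2_eq_square algebra_simps)
    also have "\<dots> = (cos r)\<^sup>2 + (sin r)\<^sup>2 * (p\<^sup>2 + q\<^sup>2)"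
      unfolding sc by (simp add: power2_eq_square algebra_simps)
    finally show "norm b' = 1" unfolding pq by (simp add: norm_eq_1)
  qed
  have unit: "sgn z = z" if "norm z = 1" for z :: "real^3" using that by (simp add: sgn_div_norm)
  have nt: "norm t = 1" "norm b = 1" using fr by (simp_all add: oriented_frame_def)
  show "vec_angle t (rotation_about a r *v t) \<le> r"
  proof (rule vec_angle_le_cos)
    have "0 \<le> (1 - cos r) * p\<^sup>2" by simp
    then show "cos r \<le> sgn t \<bullet> sgn (rotation_about a r *v t)"
      unfolding t'_def[symmetric] using cross_norm nt tdot by (simp add: unit)
  qed (use al in simp)
  \<comment> \<open>Since m is at most a unit vector, dividing by its length only increases the
    cosine.\<close>
  have cc: "c \<le> c / norm m" using nm c0 by (simp add: le_divide_eq mult_left_le)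
  have "vec_angle b \<nu> \<le> r / 2"
  proof (rule vec_angle_le_cos)
    have "b \<bullet> \<nu> = c / norm m" by (simp add: \<nu>_def bm)
    then show "cos (r / 2) \<le> sgn b \<bullet> sgn \<nu>" using cc nt nu by (simp add: unit c_def)
  qed (use al in simp)
  moreover have "vec_angle \<nu> b' \<le> r / 2"
  proof (rule vec_angle_le_cos)
    have "\<nu> \<bullet> b' = c / norm m" by (simp add: \<nu>_def b'm inner_commute[of m])
    then show "cos (r / 2) \<le> sgn \<nu> \<bullet> sgn b'" using cc cross_norm nu by (simp add: unit c_def)
  qed (use al in simp)
  moreover have "t = t'" if "w = 0"
  proof -
    \<comment> \<open>Then the axis a is t or its opposite, so the rotation fixes t.\<close>
    have "q = 0" using that s0 nm by (simp add: w_def)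
    then have "p\<^sup>2 = 1" using pq by simp
    then have "p * p = 1" by (simp add: power2_eq_square)
    then show ?thesis unfolding t' a_def using \<open>q = 0\<close> by (simp add: mult.assoc flip: scaleR_add_left)
  qed
  moreover have "0 \<le> w" using pq s0 by (simp add: w_def)
  ultimately show "\<exists>\<nu> w. norm \<nu> = 1 \<and> 0 \<le> w \<and> cross3 t (rotation_about a r *v t) = w *\<^sub>R \<nu> \<and>
      (w = 0 \<longrightarrow> t = rotation_about a r *v t) \<and>
      vec_angle b \<nu> \<le> r / 2 \<and> vec_angle \<nu> (rotation_about a r *v b) \<le> r / 2"
    using nu tt' unfolding t'_def b'_def by blast
qed

section \<open>The frame equation\<close>

text \<open>Freezing the matrix factor at a constant C turns the equation of measures into an
  estimate of increments: the error integrand is (C - G) f. K is the cumulative variation of \<mu>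
  times the constant B of the matrix product.\<close>

lemma product_measure_interval:
  assumes "is_product_measure E (\<lambda>s. - G s) \<mu> \<eta>"
  obtains K :: "real \<Rightarrow> real" where "mono K"
    "\<And>x y C \<epsilon>. x < y \<Longrightarrow> {x<..<y} \<subseteq> E \<Longrightarrow> 0 \<le> \<epsilon> \<Longrightarrow> (\<And>z. z \<in> {x<..<y} \<Longrightarrow> norm (G z - C) \<le> \<epsilon>) \<Longrightarrow>
      norm (\<eta> {x<..<y} + C ** \<mu> {x<..<y}) \<le> \<epsilon> * (K y - K x)"
proof -
  obtain \<nu> f where d1: "has_density E \<mu> \<nu> f" and d2: "has_density E \<eta> \<nu> (\<lambda>x. (- G x) ** f x)"
    using assms unfolding is_product_measure_def by blast
  have bil: "bounded_bilinear ((**) :: real^3^3 \<Rightarrow> real^3^3 \<Rightarrow> real^3^3)"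
  proof -
    have "bilinear ((**) :: real^3^3 \<Rightarrow> real^3^3 \<Rightarrow> real^3^3)"
      unfolding bilinear_def
      by (auto intro!: linearI simp: vec_eq_iff matrix_matrix_mult_def sum_3 algebra_simps)
    then show ?thesis using bilinear_conv_bounded_bilinear by blast
  qed
  have "\<exists>B>0. \<forall>(P :: real^3^3) (Q :: real^3^3). norm (P ** Q) \<le> norm P * norm Q * B"
    by (rule bounded_bilinear.pos_bounded[OF bil])
  then obtain B where B: "0 < B" "\<forall>(P :: real^3^3) (Q :: real^3^3). norm (P ** Q) \<le> norm P * norm Q * B"
    by (elim exE conjE)
  obtain K0 :: "real \<Rightarrow> real" where K0: "mono K0"
    "\<And>x y (g :: real \<Rightarrow> real^3^3) B. x < y \<Longrightarrow> {x<..<y} \<subseteq> E \<Longrightarrow> integrable \<nu> g \<Longrightarrow> 0 \<le> B \<Longrightarrow>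
      (\<And>z. z \<in> {x<..<y} \<Longrightarrow> norm (g z) \<le> B * norm (f z)) \<Longrightarrow>
      norm (LINT z:{x<..<y}|\<nu>. g z) \<le> B * (K0 y - K0 x)"
    using density_cumulative[OF d1, where 'b = "real^3^3"] by metis
  show thesis
  proof (rule that[of "\<lambda>s. B * K0 s"])
    show "mono (\<lambda>s. B * K0 s)" using K0(1) B(1) by (auto simp: mono_def intro!: mult_left_mono)
    fix x y C \<epsilon> assume xy: "x < y" "{x<..<y} \<subseteq> E" and e: "0 \<le> \<epsilon>"
      and le: "\<And>z. z \<in> {x<..<y} \<Longrightarrow> norm (G z - C) \<le> \<epsilon>"
    have A: "{x<..<y} \<in> sets \<nu>" using has_density_sets[OF d1 _ xy(2)] by simp
    have f: "integrable \<nu> f" and gf: "integrable \<nu> (\<lambda>z. (- G z) ** f z)"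
      using d1 d2 by (simp_all add: has_density_def)
    note lin = bounded_bilinear.bounded_linear_right[OF bil, of C]
    have Cf: "integrable \<nu> (\<lambda>z. C ** f z)" by (rule integrable_bounded_linear[OF lin f])
    have \<mu>: "\<mu> {x<..<y} = (LINT z|\<nu>. indicator {x<..<y} z *\<^sub>R f z)"
      and \<eta>: "\<eta> {x<..<y} = (LINT z:{x<..<y}|\<nu>. (- G z) ** f z)"
      using d1 d2 A unfolding has_density_def set_lebesgue_integral_def by blast+
    have "C ** \<mu> {x<..<y} = (LINT z:{x<..<y}|\<nu>. C ** f z)"
      unfolding \<mu> set_lebesgue_integral_def
      using integral_bounded_linear[OF lin integrable_mult_indicator[OF A f]]
      by (simp add: linear_simps[OF lin])
    then have "\<eta> {x<..<y} + C ** \<mu> {x<..<y} = (LINT z:{x<..<y}|\<nu>. (- G z) ** f z + C ** f z)"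
      unfolding \<eta> using integrable_mult_indicator[OF A gf] integrable_mult_indicator[OF A Cf]
      by (simp add: set_integral_add(2) set_integrable_def)
    also have "norm \<dots> \<le> (\<epsilon> * B) * (K0 y - K0 x)"
    proof (rule K0(2)[OF xy])
      show "integrable \<nu> (\<lambda>z. (- G z) ** f z + C ** f z)" using gf Cf by simp
      fix z assume "z \<in> {x<..<y}"
      have "(- G z) ** f z + C ** f z = (C - G z) ** f z"
        by (simp add: bounded_bilinear.diff_left[OF bil] bounded_bilinear.minus_left[OF bil])
      then have "norm ((- G z) ** f z + C ** f z) \<le> norm (C - G z) * norm (f z) * B"
        using B(2)[rule_format, of "C - G z" "f z"] by simp
      also have "\<dots> \<le> \<epsilon> * norm (f z) * B"
        using le[OF \<open>z \<in> {x<..<y}\<close>] B(1) by (intro mult_right_mono) (auto simp: norm_minus_commute)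
      finally show "norm ((- G z) ** f z + C ** f z) \<le> \<epsilon> * B * norm (f z)" by (simp add: mult_ac)
    qed (use e B(1) in simp)
    finally show "norm (\<eta> {x<..<y} + C ** \<mu> {x<..<y}) \<le> \<epsilon> * (B * K0 y - B * K0 x)"
      by (simp add: algebra_simps)
  qed
qed

lemma Omega_eq: "Omega \<theta> \<phi> s = \<theta> s *\<^sub>R (- J3) + \<phi> s *\<^sub>R (- J1)"
  by (simp add: Omega_def J1_def J3_def vec_eq_iff forall_3)

text \<open>The first column of DG = - G D\<Omega> thereby becomes dt = n d\<theta>.\<close>

lemma J_axis: "(- J3) *v axis 1 1 = - axis 2 1" "(- J1) *v axis 1 1 = 0"
  by (simp_all add: J1_def J3_def vec_eq_iff forall_3 matrix_vector_mult_def sum_3 axis_def)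

text \<open>Each of p and q fills two entries of the matrix, up to sign; this is the origin of the
  factor \<open>2 powr (-1/2)\<close>.\<close>

lemma norm_J_combination: "norm (p *\<^sub>R (- J3) + q *\<^sub>R (- J1)) = sqrt 2 * sqrt (p\<^sup>2 + q\<^sup>2)"
proof -
  have "(norm (p *\<^sub>R (- J3) + q *\<^sub>R (- J1)))\<^sup>2 = 2 * (p\<^sup>2 + q\<^sup>2)"
    unfolding power2_norm_eq_inner
    by (simp add: J1_def J3_def inner_vec_def sum_3 power2_eq_square)
  then show ?thesis by (metis norm_ge_zero real_sqrt_mult real_sqrt_abs abs_of_nonneg)
qed

lemma bounded_linear_matrix_apply: "bounded_linear (\<lambda>A :: real^3^3. A *v e)"
  unfolding linear_conv_bounded_linear[symmetric]
  by (rule linearI) (simp_all add: matrix_vector_mult_add_rdistrib scaleR_matrix_vector_assoc)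

lemma J_combination_diff:
  "(p' *\<^sub>R (- J3) + q' *\<^sub>R (- J1)) - (p *\<^sub>R (- J3) + q *\<^sub>R (- J1))
    = (p' - p) *\<^sub>R (- J3) + (q' - q) *\<^sub>R (- J1)"
  by (simp add: algebra_simps)

lemma BV_small_osc:
  assumes "BV L u" "\<And>s. s \<in> {0<..<L} - S \<Longrightarrow> lim_left u s = u s \<and> lim_right u s = u s" "0 < \<eta>"
  shows "\<exists>\<delta>>0. small_osc L S u \<eta> \<delta>"
  using BV_tendsto_left[OF assms(1)] BV_tendsto_right[OF assms(1)] assms(2,3) by (rule small_osc_regulated)

locale frame_equation =
  fixes L :: real and \<theta> \<phi> :: "real \<Rightarrow> real" and G :: "real \<Rightarrow> real^3^3"
    and t n b c :: "real \<Rightarrow> real^3" and S :: "real set"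
  assumes L_pos: "0 < L" and BV_theta: "BV L \<theta>" and BV_phi: "BV L \<phi>"
    and theta_mono: "strict_mono_on {0<..<L} \<theta>"
    and S_def: "S = jump_set L (Omega \<theta> \<phi>)" and S_finite: "finite S"
    and jump_angle: "s \<in> S \<Longrightarrow> 0 < jump_angle \<theta> \<phi> s \<and> jump_angle \<theta> \<phi> s < pi"
    and sol: "frame_solution L \<theta> \<phi> G"
    and t_def: "t = (\<lambda>s. G s *v axis 1 1)" and n_def: "n = (\<lambda>s. G s *v axis 2 1)"
    and b_def: "b = (\<lambda>s. G s *v axis 3 1)" and c_def: "c = (\<lambda>s. integral {0..s} t)"
begin

section \<open>One-sided limits of the solution\<close>

lemma BV_G: "BV L G"
  using sol by (simp add: frame_solution_def)

lemma BV_frame: "BV L t" "BV L n" "BV L b"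
  unfolding t_def n_def b_def by (rule BV_linear[OF bounded_linear_matrix_apply BV_G])+

lemma lim_frame:
  "s \<in> {0<..L} \<Longrightarrow> lim_left t s = lim_left G s *v axis 1 1"
  "s \<in> {0<..L} \<Longrightarrow> lim_left b s = lim_left G s *v axis 3 1"
  "s \<in> {0..<L} \<Longrightarrow> lim_right t s = lim_right G s *v axis 1 1"
  "s \<in> {0..<L} \<Longrightarrow> lim_right n s = lim_right G s *v axis 2 1"
  "s \<in> {0..<L} \<Longrightarrow> lim_right b s = lim_right G s *v axis 3 1"
  unfolding t_def n_def b_def by (rule lim_linear[OF bounded_linear_matrix_apply BV_G]; assumption)+

lemma S_subset: "S \<subseteq> {0<..<L}"
  by (auto simp: S_def jump_set_def)

lemma BV_Omega: "BV L (Omega \<theta> \<phi>)"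
proof -
  have "BV L (\<lambda>s. \<theta> s *\<^sub>R (- J3) + \<phi> s *\<^sub>R (- J1))"
    by (intro BV_add BV_linear[OF _ BV_theta] BV_linear[OF _ BV_phi] bounded_linear_scaleR_left)
  then show ?thesis by (simp add: Omega_eq[abs_def])
qed

lemma lim_Omega:
  "s \<in> {0<..L} \<Longrightarrow> lim_left (Omega \<theta> \<phi>) s = lim_left \<theta> s *\<^sub>R (- J3) + lim_left \<phi> s *\<^sub>R (- J1)"
  "s \<in> {0..<L} \<Longrightarrow> lim_right (Omega \<theta> \<phi>) s = lim_right \<theta> s *\<^sub>R (- J3) + lim_right \<phi> s *\<^sub>R (- J1)"
  unfolding Omega_eq[abs_def]
  by (rule lim_left_eq lim_right_eq, intro tendsto_intros BV_tendsto_left[OF BV_theta]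
      BV_tendsto_left[OF BV_phi] BV_tendsto_right[OF BV_theta] BV_tendsto_right[OF BV_phi]; assumption)+

lemma off_S: "s \<in> {0<..<L} - S \<Longrightarrow> lim_left \<theta> s = lim_right \<theta> s"
proof -
  assume s: "s \<in> {0<..<L} - S"
  then have "lim_left (Omega \<theta> \<phi>) s = lim_right (Omega \<theta> \<phi>) s" by (simp add: S_def jump_set_def)
  then have "(lim_left \<theta> s - lim_right \<theta> s) *\<^sub>R (- J3) + (lim_left \<phi> s - lim_right \<phi> s) *\<^sub>R (- J1) = 0"
    unfolding J_combination_diff[symmetric] using lim_Omega[of s] s by simp
  then have "sqrt 2 * sqrt ((lim_left \<theta> s - lim_right \<theta> s)\<^sup>2 + (lim_left \<phi> s - lim_right \<phi> s)\<^sup>2) = 0"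
    unfolding norm_J_combination[symmetric] by simp
  then show ?thesis by (simp add: add_nonneg_eq_0_iff)
qed

lemma jump_Omega: "s \<in> S \<Longrightarrow> norm (jump (Omega \<theta> \<phi>) s) = sqrt 2 * jump_angle \<theta> \<phi> s"
proof -
  assume "s \<in> S"
  then have s: "s \<in> {0<..<L}" using S_subset by blast
  have "jump (Omega \<theta> \<phi>) s = jump \<theta> s *\<^sub>R (- J3) + jump \<phi> s *\<^sub>R (- J1)"
    unfolding jump_def J_combination_diff[symmetric] using lim_Omega[of s] s by simp
  then show ?thesis unfolding jump_angle_def by (simp only: norm_J_combination)
qed

lemma theta_le: "x \<in> {0<..<L} \<Longrightarrow> y \<in> {0<..<L} \<Longrightarrow> x \<le> y \<Longrightarrow> \<theta> x \<le> \<theta> y"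
  using strict_mono_on_leD[OF theta_mono] by blast

lemma theta_less:
  assumes "0 \<le> x" "x < y" "y \<le> L"
  shows "lim_right \<theta> x \<le> lim_left \<theta> y"
proof -
  define z where "z = (x + y) / 2"
  have z: "x < z" "z < y" using assms by (auto simp: z_def)
  have "lim_right \<theta> x \<le> \<theta> z"
  proof (rule tendsto_upperbound[OF BV_tendsto_right[OF BV_theta]])
    have "eventually (\<lambda>w. w \<in> {x<..<z}) (at_right x)" using z by (intro eventually_at_rightI[of x z]) auto
    then show "eventually (\<lambda>w. \<theta> w \<le> \<theta> z) (at_right x)"
    proof eventually_elim
      case (elim w)
      then show ?case using z assms by (intro theta_le) auto
    qed
  qed (use assms in \<open>auto simp: trivial_limit_at_right_real\<close>)
  also have "\<theta> z \<le> lim_left \<theta> y"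
  proof (rule tendsto_lowerbound[OF BV_tendsto_left[OF BV_theta]])
    have "eventually (\<lambda>w. w \<in> {z<..<y}) (at_left y)" using z by (intro eventually_at_leftI[of z y]) auto
    then show "eventually (\<lambda>w. \<theta> z \<le> \<theta> w) (at_left y)"
    proof eventually_elim
      case (elim w)
      then show ?case using z assms by (intro theta_le) auto
    qed
  qed (use assms in \<open>auto simp: trivial_limit_at_left_real\<close>)
  finally show ?thesis .
qed

text \<open>The predicate \<open>BV\<close> leaves the values at single points free; monotonicity
  places \<open>\<theta> x\<close> between the one-sided limits, so that \<theta> is continuous off
  S.\<close>

lemma theta_between:
  assumes "x \<in> {0<..<L}"
  shows "lim_left \<theta> x \<le> \<theta> x" "\<theta> x \<le> lim_right \<theta> x"
proof -
  show "lim_left \<theta> x \<le> \<theta> x"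
  proof (rule tendsto_upperbound[OF BV_tendsto_left[OF BV_theta]])
    have "eventually (\<lambda>w. w \<in> {0<..<x}) (at_left x)" using assms by (intro eventually_at_leftI[of 0 x]) auto
    then show "eventually (\<lambda>w. \<theta> w \<le> \<theta> x) (at_left x)"
    proof eventually_elim
      case (elim w)
      then show ?case using assms by (intro theta_le) auto
    qed
  qed (use assms in \<open>auto simp: trivial_limit_at_left_real\<close>)
  show "\<theta> x \<le> lim_right \<theta> x"
  proof (rule tendsto_lowerbound[OF BV_tendsto_right[OF BV_theta]])
    have "eventually (\<lambda>w. w \<in> {x<..<L}) (at_right x)" using assms by (intro eventually_at_rightI[of x L]) auto
    then show "eventually (\<lambda>w. \<theta> x \<le> \<theta> w) (at_right x)"
    proof eventually_elim
      case (elim w)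
      then show ?case using assms by (intro theta_le) auto
    qed
  qed (use assms in \<open>auto simp: trivial_limit_at_right_real\<close>)
qed

lemma theta_cont: "s \<in> {0<..<L} - S \<Longrightarrow> lim_left \<theta> s = \<theta> s \<and> lim_right \<theta> s = \<theta> s"
  using off_S[of s] theta_between[of s] by auto

lemma G_cont: "s \<in> {0<..<L} - S \<Longrightarrow> lim_left G s = G s \<and> lim_right G s = G s"
proof -
  assume s: "s \<in> {0<..<L} - S"
  have "open ({0<..<L} - S)" using S_finite by (intro open_Diff finite_imp_closed) auto
  moreover have "continuous_on ({0<..<L} - S) G" using sol by (simp add: frame_solution_def S_def)
  ultimately have "isCont G s" using s continuous_on_eq_continuous_at by blast
  then have "(G \<longlongrightarrow> G s) (at s)" by (simp add: isCont_def)
  then have "(G \<longlongrightarrow> G s) (at_left s)" "(G \<longlongrightarrow> G s) (at_right s)"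
    by (simp_all add: filterlim_at_split)
  then show ?thesis by (simp add: lim_left_eq lim_right_eq)
qed

lemma frame_cont:
  assumes "s \<in> {0<..<L} - S"
  shows "lim_left t s = t s \<and> lim_right t s = t s" "lim_left n s = n s \<and> lim_right n s = n s"
    "lim_left b s = b s \<and> lim_right b s = b s"
  unfolding t_def n_def b_def
  using lim_linear[OF bounded_linear_matrix_apply BV_G, of s] G_cont[OF assms] assms by auto

lemma frame: "s \<in> {0<..<L} - S \<Longrightarrow> oriented_frame (t s) (n s) (b s)"
  unfolding t_def n_def b_def
  by (rule rotation_matrix_frame) (use sol in \<open>simp add: frame_solution_def S_def\<close>)

lemma eventually_off_S: "eventually (\<lambda>z. z \<notin> S) (at x)"
proof -
  have "open (- (S - {x}))" using S_finite by (intro open_Compl finite_imp_closed) auto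
  then show ?thesis unfolding eventually_at_topological by (intro exI[of _ "- (S - {x})"]) auto
qed

text \<open>G is a rotation off the finite set S; being an oriented frame is a closed condition and
  so passes to the one-sided limits, also at points of S and at 0.\<close>

lemma frame_right:
  assumes "x \<in> {0..<L}"
  shows "oriented_frame (lim_right t x) (lim_right n x) (lim_right b x)"
proof (rule oriented_frame_limit)
  have "eventually (\<lambda>z. z \<in> {x<..<L}) (at_right x)" using assms by (intro eventually_at_rightI[of x L]) auto
  moreover have "eventually (\<lambda>z. z \<notin> S) (at_right x)"
    using eventually_off_S[of x] by (simp add: eventually_at_split)
  ultimately show "eventually (\<lambda>z. oriented_frame (t z) (n z) (b z)) (at_right x)"
    by eventually_elim (use assms in \<open>auto intro!: frame\<close>)
qed (use BV_tendsto_right assms BV_frame in \<open>auto simp: trivial_limit_at_right_real\<close>)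

lemma frame_left:
  assumes "x \<in> {0<..L}"
  shows "oriented_frame (lim_left t x) (lim_left n x) (lim_left b x)"
proof (rule oriented_frame_limit)
  have "eventually (\<lambda>z. z \<in> {0<..<x}) (at_left x)" using assms by (intro eventually_at_leftI[of 0 x]) auto
  moreover have "eventually (\<lambda>z. z \<notin> S) (at_left x)"
    using eventually_off_S[of x] by (simp add: eventually_at_split)
  ultimately show "eventually (\<lambda>z. oriented_frame (t z) (n z) (b z)) (at_left x)"
    by eventually_elim (use assms in \<open>auto intro!: frame\<close>)
qed (use BV_tendsto_left assms BV_frame in \<open>auto simp: trivial_limit_at_left_real\<close>)

text \<open>Freezing G at the left end of a subinterval costs \<epsilon> times an increment of K.
  These costs add up to \<epsilon> times one fixed number, and \<epsilon> is arbitrary, so that only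
  the distance of n from v remains.\<close>

lemma tangent_step_interior:
  assumes xy: "0 \<le> x" "x < y" "y \<le> L" "{x<..<y} \<inter> S = {}"
    and le: "\<And>z. z \<in> {x<..<y} \<Longrightarrow> norm (n z - v) \<le> \<eta>" and ab: "x < a" "a \<le> b'" "b' < y"
  shows "norm (t b' - t a - (\<theta> b' - \<theta> a) *\<^sub>R v) \<le> \<eta> * (\<theta> b' - \<theta> a)"
proof (rule field_le_epsilon)
  fix e :: real assume e: "0 < e"
  obtain K :: "real \<Rightarrow> real" where K: "mono K"
    "\<And>x y C \<epsilon>. x < y \<Longrightarrow> {x<..<y} \<subseteq> {0<..<L} - S \<Longrightarrow> 0 \<le> \<epsilon> \<Longrightarrow> (\<And>z. z \<in> {x<..<y} \<Longrightarrow> norm (G z - C) \<le> \<epsilon>) \<Longrightarrow>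
      norm (deriv_measure L G {x<..<y} + C ** deriv_measure L (Omega \<theta> \<phi>) {x<..<y}) \<le> \<epsilon> * (K y - K x)"
    using product_measure_interval[of "{0<..<L} - S" G "deriv_measure L (Omega \<theta> \<phi>)" "deriv_measure L G"] sol
    unfolding frame_solution_def S_def by blast
  obtain B where B: "0 < B" "\<And>A :: real^3^3. norm (A *v axis 1 1) \<le> norm A * B"
    using bounded_linear.pos_bounded[OF bounded_linear_matrix_apply] by blast
  define R where "R = B * (K b' - K a) + 1"
  have "0 \<le> B * (K b' - K a)" using K(1) ab B by (simp add: mono_def)
  then have R: "0 < R" by (simp add: R_def)
  define \<epsilon> where "\<epsilon> = e / R"
  have eps: "0 < \<epsilon>" using e R by (simp add: \<epsilon>_def)
  obtain \<delta> where d: "0 < \<delta>" "small_osc L S G \<epsilon> \<delta>"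
    using BV_small_osc[OF BV_G G_cont eps] by blast
  have inS: "z \<in> {0<..<L} - S" if "x < z" "z < y" for z
  proof -
    have "z \<in> {x<..<y}" using that by simp
    then show ?thesis using xy by auto
  qed
  \<comment> \<open>The claim becomes an inequality between increments of F and of g, which may be
    checked on short intervals.\<close>
  define F where "F s = t s - \<theta> s *\<^sub>R v" for s
  define g where "g s = \<eta> * \<theta> s + \<epsilon> * B * K s" for s
  have "norm (F b' - F a) \<le> g b' - g a"
  proof (rule local_to_global[OF d(1) ab(2)])
    fix p q assume pq: "a \<le> p" "p \<le> q" "q \<le> b'" "q - p < \<delta>"
    show "norm (F q - F p) \<le> g q - g p"
    proof (cases "p = q")
      case False
      then have lt: "p < q" using pq by simp
      have p: "p \<in> {0<..<L} - S" and q: "q \<in> {0<..<L} - S" using inS pq ab by auto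
      have sub: "{p<..<q} \<subseteq> {0<..<L} - S" using inS pq ab by auto
      have GG: "deriv_measure L G {p<..<q} = G q - G p"
        using distr_deriv_interval[OF BV_G BV_distr_deriv[OF BV_G], of p q] lt p q G_cont[OF p] G_cont[OF q] by auto
      have OO: "deriv_measure L (Omega \<theta> \<phi>) {p<..<q} *v axis 1 1 = - ((\<theta> q - \<theta> p) *\<^sub>R axis 2 1)"
      proof -
        have "deriv_measure L (Omega \<theta> \<phi>) {p<..<q} = (\<theta> q - \<theta> p) *\<^sub>R (- J3) + (lim_left \<phi> q - lim_right \<phi> p) *\<^sub>R (- J1)"
          unfolding J_combination_diff[symmetric]
          using distr_deriv_interval[OF BV_Omega BV_distr_deriv[OF BV_Omega], of p q] lt p q
            lim_Omega(1)[of q] lim_Omega(2)[of p] theta_cont[OF p] theta_cont[OF q] by simp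
        then show ?thesis
          by (simp only: matrix_vector_mult_add_rdistrib scaleR_matrix_vector_assoc[symmetric] J_axis) simp
      qed
      have "norm (deriv_measure L G {p<..<q} + G p ** deriv_measure L (Omega \<theta> \<phi>) {p<..<q}) \<le> \<epsilon> * (K q - K p)"
      proof (rule K(2)[OF lt sub less_imp_le[OF eps]])
        fix z assume z: "z \<in> {p<..<q}"
        have zS: "z \<in> {0<..<L} - S" using z sub by blast
        have "norm (lim_right G p - lim_right G z) \<le> \<epsilon>"
          using z p q pq sub by (intro small_osc_right[OF d(2), of p q]) auto
        then show "norm (G z - G p) \<le> \<epsilon>" using G_cont[OF p] G_cont[OF zS] by (simp add: norm_minus_commute)
      qed
      moreover have "(deriv_measure L G {p<..<q} + G p ** deriv_measure L (Omega \<theta> \<phi>) {p<..<q}) *v axis 1 1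
        = t q - t p - (\<theta> q - \<theta> p) *\<^sub>R n p"
      proof -
        have "(G p ** deriv_measure L (Omega \<theta> \<phi>) {p<..<q}) *v axis 1 1 = - ((\<theta> q - \<theta> p) *\<^sub>R n p)"
          unfolding matrix_vector_mul_assoc[symmetric] OO n_def
          by (simp add: linear_neg[OF matrix_vector_mul_linear] linear_scale[OF matrix_vector_mul_linear])
        then show ?thesis unfolding GG t_def
          by (simp add: matrix_vector_mult_add_rdistrib matrix_vector_mult_diff_rdistrib)
      qed
      ultimately have 1: "norm (t q - t p - (\<theta> q - \<theta> p) *\<^sub>R n p) \<le> \<epsilon> * (K q - K p) * B"
        using B(2)[of "deriv_measure L G {p<..<q} + G p ** deriv_measure L (Omega \<theta> \<phi>) {p<..<q}"] B(1)
        by (smt (verit) mult_right_mono)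
      have th: "0 \<le> \<theta> q - \<theta> p" using theta_le[of p q] p q lt by auto
      have "F q - F p = (t q - t p - (\<theta> q - \<theta> p) *\<^sub>R n p) + (\<theta> q - \<theta> p) *\<^sub>R (n p - v)"
        by (simp add: F_def algebra_simps)
      also have "norm \<dots> \<le> \<epsilon> * (K q - K p) * B + (\<theta> q - \<theta> p) * \<eta>"
      proof (rule norm_triangle_le[OF add_mono[OF 1]])
        have "norm (n p - v) \<le> \<eta>" using pq ab by (intro le) auto
        then show "norm ((\<theta> q - \<theta> p) *\<^sub>R (n p - v)) \<le> (\<theta> q - \<theta> p) * \<eta>"
          using th by (simp add: mult_left_mono)
      qed
      finally show ?thesis by (simp add: g_def algebra_simps)
    qed simp
  qed
  then have "norm (t b' - t a - (\<theta> b' - \<theta> a) *\<^sub>R v) \<le> \<eta> * (\<theta> b' - \<theta> a) + \<epsilon> * (B * (K b' - K a))"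
    by (simp add: F_def g_def algebra_simps)
  also have "\<epsilon> * (B * (K b' - K a)) \<le> \<epsilon> * R" using eps by (intro mult_left_mono) (auto simp: R_def)
  also have "\<epsilon> * R = e" using R by (simp add: \<epsilon>_def)
  finally show "norm (t b' - t a - (\<theta> b' - \<theta> a) *\<^sub>R v) \<le> \<eta> * (\<theta> b' - \<theta> a) + e" by simp
qed

text \<open>G may jump at x and y, so the estimate is taken in the interior and carried to the ends
  by one-sided limits, first at x and then at y.\<close>

lemma tangent_step:
  assumes xy: "0 \<le> x" "x < y" "y \<le> L" "{x<..<y} \<inter> S = {}"
    and le: "\<And>z. z \<in> {x<..<y} \<Longrightarrow> norm (lim_right n z - v) \<le> \<eta>"
  shows "norm (lim_left t y - lim_right t x - (lim_left \<theta> y - lim_right \<theta> x) *\<^sub>R v)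
    \<le> \<eta> * (lim_left \<theta> y - lim_right \<theta> x)"
proof -
  have le': "norm (n z - v) \<le> \<eta>" if "z \<in> {x<..<y}" for z
  proof -
    have "z \<in> {0<..<L} - S" using that xy by auto
    then show ?thesis using le[OF that] frame_cont(2) by auto
  qed
  have x: "x \<in> {0..<L}" and y: "y \<in> {0<..L}" using xy by auto
  have 1: "norm (t b' - lim_right t x - (\<theta> b' - lim_right \<theta> x) *\<^sub>R v) \<le> \<eta> * (\<theta> b' - lim_right \<theta> x)"
    if b': "x < b'" "b' < y" for b'
  proof (rule tendsto_le)
    show "((\<lambda>a. \<eta> * (\<theta> b' - \<theta> a)) \<longlongrightarrow> \<eta> * (\<theta> b' - lim_right \<theta> x)) (at_right x)"
      by (intro tendsto_intros BV_tendsto_right[OF BV_theta x])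
    show "((\<lambda>a. norm (t b' - t a - (\<theta> b' - \<theta> a) *\<^sub>R v)) \<longlongrightarrow> norm (t b' - lim_right t x - (\<theta> b' - lim_right \<theta> x) *\<^sub>R v)) (at_right x)"
      by (intro tendsto_intros BV_tendsto_right[OF BV_theta x] BV_tendsto_right[OF BV_frame(1) x])
    have "eventually (\<lambda>a. a \<in> {x<..<b'}) (at_right x)" using b' by (intro eventually_at_rightI[of x b']) auto
    then show "\<forall>\<^sub>F a in at_right x. norm (t b' - t a - (\<theta> b' - \<theta> a) *\<^sub>R v) \<le> \<eta> * (\<theta> b' - \<theta> a)"
    proof eventually_elim
      case (elim a)
      then show ?case using b' by (intro tangent_step_interior[OF xy le']) auto
    qed
  qed (simp add: trivial_limit_at_right_real)
  show ?thesis
  proof (rule tendsto_le)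
    show "((\<lambda>a. \<eta> * (\<theta> a - lim_right \<theta> x)) \<longlongrightarrow> \<eta> * (lim_left \<theta> y - lim_right \<theta> x)) (at_left y)"
      by (intro tendsto_intros BV_tendsto_left[OF BV_theta y])
    show "((\<lambda>a. norm (t a - lim_right t x - (\<theta> a - lim_right \<theta> x) *\<^sub>R v)) \<longlongrightarrow>
        norm (lim_left t y - lim_right t x - (lim_left \<theta> y - lim_right \<theta> x) *\<^sub>R v)) (at_left y)"
      by (intro tendsto_intros BV_tendsto_left[OF BV_theta y] BV_tendsto_left[OF BV_frame(1) y])
    have "eventually (\<lambda>a. a \<in> {x<..<y}) (at_left y)" using xy by (intro eventually_at_leftI[of x y]) auto
    then show "\<forall>\<^sub>F a in at_left y. norm (t a - lim_right t x - (\<theta> a - lim_right \<theta> x) *\<^sub>R v) \<le> \<eta> * (\<theta> a - lim_right \<theta> x)"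
      by eventually_elim (use 1 in auto)
  qed (simp add: trivial_limit_at_left_real)
qed

text \<open>K is the cumulative variation of n; it also accounts for jumps of n inside the
  interval.\<close>

lemma normal_step:
  obtains K :: "real \<Rightarrow> real" where "mono K"
    "\<And>x y. 0 \<le> x \<Longrightarrow> x < y \<Longrightarrow> y \<le> L \<Longrightarrow> norm (lim_left n y - lim_right n x) \<le> K y - K x"
proof -
  obtain \<nu> f where d: "has_density {0<..<L} (deriv_measure L n) \<nu> f"
    using BV_distr_deriv[OF BV_frame(2)] unfolding distr_deriv_def by blast
  obtain K :: "real \<Rightarrow> real" where K: "mono K"
    "\<And>x y (g :: real \<Rightarrow> real^3) B. x < y \<Longrightarrow> {x<..<y} \<subseteq> {0<..<L} \<Longrightarrow> integrable \<nu> g \<Longrightarrow> 0 \<le> B \<Longrightarrow>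
      (\<And>z. z \<in> {x<..<y} \<Longrightarrow> norm (g z) \<le> B * norm (f z)) \<Longrightarrow>
      norm (LINT z:{x<..<y}|\<nu>. g z) \<le> B * (K y - K x)"
    using density_cumulative[OF d, where 'b = "real^3"] by blast
  show thesis
  proof (rule that[OF K(1)])
    fix x y assume xy: "0 \<le> x" "x < y" "y \<le> L"
    have sub: "{x<..<y} \<subseteq> {0<..<L}" using xy by auto
    have "norm (LINT z:{x<..<y}|\<nu>. f z) \<le> 1 * (K y - K x)"
      by (rule K(2)[OF xy(2) sub]) (use d in \<open>auto simp: has_density_def\<close>)
    moreover have "deriv_measure L n {x<..<y} = (LINT z:{x<..<y}|\<nu>. f z)"
      using d has_density_sets[OF d _ sub] unfolding has_density_def by auto
    ultimately show "norm (lim_left n y - lim_right n x) \<le> K y - K x"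
      using distr_deriv_interval[OF BV_frame(2) BV_distr_deriv[OF BV_frame(2)] xy] by simp
  qed
qed

section \<open>Increments of the curve\<close>

lemma t_integrable: "t integrable_on {0..L}"
proof -
  have "set_integrable lborel {0<..<L} t" using BV_frame(1) by (simp add: BV_def)
  then show ?thesis
    using set_borel_integral_eq_integral(1) integrable_on_open_interval_real by blast
qed

lemma c_diff:
  assumes "0 \<le> x" "x \<le> y" "y \<le> L"
  shows "(t has_integral (c y - c x)) {x..y}"
proof -
  have "t integrable_on {0..y}" by (rule integrable_on_subinterval[OF t_integrable]) (use assms in auto)
  then have "integral {0..x} t + integral {x..y} t = integral {0..y} t"
    using assms by (intro Henstock_Kurzweil_Integration.integral_combine) auto
  moreover have "t integrable_on {x..y}" by (rule integrable_on_subinterval[OF t_integrable]) (use assms in auto)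
  ultimately show ?thesis unfolding c_def by (metis add_diff_cancel_left' integrable_integral)
qed

lemma c_bound:
  assumes xy: "0 \<le> x" "x \<le> y" "y \<le> L" and "0 \<le> \<eta>"
    and le: "\<And>z. z \<in> {x<..<y} - S \<Longrightarrow> norm (t z - v) \<le> \<eta>"
  shows "norm (c y - c x - (y - x) *\<^sub>R v) \<le> \<eta> * (y - x)"
proof -
  define f where "f z = (if z \<in> {x<..<y} - S then t z - v else 0)" for z
  have "((\<lambda>z. t z - v) has_integral (c y - c x - (y - x) *\<^sub>R v)) {x..y}"
    using has_integral_diff[OF c_diff[OF xy] has_integral_const_real[of v x y]] xy by simp
  then have "(f has_integral (c y - c x - (y - x) *\<^sub>R v)) (cbox x y)"
    unfolding cbox_interval
  proof (rule has_integral_spike[OF negligible_finite, rotated -1])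
    show "finite (S \<union> {x, y})" using S_finite by simp
    show "f z = t z - v" if "z \<in> {x..y} - (S \<union> {x, y})" for z using that by (auto simp: f_def)
  qed
  then have "norm (c y - c x - (y - x) *\<^sub>R v) \<le> \<eta> * measure lborel (cbox x y)"
    by (rule has_integral_bound[OF assms(4)]) (use le assms(4) in \<open>auto simp: f_def\<close>)
  then show ?thesis using xy by simp
qed

lemma c_step:
  assumes xy: "0 \<le> x" "x < y" "y \<le> L" "{x<..<y} \<inter> S = {}"
    and le: "\<And>z. z \<in> {x<..<y} \<Longrightarrow> norm (lim_right t z - v) \<le> \<eta>"
  shows "norm (c y - c x - (y - x) *\<^sub>R v) \<le> \<eta> * (y - x)"
proof (rule c_bound)
  have "(x + y) / 2 \<in> {x<..<y}" using xy by simp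
  from le[OF this] show "0 \<le> \<eta>" using norm_ge_zero order_trans by blast
  fix z assume z: "z \<in> {x<..<y} - S"
  then have "z \<in> {0<..<L} - S" using xy by auto
  then show "norm (t z - v) \<le> \<eta>" using le[of z] z frame_cont(1)[of z] by auto
qed (use xy in auto)

lemma c_lipschitz:
  assumes "0 \<le> x" "x \<le> y" "y \<le> L"
  shows "norm (c y - c x) \<le> y - x"
proof -
  have "norm (t z - 0) \<le> 1" if "z \<in> {x<..<y} - S" for z
    using frame[of z] that assms by (auto simp: oriented_frame_def)
  from c_bound[OF assms _ this] show ?thesis by simp
qed

text \<open>In the left frame the axis is p t + q b, where \<phi> contributes p and \<theta>
  contributes q; since \<theta> jumps upward, q has the sign that \<open>jump_geometry\<close> asks
  for.\<close>

lemma jump_normal: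
  assumes s: "s \<in> S"
  defines "r \<equiv> jump_angle \<theta> \<phi> s"
  shows "vec_angle (lim_left t s) (lim_right t s) \<le> r"
    "\<exists>\<nu> w. norm \<nu> = 1 \<and> 0 \<le> w \<and> cross3 (lim_left t s) (lim_right t s) = w *\<^sub>R \<nu> \<and>
      (w = 0 \<longrightarrow> lim_left t s = lim_right t s) \<and>
      vec_angle (lim_left b s) \<nu> \<le> r / 2 \<and> vec_angle \<nu> (lim_right b s) \<le> r / 2"
proof -
  have sL: "s \<in> {0<..<L}" using S_subset s by blast
  have r: "0 < r" "r < pi" using jump_angle[OF s] by (auto simp: r_def)
  define p q where "p = jump \<phi> s / r" and "q = jump \<theta> s / r"
  have r2: "r\<^sup>2 = (jump \<theta> s)\<^sup>2 + (jump \<phi> s)\<^sup>2" by (simp add: r_def jump_angle_def)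
  have pq: "p\<^sup>2 + q\<^sup>2 = 1"
  proof -
    have "p\<^sup>2 + q\<^sup>2 = ((jump \<theta> s)\<^sup>2 + (jump \<phi> s)\<^sup>2) / r\<^sup>2"
      by (simp add: p_def q_def power_divide add_divide_distrib)
    then show ?thesis unfolding r2[symmetric] using r by simp
  qed
  have q: "0 \<le> q" using theta_between[OF sL] r by (simp add: q_def jump_def)
  have "jump_axis \<theta> \<phi> s = p *\<^sub>R axis 1 1 + q *\<^sub>R axis 3 1"
    by (simp add: jump_axis_def r_def p_def q_def vec_eq_iff forall_3 axis_def)
  then have axis: "lim_left G s *v jump_axis \<theta> \<phi> s = p *\<^sub>R lim_left t s + q *\<^sub>R lim_left b s"
    using lim_frame(1,2)[of s] sL
    by (simp add: matrix_vector_right_distrib linear_scale[OF matrix_vector_mul_linear])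
  have G: "lim_right G s = rotation_about (p *\<^sub>R lim_left t s + q *\<^sub>R lim_left b s) r ** lim_left G s"
    using sol s unfolding frame_solution_def S_def axis[symmetric] r_def by blast
  have tb: "lim_right t s = rotation_about (p *\<^sub>R lim_left t s + q *\<^sub>R lim_left b s) r *v lim_left t s"
    "lim_right b s = rotation_about (p *\<^sub>R lim_left t s + q *\<^sub>R lim_left b s) r *v lim_left b s"
    using lim_frame[of s] sL by (simp_all add: G matrix_vector_mul_assoc)
  have fr: "oriented_frame (lim_left t s) (lim_left n s) (lim_left b s)" using frame_left[of s] sL by simp
  show "vec_angle (lim_left t s) (lim_right t s) \<le> r"
    unfolding tb by (rule jump_geometry(1)[OF fr pq q r])
  show "\<exists>\<nu> w. norm \<nu> = 1 \<and> 0 \<le> w \<and> cross3 (lim_left t s) (lim_right t s) = w *\<^sub>R \<nu> \<and>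
      (w = 0 \<longrightarrow> lim_left t s = lim_right t s) \<and>
      vec_angle (lim_left b s) \<nu> \<le> r / 2 \<and> vec_angle \<nu> (lim_right b s) \<le> r / 2"
    unfolding tb by (rule jump_geometry(2)[OF fr pq q r])
qed

lemma small_osc_joint:
  assumes "0 < \<eta>"
  shows "\<exists>\<delta>>0. small_osc L S t \<eta> \<delta> \<and> small_osc L S n \<eta> \<delta> \<and> small_osc L S b \<eta> \<delta> \<and> small_osc L S \<theta> \<eta> \<delta>"
proof -
  obtain d1 d2 d3 d4 where d: "0 < d1" "small_osc L S t \<eta> d1" "0 < d2" "small_osc L S n \<eta> d2"
    "0 < d3" "small_osc L S b \<eta> d3" "0 < d4" "small_osc L S \<theta> \<eta> d4"
    using BV_small_osc[OF BV_frame(1) frame_cont(1) assms] BV_small_osc[OF BV_frame(2) frame_cont(2) assms]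
      BV_small_osc[OF BV_frame(3) frame_cont(3) assms] BV_small_osc[OF BV_theta theta_cont assms] by metis
  show ?thesis
    using d by (intro exI[of _ "min (min d1 d2) (min d3 d4)"] conjI small_osc_mono[OF d(2)]
        small_osc_mono[OF d(4)] small_osc_mono[OF d(6)] small_osc_mono[OF d(8)]) auto
qed

text \<open>The partition contains S, so no cell has a jump of u in its interior, and the diffuse
  part of a cell is the whole increment between one-sided limits.\<close>

lemma diffuse_part_cells:
  fixes u :: "real \<Rightarrow> real^3"
  assumes u: "BV L u" and cont: "\<And>s. s \<in> {0<..<L} - S \<Longrightarrow> lim_left u s = u s \<and> lim_right u s = u s"
    and nd: "nodes L S N x"
  shows "ennreal (\<Sum>l<N. norm (lim_left u (x (Suc l)) - lim_right u (x l))) \<le> total_variation L (diffuse_part L u)"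
proof -
  let ?A = "\<lambda>l. {x l<..<x (Suc l)}"
  have "diffuse_part L u (?A l) = lim_left u (x (Suc l)) - lim_right u (x l)" if "l < N" for l
  proof -
    note cell = nodes_cell[OF nd that]
    have "jump_set L u \<subseteq> S"
    proof
      fix s assume s: "s \<in> jump_set L u"
      show "s \<in> S"
      proof (rule ccontr)
        assume "s \<notin> S"
        with s have "s \<in> {0<..<L} - S" by (simp add: jump_set_def)
        from cont[OF this] s show False by (simp add: jump_set_def)
      qed
    qed
    then have "jump_set L u \<inter> ?A l = {}" using cell(4) by blast
    then have "jump_part L u (?A l) = 0" by (simp add: jump_part_def)
    then show ?thesis
      using distr_deriv_interval[OF u BV_distr_deriv[OF u], of "x l" "x (Suc l)"] cell
      by (simp add: diffuse_part_def)
  qed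
  then have "(\<Sum>l<N. norm (lim_left u (x (Suc l)) - lim_right u (x l))) = (\<Sum>l<N. norm (diffuse_part L u (?A l)))"
    by (intro sum.cong) auto
  moreover have "ennreal (\<Sum>l<N. norm (diffuse_part L u (?A l))) \<le> total_variation L (diffuse_part L u)"
  proof (rule total_variation_ge)
    show "?A l \<subseteq> {0<..<L}" if "l < N" for l using nodes_cell(1,2)[OF nd that] by auto
    have "?A i \<inter> ?A j = {}" if "i < j" "j < N" for i j
    proof -
      have "x (Suc i) \<le> x j" using nodes_le_iff[OF nd, of "Suc i" j] that by simp
      then show ?thesis by auto
    qed
    then show "disjoint_family_on ?A {..<N}"
      unfolding disjoint_family_on_def by (metis Int_commute lessThan_iff linorder_neqE_nat)
  qed simp
  ultimately show ?thesis by simp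
qed

text \<open>The singletons of the jump points are disjoint, and each carries a mass of norm sqrt 2
  times the rotation angle.\<close>

lemma jump_part_total:
  "ennreal (\<Sum>s\<in>S. jump_angle \<theta> \<phi> s) \<le> ennreal (2 powr (-1/2)) * total_variation L (jump_part L (Omega \<theta> \<phi>))"
proof -
  define xs where "xs = sorted_list_of_set S"
  have xs: "distinct xs" "set xs = S" using S_finite by (simp_all add: xs_def)
  have "ennreal (\<Sum>i<length xs. norm (jump_part L (Omega \<theta> \<phi>) {xs ! i})) \<le> total_variation L (jump_part L (Omega \<theta> \<phi>))"
  proof (rule total_variation_ge)
    show "{xs ! i} \<subseteq> {0<..<L}" if "i < length xs" for i using S_subset xs nth_mem[OF that] by auto
    show "disjoint_family_on (\<lambda>i. {xs ! i}) {..<length xs}"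
      using xs(1) by (auto simp: disjoint_family_on_def nth_eq_iff_index_eq)
  qed simp
  also have "(\<Sum>i<length xs. norm (jump_part L (Omega \<theta> \<phi>) {xs ! i})) = (\<Sum>i<length xs. sqrt 2 * jump_angle \<theta> \<phi> (xs ! i))"
  proof (intro sum.cong refl)
    fix i assume "i \<in> {..<length xs}"
    then have "xs ! i \<in> S" using xs nth_mem by auto
    then have "jump_set L (Omega \<theta> \<phi>) \<inter> {xs ! i} = {xs ! i}" by (auto simp: S_def)
    then show "norm (jump_part L (Omega \<theta> \<phi>) {xs ! i}) = sqrt 2 * jump_angle \<theta> \<phi> (xs ! i)"
      using jump_Omega[OF \<open>xs ! i \<in> S\<close>] by (simp add: jump_part_def)
  qed
  also have "\<dots> = sqrt 2 * (\<Sum>s\<in>S. jump_angle \<theta> \<phi> s)"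
  proof -
    have "(\<Sum>s\<in>S. jump_angle \<theta> \<phi> s) = (\<Sum>i<length xs. jump_angle \<theta> \<phi> (xs ! i))"
      using sum_list_sum_nth[of "map (jump_angle \<theta> \<phi>) xs"] sum_list_distinct_conv_sum_set[OF xs(1), of "jump_angle \<theta> \<phi>"] xs(2)
      by (simp add: atLeast0LessThan)
    then show ?thesis by (simp add: sum_distrib_left)
  qed
  finally have le: "ennreal (2 powr (-1/2)) * ennreal (sqrt 2 * (\<Sum>s\<in>S. jump_angle \<theta> \<phi> s))
    \<le> ennreal (2 powr (-1/2)) * total_variation L (jump_part L (Omega \<theta> \<phi>))" by (rule mult_left_mono) simp
  have "2 powr (-1/2) * sqrt 2 = (1::real)"
    by (simp add: powr_half_sqrt[symmetric] powr_add[symmetric])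
  then have "2 powr (-1/2) * (sqrt 2 * (\<Sum>s\<in>S. jump_angle \<theta> \<phi> s)) = (\<Sum>s\<in>S. jump_angle \<theta> \<phi> s)"
    by (metis mult.assoc mult_1)
  then have "ennreal (\<Sum>s\<in>S. jump_angle \<theta> \<phi> s)
    = ennreal (2 powr (-1/2)) * ennreal (sqrt 2 * (\<Sum>s\<in>S. jump_angle \<theta> \<phi> s))"
    by (metis ennreal_mult' powr_ge_zero)
  then show ?thesis using le by simp
qed

text \<open>The supremum shrinks with the mesh bound, so its limit is an infimum, and one suitable
  mesh bound for every \<eta> is enough.\<close>

lemma TAT_le:
  assumes "\<And>\<eta>. 0 < \<eta> \<Longrightarrow> \<exists>e>0. \<forall>ts. inscribed L ts \<longrightarrow> mesh c ts < e \<longrightarrow> ennreal (TAT_poly (map c ts)) \<le> V + ennreal \<eta>"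
  shows "TAT L c \<le> V"
proof -
  define f where "f \<epsilon> = (SUP ts\<in>{ts. inscribed L ts \<and> mesh c ts < \<epsilon>}. ennreal (TAT_poly (map c ts)))" for \<epsilon> :: real
  have mono: "f e \<le> f e'" if "e \<le> e'" for e e' unfolding f_def by (rule SUP_subset_mono) (use that in auto)
  have "(f \<longlongrightarrow> (INF e\<in>{0<..}. f e)) (at_right 0)"
  proof (rule order_tendstoI)
    fix a assume "a < (INF e\<in>{0<..}. f e)"
    then have "a < f e" if "0 < e" for e using that by (meson INF_lower greaterThan_iff less_le_trans)
    then show "eventually (\<lambda>e. a < f e) (at_right 0)" by (intro eventually_at_rightI[of 0 1]) auto
  next
    fix a assume "(INF e\<in>{0<..}. f e) < a"
    then obtain e where e: "0 < e" "f e < a" by (auto simp: INF_less_iff)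
    then have "f e' < a" if "e' < e" for e' using mono[of e' e] that by (auto intro: le_less_trans)
    then show "eventually (\<lambda>e. f e < a) (at_right 0)" using e by (intro eventually_at_rightI[of 0 e]) auto
  qed
  then have "TAT L c = (INF e\<in>{0<..}. f e)"
    unfolding TAT_def f_def by (intro tendsto_Lim) (simp_all add: trivial_limit_at_right_real)
  also have "\<dots> \<le> V"
  proof (rule ennreal_le_epsilon)
    fix \<eta> :: real assume "0 < \<eta>"
    then obtain e where e: "0 < e" "\<forall>ts. inscribed L ts \<longrightarrow> mesh c ts < e \<longrightarrow> ennreal (TAT_poly (map c ts)) \<le> V + ennreal \<eta>"
      using assms by blast
    have "(INF e\<in>{0<..}. f e) \<le> f e" using e by (intro INF_lower) auto
    also have "\<dots> \<le> V + ennreal \<eta>" unfolding f_def by (rule SUP_least) (use e in auto)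
    finally show "(INF e\<in>{0<..}. f e) \<le> V + ennreal \<eta>" .
  qed
  finally show ?thesis .
qed

theorem curvature_torsion_bounds:
  "TC L c \<le> total_variation L (diffuse_part L t) + ennreal (2 powr (-1/2)) * total_variation L (jump_part L (Omega \<theta> \<phi>))"
  "TAT L c \<le> total_variation L (diffuse_part L b) + ennreal (2 powr (-1/2)) * total_variation L (jump_part L (Omega \<theta> \<phi>))"
proof -
  let ?\<alpha> = "jump_angle \<theta> \<phi>" and ?J = "ennreal (2 powr (-1/2)) * total_variation L (jump_part L (Omega \<theta> \<phi>))"
  obtain \<nu> w where nw: "\<And>s. s \<in> S \<Longrightarrow> norm (\<nu> s) = 1 \<and> 0 \<le> w s \<and> cross3 (lim_left t s) (lim_right t s) = w s *\<^sub>R \<nu> s \<and>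
      (w s = 0 \<longrightarrow> lim_left t s = lim_right t s) \<and>
      vec_angle (lim_left b s) (\<nu> s) \<le> ?\<alpha> s / 2 \<and> vec_angle (\<nu> s) (lim_right b s) \<le> ?\<alpha> s / 2"
    using jump_normal(2) by metis
  obtain K :: "real \<Rightarrow> real" where K: "mono K"
    "\<And>x y. 0 \<le> x \<Longrightarrow> x < y \<Longrightarrow> y \<le> L \<Longrightarrow> norm (lim_left n y - lim_right n x) \<le> K y - K x"
    using normal_step by blast
  interpret mf: moving_frame L S t n b c \<nu> \<theta> ?\<alpha> w K
  proof
    show "norm (lim_right t x) = 1 \<and> norm (lim_right n x) = 1 \<and> norm (lim_right b x) = 1 \<and>
      cross3 (lim_right t x) (lim_right n x) = lim_right b x" if "x \<in> {0..<L}" for x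
      using frame_right[OF that] by (simp add: oriented_frame_def)
    show "norm (lim_left t x) = 1 \<and> norm (lim_left b x) = 1" if "x \<in> {0<..L}" for x
      using frame_left[OF that] by (simp add: oriented_frame_def)
    show "lim_left t x = lim_right t x \<and> lim_left n x = lim_right n x \<and> lim_left b x = lim_right b x"
      if "x \<in> {0<..<L} - S" for x using frame_cont[OF that] by simp
    show "lim_left \<theta> x \<le> lim_right \<theta> x" if "x \<in> {0<..<L}" for x using theta_between[OF that] by simp
    show "K x \<le> K y" if "x \<le> y" for x y using K(1) that by (simp add: mono_def)
    show "0 < ?\<alpha> s \<and> ?\<alpha> s < pi \<and> vec_angle (lim_left t s) (lim_right t s) \<le> ?\<alpha> s \<and>
      vec_angle (lim_left b s) (\<nu> s) \<le> ?\<alpha> s / 2 \<and> vec_angle (\<nu> s) (lim_right b s) \<le> ?\<alpha> s / 2" if "s \<in> S" for s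
      using jump_angle[OF that] jump_normal(1)[OF that] nw[OF that] by simp
  qed (fact L_pos S_finite S_subset small_osc_joint theta_less tangent_step K(2) c_step c_lipschitz | (use nw in blast))+
  have sum0: "0 \<le> (\<Sum>s\<in>S. ?\<alpha> s)" using jump_angle by (intro sum_nonneg) (simp add: less_imp_le)
  \<comment> \<open>The real bound on sums over cells on which the estimates for moving frames rely,
    available once the variation is finite.\<close>
  have V: "(\<Sum>l<N. norm (lim_left u (x (Suc l)) - lim_right u (x l))) \<le> enn2real (total_variation L (diffuse_part L u))"
    if "BV L u" "\<And>s. s \<in> {0<..<L} - S \<Longrightarrow> lim_left u s = u s \<and> lim_right u s = u s" "nodes L S N x"
      "total_variation L (diffuse_part L u) \<noteq> top" for u :: "real \<Rightarrow> real^3" and N x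
  proof -
    have "ennreal (\<Sum>l<N. norm (lim_left u (x (Suc l)) - lim_right u (x l)))
      \<le> ennreal (enn2real (total_variation L (diffuse_part L u)))"
      using diffuse_part_cells[OF that(1-3)] that(4) by (simp add: less_top)
    then show ?thesis by (simp add: ennreal_le_iff)
  qed
  \<comment> \<open>If the variation is infinite, the inequality is trivial.\<close>
  show "TC L c \<le> total_variation L (diffuse_part L t) + ?J"
  proof (cases "total_variation L (diffuse_part L t) = top")
    case False
    let ?V = "enn2real (total_variation L (diffuse_part L t))"
    show ?thesis
      unfolding TC_def
    proof (rule SUP_least)
      fix ts assume "ts \<in> {ts. inscribed L ts}"
      then have "rotation_poly (map c ts) \<le> ?V + (\<Sum>s\<in>S. ?\<alpha> s)"
        by (intro mf.TC_bound V[OF BV_frame(1) frame_cont(1) _ False]) auto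
      then have "ennreal (rotation_poly (map c ts)) \<le> ennreal ?V + ennreal (\<Sum>s\<in>S. ?\<alpha> s)"
        using sum0 by (simp flip: ennreal_plus add: ennreal_leI)
      also have "\<dots> \<le> total_variation L (diffuse_part L t) + ?J"
        using False jump_part_total by (intro add_mono) (simp_all add: less_top)
      finally show "ennreal (rotation_poly (map c ts)) \<le> total_variation L (diffuse_part L t) + ?J" .
    qed
  qed simp
  show "TAT L c \<le> total_variation L (diffuse_part L b) + ?J"
  proof (cases "total_variation L (diffuse_part L b) = top")
    case False
    let ?V = "enn2real (total_variation L (diffuse_part L b))"
    show ?thesis
    proof (rule TAT_le)
      fix \<eta> :: real assume eta: "0 < \<eta>"
      obtain e where e: "0 < e" "\<And>ts. inscribed L ts \<Longrightarrow> mesh c ts < e \<Longrightarrow>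
          TAT_poly (map c ts) \<le> ?V + (\<Sum>s\<in>S. ?\<alpha> s) + \<eta>"
        using mf.TAT_bound[OF V[OF BV_frame(3) frame_cont(3) _ False] eta] by blast
      have "ennreal (TAT_poly (map c ts)) \<le> total_variation L (diffuse_part L b) + ?J + ennreal \<eta>"
        if "inscribed L ts" "mesh c ts < e" for ts
      proof -
        have "ennreal (TAT_poly (map c ts)) \<le> ennreal ?V + ennreal (\<Sum>s\<in>S. ?\<alpha> s) + ennreal \<eta>"
          using e(2)[OF that] sum0 eta by (simp flip: ennreal_plus add: ennreal_leI)
        also have "\<dots> \<le> total_variation L (diffuse_part L b) + ?J + ennreal \<eta>"
          using False jump_part_total by (intro add_mono) (simp_all add: less_top)
        finally show ?thesis .
      qed
      then show "\<exists>e>0. \<forall>ts. inscribed L ts \<longrightarrow> mesh c ts < e \<longrightarrow>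
          ennreal (TAT_poly (map c ts)) \<le> total_variation L (diffuse_part L b) + ?J + ennreal \<eta>"
        using e(1) by blast
    qed
  qed simp
qed

end

theorem corollary4p4:
  fixes L :: real and \<theta> \<phi> :: "real \<Rightarrow> real" and G :: "real \<Rightarrow> real^3^3"
    and t b c :: "real \<Rightarrow> real^3"
  assumes "L > 0"
    and "BV L \<theta>" and "BV L \<phi>"
    and "strict_mono_on {0<..<L} \<theta>"
    and "finite (jump_set L (Omega \<theta> \<phi>))"
    and "\<forall>s\<in>jump_set L (Omega \<theta> \<phi>). 0 < jump_angle \<theta> \<phi> s \<and> jump_angle \<theta> \<phi> s < pi"
    and "frame_solution L \<theta> \<phi> G"
    and "t = (\<lambda>s. G s *v axis 1 1)"
    and "b = (\<lambda>s. G s *v axis 3 1)"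
    and "c = (\<lambda>s. integral {0..s} t)"
  shows "TC L c \<le> total_variation L (diffuse_part L t)
             + ennreal (2 powr (-1/2)) * total_variation L (jump_part L (Omega \<theta> \<phi>)) \<and>
         TAT L c \<le> total_variation L (diffuse_part L b)
             + ennreal (2 powr (-1/2)) * total_variation L (jump_part L (Omega \<theta> \<phi>))"
proof -
  \<comment> \<open>The normal, absent from the statement, is supplied as the second column of
    G.\<close>
  interpret frame_equation L \<theta> \<phi> G t "\<lambda>s. G s *v axis 2 1" b c "jump_set L (Omega \<theta> \<phi>)"
    by unfold_locales (use assms in auto)
  show ?thesis using curvature_torsion_bounds by blast
qed

end
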